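(* There is a polynomial-time algorithm which, given any $(P_7, C_5, \text{kite}, \text{paraglider})$-free graph $G$, produces a (proper) coloring of $G$ with at most $\omega(G)+1$ colors. In particular, every such graph satisfies $\chi(G)\le \omega(G)+1$.
   Context: All graphs are finite and simple. $\omega(G)$ is the clique number and $\chi(G)$ the chromatic number of $G$. A $k$-coloring of $G$ is a function $\phi:V(G)\to\{1,\ldots,k\}$ with $\phi(u)\neq\phi(v)$ whenever $u$ and $v$ are adjacent. Polynomial time is measured in the size of the input graph $G$. $G$ is $(H_1,H_2,\ldots)$-free if no induced subgraph of $G$ is isomorphic to any $H_i$. $P_t$ and $C_t$ denote the path and the cycle on $t$ vertices. A kite is the 5-vertex graph consisting of a $P_4$ and a new vertex adjacent to exactly three consecutive vertices of the $P_4$. A paraglider is the 5-vertex graph consisting of a $C_4$ and a new vertex adjacent to exactly three vertices of the $C_4$. *)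

theory Defs
  imports Main "HOL-Computational_Algebra.Polynomial"
begin

section \<open>Finite simple graphs\<close>

datatype 'a graph = Graph (verts: "'a set") (edges: "'a set set")

definition simple_graph :: "'a graph \<Rightarrow> bool" where
  "simple_graph G \<longleftrightarrow>
     finite (verts G) \<and> edges G \<subseteq> {{u, v} |u v. u \<in> verts G \<and> v \<in> verts G \<and> u \<noteq> v}"

abbreviation adjacent :: "'a graph \<Rightarrow> 'a \<Rightarrow> 'a \<Rightarrow> bool" where
  "adjacent G u v \<equiv> {u, v} \<in> edges G"

definition graph_size :: "'a graph \<Rightarrow> nat" where
  "graph_size G = card (verts G) + card (edges G)"

definition induced_subgraph :: "'a graph \<Rightarrow> 'a set \<Rightarrow> 'a graph" where
  "induced_subgraph G W = Graph W {e \<in> edges G. e \<subseteq> W}"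

definition graph_iso :: "'a graph \<Rightarrow> 'b graph \<Rightarrow> bool" where
  "graph_iso G H \<longleftrightarrow>
     (\<exists>f. bij_betw f (verts G) (verts H) \<and>
          (\<forall>u \<in> verts G. \<forall>v \<in> verts G. adjacent G u v \<longleftrightarrow> adjacent H (f u) (f v)))"

definition free_of :: "'a graph \<Rightarrow> 'b graph set \<Rightarrow> bool" where
  "free_of G \<H> \<longleftrightarrow>
     (\<forall>H \<in> \<H>. \<not> (\<exists>W \<subseteq> verts G. graph_iso (induced_subgraph G W) H))"

definition clique :: "'a graph \<Rightarrow> 'a set \<Rightarrow> bool" where
  "clique G K \<longleftrightarrow> K \<subseteq> verts G \<and> (\<forall>u \<in> K. \<forall>v \<in> K. u \<noteq> v \<longrightarrow> adjacent G u v)"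

definition clique_number :: "'a graph \<Rightarrow> nat" where
  "clique_number G = Max (card ` {K. clique G K})"

definition coloring :: "'a graph \<Rightarrow> nat \<Rightarrow> ('a \<Rightarrow> nat) \<Rightarrow> bool" where
  "coloring G k \<phi> \<longleftrightarrow>
     (\<forall>v \<in> verts G. \<phi> v \<in> {1..k}) \<and>
     (\<forall>u \<in> verts G. \<forall>v \<in> verts G. adjacent G u v \<longrightarrow> \<phi> u \<noteq> \<phi> v)"

definition chromatic_number :: "'a graph \<Rightarrow> nat" where
  "chromatic_number G = (LEAST k. \<exists>\<phi>. coloring G k \<phi>)"

definition path_graph :: "nat \<Rightarrow> nat graph" where
  "path_graph t = Graph {..<t} {{i, i + 1} |i. i + 1 < t}"

text \<open>A cycle on \<open>t\<close> vertices only for \<open>t \<ge> 3\<close>.\<close>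

definition cycle_graph :: "nat \<Rightarrow> nat graph" where
  "cycle_graph t = Graph {..<t} {{i, (i + 1) mod t} |i. i < t}"

definition add_vertex :: "'a graph \<Rightarrow> 'a \<Rightarrow> 'a set \<Rightarrow> 'a graph" where
  "add_vertex G x N = Graph (insert x (verts G)) (edges G \<union> {{x, v} |v. v \<in> N})"

definition kite :: "nat graph" where
  "kite = add_vertex (path_graph 4) 4 {0, 1, 2}"

definition paraglider :: "nat graph" where
  "paraglider = add_vertex (cycle_graph 4) 4 {0, 1, 2}"


section \<open>Polynomial-time computation\<close>

text \<open>
  The machine model is a unit-cost random access machine, presented as a structured while
  language over finitely many (per program) unbounded arrays of natural numbers. A cell is named
  by an array name and two indices; scalars and one-dimensional arrays are obtained by fixing
  indices to 0. Arithmetic is restricted to addition and truncated subtraction. With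
  multiplication at unit cost, the model would be stronger than Turing machines; without it,
  a run of \<open>t\<close> steps only creates numbers of bit length linear in \<open>t\<close> and the input length and
  writes at most \<open>t\<close> cells, so polynomial time agrees with polynomial time on Turing machines.
\<close>

type_synonym name = string
type_synonym state = "name \<Rightarrow> nat \<Rightarrow> nat \<Rightarrow> nat"

datatype aexp =
    Const nat
  | Cell name aexp aexp
  | Plus aexp aexp
  | Minus aexp aexp

datatype bexp =
    Less aexp aexp
  | BNot bexp
  | BAnd bexp bexp

datatype com =
    Skip
  | Assign name aexp aexp aexp
  | Seq com com
  | Cond bexp com com
  | While bexp com

fun aval :: "aexp \<Rightarrow> state \<Rightarrow> nat" where
  "aval (Const k) s = k"
| "aval (Cell x a b) s = s x (aval a s) (aval b s)"
| "aval (Plus a b) s = aval a s + aval b s"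
| "aval (Minus a b) s = aval a s - aval b s"

fun bval :: "bexp \<Rightarrow> state \<Rightarrow> bool" where
  "bval (Less a b) s \<longleftrightarrow> aval a s < aval b s"
| "bval (BNot b) s \<longleftrightarrow> \<not> bval b s"
| "bval (BAnd b b') s \<longleftrightarrow> bval b s \<and> bval b' s"

definition store :: "state \<Rightarrow> name \<Rightarrow> nat \<Rightarrow> nat \<Rightarrow> nat \<Rightarrow> state" where
  "store s x i j k = s(x := (s x)(i := (s x i)(j := k)))"

text \<open>
  \<open>exec c s t s'\<close>: started in \<open>s\<close>, the program \<open>c\<close> halts in \<open>s'\<close> after exactly \<open>t\<close> steps.
  Every assignment and every evaluation of a test is one step; the expressions of a program have
  a size independent of the input, so charging for their nodes would only change \<open>t\<close> by a
  constant factor.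
\<close>

inductive exec :: "com \<Rightarrow> state \<Rightarrow> nat \<Rightarrow> state \<Rightarrow> bool" where
  Skip: "exec Skip s 1 s"
| Assign: "exec (Assign x a b e) s 1 (store s x (aval a s) (aval b s) (aval e s))"
| Seq: "exec c1 s t1 s' \<Longrightarrow> exec c2 s' t2 s'' \<Longrightarrow> exec (Seq c1 c2) s (t1 + t2) s''"
| CondTrue: "bval b s \<Longrightarrow> exec c1 s t s' \<Longrightarrow> exec (Cond b c1 c2) s (t + 1) s'"
| CondFalse: "\<not> bval b s \<Longrightarrow> exec c2 s t s' \<Longrightarrow> exec (Cond b c1 c2) s (t + 1) s'"
| WhileFalse: "\<not> bval b s \<Longrightarrow> exec (While b c) s 1 s"
| WhileTrue: "bval b s \<Longrightarrow> exec c s t1 s' \<Longrightarrow> exec (While b c) s' t2 s'' \<Longrightarrow>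
    exec (While b c) s (t1 + t2 + 1) s''"

text \<open>
  A graph on \<open>{0..<n}\<close> is given to a program by \<open>n\<close> in the scalar \<open>n\<close> and its adjacency matrix
  in the array \<open>adj\<close>; all other cells are 0. A vertex labelling is returned in the array \<open>out\<close>.
\<close>

definition graph_input :: "nat graph \<Rightarrow> state" where
  "graph_input G = (\<lambda>x i j.
     if x = ''n'' \<and> i = 0 \<and> j = 0 then card (verts G)
     else if x = ''adj'' \<and> adjacent G i j then 1
     else 0)"

definition labelling_output :: "state \<Rightarrow> nat \<Rightarrow> nat" where
  "labelling_output s v = s ''out'' v 0"

text \<open>
  On every simple graph satisfying \<open>P\<close>, presented on an initial segment of the natural numbers,
  the program halts in time polynomial in the size of the graph with a labelling related to the
  graph by \<open>R\<close>. Its behaviour on other inputs is not constrained.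
\<close>

definition poly_time_labelling ::
    "com \<Rightarrow> (nat graph \<Rightarrow> bool) \<Rightarrow> (nat graph \<Rightarrow> (nat \<Rightarrow> nat) \<Rightarrow> bool) \<Rightarrow> bool" where
  "poly_time_labelling c P R \<longleftrightarrow>
     (\<exists>p :: nat poly. \<forall>G. simple_graph G \<and> (\<exists>n. verts G = {..<n}) \<and> P G \<longrightarrow>
        (\<exists>t s. exec c (graph_input G) t s \<and> t \<le> poly p (graph_size G) \<and>
               R G (labelling_output s)))"

end

theory Submission imports Defs begin

text \<open>Every nonempty induced subgraph has a removable vertex \<open>v\<close>: either \<open>N(v)\<close> is contained in \<open>N(z)\<close> for
  some non-neighbour \<open>z\<close>, or, up to vertices adjacent to the whole rest of \<open>N(v)\<close>, the neighbourhood is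
  a disjoint union of cliques of which at most two have more than one vertex. If there is a diamond,
  a largest connected non-clique set of neighbours of some vertex yields a vertex of the first kind or
  a proper subset attached to the rest of the graph by a clique, and induction applies. In a
  diamond-free graph, one of two vertices of a hole of length 7, or else an end of a longest induced
  path, is removable.

  A removable vertex can be coloured last. Given at least \<open>\<omega> + 1\<close> colours on the rest, some pair of
  colours \<open>a, b\<close> admits a Kempe change that frees \<open>a\<close> at \<open>v\<close>: otherwise every two colours are linked
  by an alternating path that closes with \<open>v\<close> to a hole of length 7 (unless they occur on an edge inside
  \<open>N(v)\<close>). Counting colours gives three colours pairwise linked by such holes, or one colour linked to
  both colours of an edge; either configuration has at most 16 vertices and contains a forbidden
  subgraph. Hence colouring greedily along an elimination order by removable
  vertices, with Kempe changes, and opening a new colour only when no Kempe change succeeds,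
  never needs more than \<open>\<omega> + 1\<close> colours.\<close>

section \<open>Forbidden patterns\<close>

text \<open>The algorithm never looks at \<open>\<omega>\<close>, which it would have no evident way
  to compute; the bound comes from counting. A vertex \<open>v\<close>, its universal neighbours and
  any clique among its other neighbours form a clique. So if all of \<open>k > \<omega>\<close>
  colours occur at \<open>v\<close>, the other neighbours carry at least two colours more than their
  largest clique has vertices. With \<open>k = \<omega>\<close> the surplus would only be one: this
  is what the extra colour buys. The length 7 is forced: an odd hole of length 5 is forbidden and
  one of length at least 9 contains a \<open>P_7\<close>. A vertex \<open>v\<close> with
  \<open>N(v)\<close> inside \<open>N(z)\<close> fits the same scheme: the colour of
  \<open>z\<close> is absent from \<open>N(v)\<close>, and taking it is the Kempe change with
  \<open>a = b\<close>. Removability speaks only about adjacency among the remaining vertices, so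
  the elimination order is fixed before any colour is chosen. It is also a first-order condition
  with a fixed number of quantifiers over vertices; hence it compiles to nested loops whose cost
  polynomial is read off from the syntax.\<close>

definition ind_P7 :: "('a \<Rightarrow> 'a \<Rightarrow> bool) \<Rightarrow> 'a \<Rightarrow> 'a \<Rightarrow> 'a \<Rightarrow> 'a \<Rightarrow> 'a \<Rightarrow> 'a \<Rightarrow> 'a \<Rightarrow> bool" where
  "ind_P7 E a b c d e f g \<longleftrightarrow>
     E a b \<and> E b c \<and> E c d \<and> E d e \<and> E e f \<and> E f g \<and>
     \<not> E a c \<and> \<not> E a d \<and> \<not> E a e \<and> \<not> E a f \<and> \<not> E a g \<and>
     \<not> E b d \<and> \<not> E b e \<and> \<not> E b f \<and> \<not> E b g \<and>
     \<not> E c e \<and> \<not> E c f \<and> \<not> E c g \<and> \<not> E d f \<and> \<not> E d g \<and> \<not> E e g"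

definition ind_C5 :: "('a \<Rightarrow> 'a \<Rightarrow> bool) \<Rightarrow> 'a \<Rightarrow> 'a \<Rightarrow> 'a \<Rightarrow> 'a \<Rightarrow> 'a \<Rightarrow> bool" where
  "ind_C5 E a b c d e \<longleftrightarrow>
     E a b \<and> E b c \<and> E c d \<and> E d e \<and> E a e \<and>
     \<not> E a c \<and> \<not> E a d \<and> \<not> E b d \<and> \<not> E b e \<and> \<not> E c e"

definition ind_C7 :: "('a \<Rightarrow> 'a \<Rightarrow> bool) \<Rightarrow> 'a \<Rightarrow> 'a \<Rightarrow> 'a \<Rightarrow> 'a \<Rightarrow> 'a \<Rightarrow> 'a \<Rightarrow> 'a \<Rightarrow> bool" where
  "ind_C7 E a b c d e f g \<longleftrightarrow>
     E a b \<and> E b c \<and> E c d \<and> E d e \<and> E e f \<and> E f g \<and> E a g \<and>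
     \<not> E a c \<and> \<not> E a d \<and> \<not> E a e \<and> \<not> E a f \<and>
     \<not> E b d \<and> \<not> E b e \<and> \<not> E b f \<and> \<not> E b g \<and>
     \<not> E c e \<and> \<not> E c f \<and> \<not> E c g \<and> \<not> E d f \<and> \<not> E d g \<and> \<not> E e g"

definition ind_kite :: "('a \<Rightarrow> 'a \<Rightarrow> bool) \<Rightarrow> 'a \<Rightarrow> 'a \<Rightarrow> 'a \<Rightarrow> 'a \<Rightarrow> 'a \<Rightarrow> bool" where
  "ind_kite E a b c d x \<longleftrightarrow>
     E a b \<and> E b c \<and> E c d \<and> \<not> E a c \<and> \<not> E a d \<and> \<not> E b d \<and>
     E a x \<and> E b x \<and> E c x \<and> \<not> E d x"

text \<open>Distinctness has to be required only of \<open>a\<close> and \<open>c\<close>: in every other pair of vertices of one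
  of these patterns, the two are adjacent or separated by a third vertex.\<close>

definition ind_paraglider :: "('a \<Rightarrow> 'a \<Rightarrow> bool) \<Rightarrow> 'a \<Rightarrow> 'a \<Rightarrow> 'a \<Rightarrow> 'a \<Rightarrow> 'a \<Rightarrow> bool" where
  "ind_paraglider E a b c d x \<longleftrightarrow> a \<noteq> c \<and>
     E a b \<and> E b c \<and> E c d \<and> E a d \<and> \<not> E a c \<and> \<not> E b d \<and>
     E a x \<and> E b x \<and> E c x \<and> \<not> E d x"

text \<open>The relation lives on the whole type, so an induced subgraph is just a vertex set, which
  inductions can shrink without touching the relation.\<close>

locale pckp_free =
  fixes E :: "'a \<Rightarrow> 'a \<Rightarrow> bool"
  assumes commute: "E x y = E y x"
    and irrefl [simp]: "\<not> E x x"
    and no_P7: "\<not> ind_P7 E a b c d e f g"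
    and no_C5: "\<not> ind_C5 E a b c d e"
    and no_kite: "\<not> ind_kite E a b c d x"
    and no_paraglider: "\<not> ind_paraglider E a b c d x"
begin

lemmas patterns = ind_P7_def ind_C5_def ind_C7_def ind_kite_def

definition diamond_free :: "'a set \<Rightarrow> bool" where
  "diamond_free X \<longleftrightarrow>
     (\<forall>x\<in>X. \<forall>y\<in>X. \<forall>z\<in>X. \<forall>w\<in>X.
        E x y \<longrightarrow> E x z \<longrightarrow> E y z \<longrightarrow> E x w \<longrightarrow> E y w \<longrightarrow> z \<noteq> w \<longrightarrow> E z w)"

text \<open>In use, \<open>p\<close> and \<open>q\<close> are the two neighbours of \<open>v\<close>
  on a hole of length 7, and \<open>v a a'\<close> is a triangle at \<open>v\<close> off the
  hole.\<close>

definition free_pair :: "'a \<Rightarrow> 'a \<Rightarrow> 'a \<Rightarrow> 'a \<Rightarrow> 'a \<Rightarrow> bool" where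
  "free_pair v p q a a' \<longleftrightarrow>
     E v a \<and> E v a' \<and> E a a' \<and> \<not> E p a \<and> \<not> E p a' \<and> \<not> E q a \<and> \<not> E q a'"

text \<open>This lemma and the two on chains below are propositional: the listed instances of the forbidden
  patterns form an unsatisfiable core found by a SAT solver. Distinctness is not assumed.\<close>

lemma C7_no_free_pairs:
  assumes C: "ind_C7 E c0 c1 c2 c3 c4 c5 c6"
    and a: "free_pair c0 c1 c6 a a'"
    and b: "free_pair c3 c2 c4 b b'"
    and X: "{c0, c1, c2, c3, c4, c5, c6, a, a', b, b'} \<subseteq> X" "diamond_free X"
  shows False
proof -
  have dia: "\<not> (x \<in> X \<and> y \<in> X \<and> z \<in> X \<and> w \<in> X \<and>
      E x y \<and> E x z \<and> E y z \<and> E x w \<and> E y w \<and> z \<noteq> w \<and> \<not> E z w)" for x y z w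
    using X(2) unfolding diamond_free_def by blast
  have distinct: "a' \<noteq> c1" "b \<noteq> c0" "c0 \<noteq> b'" "c0 \<noteq> c2" "c0 \<noteq> c5" "c1 \<noteq> a" "c1 \<noteq> c3" "c2 \<noteq> b" "c2 \<noteq> b'" "c3 \<noteq> a" "c3 \<noteq> a'" "c3 \<noteq> c5"
    using C a b commute unfolding ind_C7_def free_pair_def by metis+
  show False
    using C a b X(1) distinct
    no_C5[of a c0 c1 c2 c3] no_C5[of a b b' c5 a'] no_C5[of c2 c3 b c0 a] no_C5[of c1 c2 c3 b' c0]
    no_C5[of a' a b' b c5] no_C5[of b' b c1 c0 a'] no_C5[of c3 c2 a' a b']
    no_C5[of c1 c2 c3 a' c0] no_C5[of a a' b' b c5] no_C5[of c6 c0 a' c4 c5]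
    no_C5[of c5 b' b a' a] no_C5[of b b' c6 c0 c1] no_C5[of c6 c0 a c4 c5] no_C5[of c3 c2 a a' b]
    no_C5[of c5 c4 c3 b c6] no_C5[of c0 c1 b' b a] no_C5[of b' c6 c5 c4 c3]
    no_C5[of c2 c3 b c0 c1] no_C5[of c2 c1 b' a a'] no_C5[of c1 b' a' a c2]
    no_P7[of a' c0 c1 c2 c3 c4 c5] no_P7[of c6 c5 a a' c2 c1 b] no_P7[of c6 c5 a a' c2 c1 b']
    no_P7[of c1 c0 c6 c5 c4 c3 b'] no_P7[of b c3 c4 c5 c6 c0 a] no_P7[of b c3 c4 c5 c6 c0 c1]
    no_P7[of b' c1 c2 a a' c5 c6] no_P7[of c2 a' c0 c6 c5 b' b] no_P7[of c4 c5 b' b c1 c2 a]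
    no_P7[of a c0 c1 c2 c3 c4 c5] dia[of b b' c3 a] dia[of a c3 c2 b'] dia[of c0 b c1 a]
    dia[of b' c0 a' c1] dia[of b b' c1 c3] dia[of a a' c0 b'] dia[of a' c3 c2 b]
    dia[of a a' c0 c2] dia[of a a' b c0] dia[of b b' c3 a'] dia[of b' b c3 c5] dia[of a a' c0 c5]
    \<comment> \<open>\<open>commute\<close> works as an ordered rewrite rule that identifies
      \<open>E x y\<close> with \<open>E y x\<close>, so each pair of vertices becomes a single
      propositional atom.\<close>
    apply (simp (no_asm_use) only: patterns free_pair_def commute insert_subset)
    by sat
qed

end

locale coloured_pckp_free = pckp_free +
  fixes S :: "'a set" and \<phi> :: "'a \<Rightarrow> nat"
  assumes proper: "x \<in> S \<Longrightarrow> y \<in> S \<Longrightarrow> E x y \<Longrightarrow> \<phi> x \<noteq> \<phi> y"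
begin

definition chain :: "'a \<Rightarrow> 'a \<Rightarrow> 'a \<Rightarrow> 'a \<Rightarrow> 'a \<Rightarrow> 'a \<Rightarrow> 'a \<Rightarrow> bool" where
  "chain v a p q r s b \<longleftrightarrow> ind_C7 E v a p q r s b \<and> {a, p, q, r, s, b} \<subseteq> S \<and>
     \<phi> p = \<phi> b \<and> \<phi> q = \<phi> a \<and> \<phi> r = \<phi> b \<and> \<phi> s = \<phi> a"

lemma independent:
  assumes "\<forall>x\<in>X. x \<in> S \<and> \<phi> x = c"
  shows "\<forall>x\<in>X. \<forall>y\<in>X. \<not> E x y"
  using assms proper by metis

lemma no_three_chains:
  assumes "chain v a p1 p2 p3 p4 b" "chain v b q1 q2 q3 q4 c" "chain v c r1 r2 r3 r4 a"
  shows False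
proof -
  note cycles = assms[unfolded chain_def ind_C7_def]
  \<comment> \<open>Properness enters the propositional core only through the three colour classes:
    each colour occurs on two of the three chains.\<close>
  have nonadj1:
    "\<forall>x\<in>{a, p2, p4, r1, r3}. \<forall>y\<in>{a, p2, p4, r1, r3}. \<not> E x y"
    by (rule independent[of _ "\<phi> a"]) (use cycles in auto)
  have nonadj2:
    "\<forall>x\<in>{b, p1, p3, q2, q4}. \<forall>y\<in>{b, p1, p3, q2, q4}. \<not> E x y"
    by (rule independent[of _ "\<phi> b"]) (use cycles in auto)
  have nonadj3:
    "\<forall>x\<in>{c, q1, q3, r2, r4}. \<forall>y\<in>{c, q1, q3, r2, r4}. \<not> E x y"
    by (rule independent[of _ "\<phi> c"]) (use cycles in auto)
  show False
    using cycles nonadj1 nonadj2 nonadj3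
    no_C5[of q1 p1 a v b] no_C5[of c v b r2 q4] no_C5[of q1 a q4 q3 q2] no_C5[of q1 p1 c v b]
    no_C5[of a v b p4 q4] no_C5[of q4 r3 r2 r1 c] no_C5[of c r1 q2 r4 q4] no_C5[of p1 p2 p3 r1 c]
    no_C5[of r1 c v a q2] no_C5[of p2 p1 a v c] no_C5[of b v a q2 r2] no_C5[of p4 q3 a v b]
    no_C5[of b p4 q2 a v] no_C5[of q1 p3 c v b] no_C5[of b v a q2 q1] no_C5[of c p4 q1 a v]
    no_C5[of c q4 p2 q1 p4] no_C5[of q1 p2 p3 p4 b] no_C5[of q3 q2 r4 a q4]
    no_C5[of a q4 r1 q2 r4] no_C5[of r1 b v a p1] no_C5[of r1 c q4 q3 q2] no_C5[of p4 q1 a p1 r2]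
    no_C5[of q1 a p1 p2 p3] no_C5[of v c r1 p1 a] no_C5[of b v c r1 r2] no_C5[of p1 r3 b v a]
    no_C5[of v b q1 r1 c] no_C5[of p1 q3 q2 q1 a] no_C5[of r1 q4 a v b] no_C5[of v b q1 p2 c]
    no_C5[of b r4 q4 c v] no_C5[of v c r1 q1 a] no_C5[of r1 r2 q2 q1 b] no_C5[of c r1 q3 a v]
    no_C5[of r4 a v b r3] no_C5[of c v a q3 q4] no_C5[of v b p4 p3 c] no_C5[of r4 p1 r2 r1 b]
    no_C5[of c q4 p2 p3 p4] no_C5[of r1 q3 q2 q1 b] no_C5[of a r4 q4 c v] no_C5[of p1 q3 q2 r4 a]
    no_C5[of b v a p1 r2] no_C5[of b p4 q3 q2 q1] no_P7[of q2 p2 p1 a v b r1]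
    no_P7[of q2 q3 q4 c v a p1] no_P7[of p3 p2 p1 a v b r1] no_P7[of r2 q2 q1 b v c p1]
    no_P7[of q2 q1 b v c q4 r2] no_P7[of b v c q4 q3 q2 r4] no_P7[of q1 q2 q3 q4 c r1 r2]
    no_P7[of q2 q1 b v a p1 p2] no_P7[of q2 q1 b v c r1 r2] no_P7[of b q1 q2 q3 q4 c p1]
    no_P7[of r1 r2 r3 r4 a v b] no_P7[of q2 q1 b p4 p3 p2 p1] no_P7[of p2 p1 r4 b v c r1]
    no_P7[of q1 q2 q3 q4 c v a] no_P7[of c q4 q3 q2 q1 b r4] no_P7[of v a p1 p2 p3 p4 q2]
    no_P7[of q2 q3 q4 c v b p4] no_P7[of r1 c v b q1 q2 q3] no_P7[of p1 a v c r1 r2 r3]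
    no_P7[of p2 p3 p4 b v a q4] no_P7[of p3 p4 b v a p1 r3] no_P7[of r1 q3 q2 a v b p4]
    no_P7[of r1 r2 q2 a v b p4] no_P7[of q3 q2 a v c r1 r2] no_P7[of r4 a v b q1 q2 q3]
    no_P7[of c v b p4 p3 p2 p1] no_P7[of q2 q3 q4 c v a r4] no_P7[of b p4 p3 r3 p1 a q4]
    no_kite[of r3 p1 a v r4] no_kite[of p2 p1 a v r4]
    apply (simp (no_asm_use) only: patterns commute ball_simps)
    by sat
qed

lemma no_two_chains:
  assumes "chain v a p1 p2 p3 p4 b" "chain v a q1 q2 q3 q4 b'"
    and "E v a'" "E a a'" "E b b'" "\<not> E a' b" "\<not> E a' b'"
  shows False
proof -
  note cycles = assms(1,2)[unfolded chain_def ind_C7_def]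
  \<comment> \<open>\<open>b\<close> and \<open>b'\<close> are adjacent and hence coloured
    differently, so only the class of \<open>a\<close> combines vertices of both chains.\<close>
  have nonadj1:
    "\<forall>x\<in>{a, p2, p4, q2, q4}. \<forall>y\<in>{a, p2, p4, q2, q4}. \<not> E x y"
    by (rule independent[of _ "\<phi> a"]) (use cycles in auto)
  have nonadj2:
    "\<forall>x\<in>{b, p1, p3}. \<forall>y\<in>{b, p1, p3}. \<not> E x y"
    by (rule independent[of _ "\<phi> b"]) (use cycles in auto)
  have nonadj3:
    "\<forall>x\<in>{b', q1, q3}. \<forall>y\<in>{b', q1, q3}. \<not> E x y"
    by (rule independent[of _ "\<phi> b'"]) (use cycles in auto)
  show False
    using cycles nonadj1 nonadj2 nonadj3 assms(3-)
    no_kite[of q4 b v a b'] no_kite[of q1 a' v b' a] no_kite[of q3 b q1 a q2]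
    no_kite[of p1 p2 p3 p4 b'] no_kite[of p4 b v a b'] no_kite[of p1 a v b a']
    no_C5[of p1 p2 b' v a] no_C5[of v a' p3 p4 b] no_C5[of q4 a' p4 b b'] no_C5[of v b q2 q1 a]
    no_C5[of q2 a' v b q3] no_C5[of v a' q3 q4 b'] no_C5[of p2 a' v b' p3]
    no_P7[of a a' q2 q3 q4 b' b] no_P7[of p4 p3 p2 p1 a v b'] no_P7[of q3 q4 b' b q1 a a']
    no_P7[of a' v b p4 p3 p2 p1] no_P7[of q1 q2 q3 q4 b' v a'] no_P7[of p3 p4 b b' p1 a a']
    apply (simp (no_asm_use) only: patterns commute ball_simps)
    by sat
qed

end

context pckp_free
begin

section \<open>Removable vertices\<close>

definition ipath :: "'a set \<Rightarrow> 'a list \<Rightarrow> bool" where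
  "ipath X xs \<longleftrightarrow> set xs \<subseteq> X \<and> distinct xs \<and>
     (\<forall>j<length xs. \<forall>i<j. E (xs ! i) (xs ! j) \<longleftrightarrow> j = Suc i)"

definition nonuniversal :: "'a set \<Rightarrow> 'a \<Rightarrow> 'a \<Rightarrow> bool" where
  "nonuniversal X v x \<longleftrightarrow> x \<in> X \<and> E v x \<and> (\<exists>y\<in>X. E v y \<and> y \<noteq> x \<and> \<not> E x y)"

definition linked :: "'a set \<Rightarrow> 'a \<Rightarrow> 'a \<Rightarrow> bool" where
  "linked X v x \<longleftrightarrow> nonuniversal X v x \<and> (\<exists>y\<in>X. nonuniversal X v y \<and> E x y)"

text \<open>Transitivity of adjacency makes the non-universal neighbours a disjoint union of
  cliques. Three pairwise nonadjacent \<open>linked\<close> vertices would witness three cliques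
  with an edge. All quantifiers are bounded by \<open>X\<close>, so the definition translates
  literally into a test.\<close>

definition two_clique_vertex :: "'a set \<Rightarrow> 'a \<Rightarrow> bool" where
  "two_clique_vertex X v \<longleftrightarrow>
     (\<forall>x\<in>X. \<forall>y\<in>X. \<forall>z\<in>X. nonuniversal X v x \<and> nonuniversal X v y \<and> nonuniversal X v z \<and>
        E x y \<and> E y z \<and> x \<noteq> z \<longrightarrow> E x z) \<and>
     \<not> (\<exists>x\<in>X. \<exists>y\<in>X. \<exists>z\<in>X. linked X v x \<and> linked X v y \<and> linked X v z \<and>
        x \<noteq> y \<and> y \<noteq> z \<and> x \<noteq> z \<and> \<not> E x y \<and> \<not> E y z \<and> \<not> E x z)"

definition dominated :: "'a set \<Rightarrow> 'a \<Rightarrow> bool" where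
  "dominated X v \<longleftrightarrow> (\<exists>z\<in>X. z \<noteq> v \<and> \<not> E v z \<and> (\<forall>x\<in>X. E v x \<longrightarrow> E z x))"

definition removable :: "'a set \<Rightarrow> 'a \<Rightarrow> bool" where
  "removable X v \<longleftrightarrow> dominated X v \<or> two_clique_vertex X v"

section \<open>Removable vertices in diamond-free graphs\<close>

lemma diamond_freeD:
  "diamond_free X \<Longrightarrow> x \<in> X \<Longrightarrow> y \<in> X \<Longrightarrow> z \<in> X \<Longrightarrow> w \<in> X \<Longrightarrow>
   E x y \<Longrightarrow> E x z \<Longrightarrow> E y z \<Longrightarrow> E x w \<Longrightarrow> E y w \<Longrightarrow> z \<noteq> w \<Longrightarrow> E z w"
  unfolding diamond_free_def by blast

text \<open>The triangles \<open>v x y\<close> and \<open>v y z\<close> share the edge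
  \<open>v y\<close>. Consequently the neighbourhood of a vertex is a disjoint union of
  cliques.\<close>

lemma diamond_free_clique_neighbourhood:
  assumes "diamond_free X" "{v, x, y, z} \<subseteq> X" "E v x" "E v y" "E v z" "E x y" "E y z" "x \<noteq> z"
  shows "E x z"
  using assms diamond_freeD[of X v y x z] commute by auto

text \<open>The transitivity clause of \<open>two_clique_vertex\<close> is automatic here, so its
  failure means three cliques with an edge each.\<close>

lemma diamond_free_three_edges:
  assumes X: "diamond_free X" "v \<in> X" and "\<not> two_clique_vertex X v"
  obtains x x' y y' z z' where "{x, x', y, y', z, z'} \<subseteq> X"
    "E v x" "E v x'" "E x x'" "E v y" "E v y'" "E y y'" "E v z" "E v z'" "E z z'"
    "x \<noteq> y" "y \<noteq> z" "x \<noteq> z" "\<not> E x y" "\<not> E y z" "\<not> E x z"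
proof -
  have nbr: "x \<in> X \<and> E v x" if "nonuniversal X v x" for x
    using that unfolding nonuniversal_def by blast
  have "\<forall>x\<in>X. \<forall>y\<in>X. \<forall>z\<in>X. nonuniversal X v x \<and> nonuniversal X v y \<and> nonuniversal X v z \<and>
        E x y \<and> E y z \<and> x \<noteq> z \<longrightarrow> E x z"
  proof (intro ballI impI, elim conjE)
    fix x y z
    assume "nonuniversal X v x" "nonuniversal X v y" "nonuniversal X v z" "E x y" "E y z" "x \<noteq> z"
    then show "E x z"
      using diamond_free_clique_neighbourhood[OF X(1), of v x y z] X(2) nbr by simp
  qed
  then obtain x y z where *: "linked X v x" "linked X v y" "linked X v z"
        "x \<noteq> y" "y \<noteq> z" "x \<noteq> z" "\<not> E x y" "\<not> E y z" "\<not> E x z"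
    using assms(3) unfolding two_clique_vertex_def by blast
  obtain x' where "x \<in> X" "E v x" "x' \<in> X" "E v x'" "E x x'"
    using *(1) nbr unfolding linked_def by blast
  moreover obtain y' where "y \<in> X" "E v y" "y' \<in> X" "E v y'" "E y y'"
    using *(2) nbr unfolding linked_def by blast
  moreover obtain z' where "z \<in> X" "E v z" "z' \<in> X" "E v z'" "E z z'"
    using *(3) nbr unfolding linked_def by blast
  ultimately show thesis
    using *(4-) by (intro that[of x x' y y' z z']) auto
qed

text \<open>The two edges lie in different cliques of the neighbourhood of \<open>v\<close>, and
  \<open>p\<close> belongs to only one clique.\<close>

lemma diamond_free_avoid:
  assumes X: "diamond_free X" "{v, x, x', y, y', p} \<subseteq> X"
    and v: "E v x" "E v x'" "E x x'" "E v y" "E v y'" "E y y'" "x \<noteq> y" "\<not> E x y" "E v p"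
  shows "(\<not> E p x \<and> \<not> E p x') \<or> (\<not> E p y \<and> \<not> E p y')"
proof (rule ccontr)
  assume H: "\<not> ?thesis"
  note N = diamond_free_clique_neighbourhood[OF X(1)]
  have "E p x \<or> p = x"
    using H X(2) v N[of v p x' x] N[of v p y' y] commute by auto
  moreover have "E p y \<or> p = y"
    using H X(2) v N[of v p x' x] N[of v p y' y] commute by auto
  ultimately show False
    using X(2) v N[of v x p y] commute by auto
qed

text \<open>Each of the two hole neighbours of a vertex touches at most one of the three cliques, so
  the third supplies a free pair. \<open>c0\<close> and \<open>c3\<close> cannot both have
  one.\<close>

lemma diamond_free_C7:
  assumes X: "diamond_free X" "{c0, c1, c2, c3, c4, c5, c6} \<subseteq> X" and C: "ind_C7 E c0 c1 c2 c3 c4 c5 c6"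
  shows "two_clique_vertex X c0 \<or> two_clique_vertex X c3"
proof (rule ccontr)
  have free: "\<exists>a a'. {a, a'} \<subseteq> X \<and> free_pair v p q a a'"
    if v: "\<not> two_clique_vertex X v" "{v, p, q} \<subseteq> X" "E v p" "E v q" for v p q
  proof -
    obtain x x' y y' z z' where *: "{x, x', y, y', z, z'} \<subseteq> X"
    "E v x" "E v x'" "E x x'" "E v y" "E v y'" "E y y'" "E v z" "E v z'" "E z z'"
    "x \<noteq> y" "y \<noteq> z" "x \<noteq> z" "\<not> E x y" "\<not> E y z" "\<not> E x z"
      using diamond_free_three_edges[OF X(1) _ v(1)] v(2) by blast
    have "(\<not> E w x \<and> \<not> E w x') \<or> (\<not> E w y \<and> \<not> E w y')"
      "(\<not> E w x \<and> \<not> E w x') \<or> (\<not> E w z \<and> \<not> E w z')"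
      "(\<not> E w y \<and> \<not> E w y') \<or> (\<not> E w z \<and> \<not> E w z')" if "w \<in> X" "E v w" for w
      using diamond_free_avoid[OF X(1), of v x x' y y' w] diamond_free_avoid[OF X(1), of v x x' z z' w]
        diamond_free_avoid[OF X(1), of v y y' z z' w] * v(2) that by auto
    from this[of p] this[of q] v
    have "(\<not> E p x \<and> \<not> E p x' \<and> \<not> E q x \<and> \<not> E q x') \<or> (\<not> E p y \<and> \<not> E p y' \<and> \<not> E q y \<and> \<not> E q y') \<or>
        (\<not> E p z \<and> \<not> E p z' \<and> \<not> E q z \<and> \<not> E q z')"
      by auto
    then show ?thesis
      using * unfolding free_pair_def by blast
  qed
  assume "\<not> ?thesis"
  then obtain a a' b b' where "{a, a'} \<subseteq> X" "free_pair c0 c1 c6 a a'" "{b, b'} \<subseteq> X" "free_pair c3 c2 c4 b b'"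
    using free[of c0 c1 c6] free[of c3 c2 c4] X(2) C commute unfolding ind_C7_def by auto
  then show False
    using C7_no_free_pairs[OF C, of a a' b b' X] X by auto
qed

lemma ipath_length:
  assumes "ipath X xs"
  shows "length xs < 7"
proof (rule ccontr)
  assume "\<not> ?thesis"
  then have "7 \<le> length xs" by simp
  then have "ind_P7 E (xs ! 0) (xs ! 1) (xs ! 2) (xs ! 3) (xs ! 4) (xs ! 5) (xs ! 6)"
    using assms unfolding ipath_def ind_P7_def by auto
  then show False using no_P7 by blast
qed

text \<open>The vertex is an end \<open>v\<close> of a longest induced path. A neighbour of
  \<open>v\<close> off the path must see the path again, and the missing holes dictate where. Two
  triangles at \<open>v\<close> that avoid the second path vertex both reach the edge between
  positions 2 and 3, which creates a diamond.\<close>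

lemma diamond_free_no_C7:
  assumes X: "diamond_free X" "X \<noteq> {}"
    and C: "\<And>a b c d e f g. {a, b, c, d, e, f, g} \<subseteq> X \<Longrightarrow> \<not> ind_C7 E a b c d e f g"
  shows "\<exists>v\<in>X. two_clique_vertex X v"
proof -
  obtain v0 where "v0 \<in> X" using X by blast
  then have "ipath X [v0]" unfolding ipath_def by auto
  then obtain xs where xs: "ipath X xs" and max: "\<And>ys. ipath X ys \<Longrightarrow> length ys \<le> length xs"
    using ex_has_greatest_nat[of "ipath X" "[v0]" length 7] ipath_length by (meson less_imp_le)
  have len: "1 \<le> length xs" using max[OF \<open>ipath X [v0]\<close>] by simp
  define v where "v = xs ! 0"
  have "v \<in> X" using xs len unfolding ipath_def v_def by (auto simp: Suc_le_eq)
  have sub: "xs ! i \<in> X" if "i < length xs" for i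
    using xs that unfolding ipath_def by auto
  have adj: "E (xs ! i) (xs ! j) \<longleftrightarrow> j = Suc i" if "i < j" "j < length xs" for i j
    using xs that unfolding ipath_def by auto
  have exit: "\<exists>j<length xs. 1 \<le> j \<and> E q (xs ! j)" if q: "q \<in> X" "E v q" "q \<notin> set xs" for q
  proof (rule ccontr)
    assume H: "\<not> ?thesis"
    have "ipath X (q # xs)"
      unfolding ipath_def
    proof (intro conjI allI impI)
      show "set (q # xs) \<subseteq> X" using xs q unfolding ipath_def by auto
      show "distinct (q # xs)" using xs q unfolding ipath_def by auto
      fix i j assume "j < length (q # xs)" "i < j"
      then show "E ((q # xs) ! i) ((q # xs) ! j) \<longleftrightarrow> j = Suc i"
        using H q adj[of "i - 1" "j - 1"] commute[of q v] unfolding v_def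
        by (cases i; cases j; cases "j - 1") auto
    qed
    then show False using max by fastforce
  qed
  show ?thesis
  proof (rule ccontr)
    assume "\<not> ?thesis"
    then have nt: "\<not> two_clique_vertex X v" using \<open>v \<in> X\<close> by blast
    obtain x x' y y' z z' where *: "{x, x', y, y', z, z'} \<subseteq> X"
    "E v x" "E v x'" "E x x'" "E v y" "E v y'" "E y y'" "E v z" "E v z'" "E z z'"
    "x \<noteq> y" "y \<noteq> z" "x \<noteq> z" "\<not> E x y" "\<not> E y z" "\<not> E x z"
      using diamond_free_three_edges[OF X(1) \<open>v \<in> X\<close> nt] by metis
    have len2: "2 \<le> length xs"
    proof (rule ccontr)
      assume "\<not> ?thesis"
      then have "xs = [v]" using len unfolding v_def by (cases xs) (auto simp: Suc_le_eq)
      then show False using exit[of x] * by auto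
    qed
    define p where "p = xs ! 1"
    have p: "p \<in> X" "E v p" using len2 sub adj[of 0 1] unfolding p_def v_def by auto
    \<comment> \<open>Of the three cliques at \<open>v\<close>, the path neighbour \<open>p\<close>
      touches at most one; the other two give these pairs.\<close>
    obtain a a' b b' where ab: "{a, a', b, b'} \<subseteq> X" "E v a" "E v a'" "E a a'" "E v b" "E v b'" "E b b'"
      "\<not> E p a" "\<not> E p a'" "\<not> E p b" "\<not> E p b'" "a \<noteq> b" "\<not> E a b"
      using * diamond_free_avoid[OF X(1), of v x x' y y' p] diamond_free_avoid[OF X(1), of v x x' z z' p]
        diamond_free_avoid[OF X(1), of v y y' z z' p] \<open>v \<in> X\<close> p by (smt (verit) insert_subset)
    \<comment> \<open>The first return of \<open>q\<close> to the path closes a hole with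
      \<open>v\<close>: index 3 gives a \<open>C5\<close>, index 5 a hole of length 7, and indices
      from 6 on do not exist.\<close>
    have kind: "2 < length xs \<and> E q (xs ! 2) \<or>
        4 < length xs \<and> \<not> E q (xs ! 2) \<and> \<not> E q (xs ! 3) \<and> E q (xs ! 4)"
      if q: "q \<in> X" "E v q" "\<not> E p q" "q \<noteq> p" for q
    proof -
      have "q \<notin> set xs"
        using q adj[of 0] xs unfolding v_def p_def ipath_def in_set_conv_nth
        by (metis One_nat_def gr0I irrefl)
      note exit = exit[OF q(1,2) this]
      define j where "j = (LEAST j. j < length xs \<and> 1 \<le> j \<and> E q (xs ! j))"
      have j: "j < length xs" "1 \<le> j" "E q (xs ! j)"
        using LeastI_ex[OF exit] unfolding j_def by auto
      have least: "\<not> E q (xs ! i)" if "1 \<le> i" "i < j" for i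
        using not_less_Least[of i "\<lambda>j. j < length xs \<and> 1 \<le> j \<and> E q (xs ! j)"] that j(1)
        unfolding j_def by auto
      have "j \<noteq> 1" using j q(3) commute unfolding p_def by auto
      moreover have "j \<noteq> 3"
      proof
        assume "j = 3"
        then have "ind_C5 E q v p (xs ! 2) (xs ! 3)"
          using j q least[of 2] adj[of 0 1] adj[of 0 2] adj[of 0 3] adj[of 1 2] adj[of 1 3] adj[of 2 3] commute
          unfolding ind_C5_def v_def p_def by auto
        then show False using no_C5 by blast
      qed
      moreover have "j \<noteq> 5"
      proof
        assume "j = 5"
        then have "ind_C7 E q v p (xs ! 2) (xs ! 3) (xs ! 4) (xs ! 5)"
          using j q least[of 2] least[of 3] least[of 4] commute
            adj[of 0 1] adj[of 0 2] adj[of 0 3] adj[of 0 4] adj[of 0 5] adj[of 1 2] adj[of 1 3] adj[of 1 4] adj[of 1 5] adj[of 2 3] adj[of 2 4] adj[of 2 5] adj[of 3 4] adj[of 3 5] adj[of 4 5]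
          unfolding ind_C7_def v_def p_def by auto
        then show False using C[of q v p] \<open>v \<in> X\<close> p sub j q \<open>j = 5\<close> by auto
      qed
      moreover have "j < 6" using j(1) ipath_length[OF xs] by simp
      ultimately have "j = 2 \<or> j = 4" using j(2) by linarith
      then show ?thesis using j least[of 2] least[of 3] by auto
    qed
    have pair: "4 < length xs \<and> (\<exists>r\<in>{q, q'}. E r (xs ! 2) \<and> E r (xs ! 3))"
      if q: "{q, q'} \<subseteq> X" "E v q" "E v q'" "E q q'" "\<not> E p q" "\<not> E p q'" for q q'
    proof -
      \<comment> \<open>A common neighbour \<open>xs ! j\<close> and \<open>v\<close> would be the
        nonadjacent tips of a diamond on the edge \<open>q q'\<close>.\<close>
      have diff: "\<not> (E q (xs ! j) \<and> E q' (xs ! j))" if "2 \<le> j" "j < length xs" for j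
      proof
        assume "E q (xs ! j) \<and> E q' (xs ! j)"
        moreover have "v \<noteq> xs ! j" using xs that nth_eq_iff_index_eq[of xs 0 j] len unfolding v_def ipath_def
          by (cases "xs = []") auto
        moreover have "\<not> E v (xs ! j)" using adj[of 0 j] that unfolding v_def by auto
        ultimately show False
          using diamond_freeD[OF X(1), of q q' v "xs ! j"] q \<open>v \<in> X\<close> sub[OF that(2)] commute by auto
      qed
      \<comment> \<open>\<open>r\<close> returns at index 2 and \<open>r'\<close> at index 4; the
        cycle through both is a \<open>C5\<close> unless \<open>r\<close> also sees index 3.\<close>
      have aux: "4 < length xs \<and> E r (xs ! 3)"
        if r: "{r, r'} \<subseteq> X" "E v r" "E v r'" "E r r'" "\<not> E p r" "\<not> E p r'" "E r (xs ! 2)" "\<not> E r' (xs ! 2)"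
          and rd: "4 < length xs \<Longrightarrow> \<not> (E r (xs ! 4) \<and> E r' (xs ! 4))" for r r'
      proof -
        have r': "4 < length xs" "\<not> E r' (xs ! 3)" "E r' (xs ! 4)" using kind[of r'] r commute by auto
        have "E r (xs ! 3)"
        proof (rule ccontr)
          assume "\<not> E r (xs ! 3)"
          then have "ind_C5 E r' r (xs ! 2) (xs ! 3) (xs ! 4)"
            using r r' rd adj[of 2 3] adj[of 2 4] adj[of 3 4] commute unfolding ind_C5_def by auto
          then show False using no_C5 by blast
        qed
        then show ?thesis using r' by blast
      qed
      have "\<not> E q p" "\<not> E q' p" "q \<noteq> p" "q' \<noteq> p" using q commute by auto
      then have "4 < length xs \<and> (E q (xs ! 2) \<and> \<not> E q' (xs ! 2) \<or> E q' (xs ! 2) \<and> \<not> E q (xs ! 2))"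
        using kind[of q] kind[of q'] q diff[of 2] diff[of 4] by auto
      then show ?thesis
        using aux[of q q'] aux[of q' q] q diff[of 4] commute[of q q'] by auto
    qed
    obtain r s where rs: "r \<in> {a, a'}" "s \<in> {b, b'}" "E r (xs ! 2)" "E r (xs ! 3)" "E s (xs ! 2)" "E s (xs ! 3)"
      and len5: "4 < length xs"
      using pair[of a a'] pair[of b b'] ab by auto
    have far: "s \<noteq> r" "\<not> E s r"
      using diamond_free_avoid[OF X(1), of v a a' b b' r] diamond_free_avoid[OF X(1), of v a a' b b' s]
        rs ab \<open>v \<in> X\<close> commute by auto
    show False
      using diamond_freeD[OF X(1), of "xs ! 2" "xs ! 3" s r] rs far sub ab len5 adj[of 2 3] commute by auto
  qed
qed

section \<open>Reduction of graphs with a diamond\<close>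

definition conn :: "'a set \<Rightarrow> bool" where
  "conn F \<longleftrightarrow> (\<forall>A\<subseteq>F. A \<noteq> {} \<longrightarrow> A \<noteq> F \<longrightarrow> (\<exists>x\<in>A. \<exists>y\<in>F - A. E x y))"

lemma conn_insert:
  assumes "conn F" "x \<in> F" "E x y"
  shows "conn (insert y F)"
proof (cases "y \<in> F")
  case True
  then show ?thesis using assms(1) by (simp add: insert_absorb)
next
  case False
  show ?thesis
    unfolding conn_def
  proof (intro allI impI)
    fix A assume A: "A \<subseteq> insert y F" "A \<noteq> {}" "A \<noteq> insert y F"
    consider "A = {y}" | "A = F" | "A - {y} \<noteq> {}" "A - {y} \<noteq> F" using A by blast
    then show "\<exists>x\<in>A. \<exists>y'\<in>insert y F - A. E x y'"
    proof cases
      case 1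
      then show ?thesis using assms(2,3) commute[of x y] False by blast
    next
      case 2
      then show ?thesis using assms(2,3) False by blast
    next
      case 3
      moreover have "A - {y} \<subseteq> F" using A by blast
      ultimately obtain u w where "u \<in> A - {y}" "w \<in> F - (A - {y})" "E u w"
        using assms(1) unfolding conn_def by blast
      then show ?thesis using False by blast
    qed
  qed
qed

lemma conn_star:
  assumes "d \<in> F" "\<And>x. x \<in> F \<Longrightarrow> x \<noteq> d \<Longrightarrow> E d x"
  shows "conn F"
  unfolding conn_def
proof (intro allI impI)
  fix A assume A: "A \<subseteq> F" "A \<noteq> {}" "A \<noteq> F"
  show "\<exists>x\<in>A. \<exists>y\<in>F - A. E x y"
  proof (cases "d \<in> A")
    case True
    obtain y where "y \<in> F - A" using A by blast
    then show ?thesis using True assms(2)[of y] by blast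
  next
    case False
    obtain x where "x \<in> A" using A by blast
    then have "E x d" using False assms(2)[of x] commute A by blast
    then show ?thesis using False assms(1) \<open>x \<in> A\<close> by blast
  qed
qed

text \<open>If \<open>w\<close> missed \<open>c\<close>, the five vertices would induce a paraglider
  when \<open>w\<close> sees \<open>b\<close>, and a kite otherwise.\<close>

lemma exit_P3:
  assumes "E d a" "E d c" "E d b" "E a c" "E c b" "\<not> E a b" "a \<noteq> b" "E w a" "\<not> E d w"
  shows "E w c"
  using no_kite[of b c a w d] no_paraglider[of a c b w d] assms commute
  unfolding ind_kite_def ind_paraglider_def by auto

text \<open>\<open>d\<close> and \<open>w\<close> are the tips of a diamond on the edge
  \<open>a c\<close>. A neighbour \<open>y\<close> of \<open>d\<close> away from that edge completes
  a paraglider if \<open>w\<close> sees \<open>y\<close>, and a kite otherwise.\<close>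

lemma exit_edge:
  assumes "E d a" "E d c" "E a c" "E w a" "E w c" "\<not> E d w" "w \<noteq> d" "E d y"
  shows "y = a \<or> y = c \<or> E a y \<or> E c y"
  using no_kite[of w a d y c] no_paraglider[of w a d y c] assms commute
  unfolding ind_kite_def ind_paraglider_def by auto

text \<open>\<open>C\<close> is a homogeneous set whose outside neighbours form a clique. These
  neighbours are universal in the neighbourhood of every vertex of \<open>C\<close>.\<close>

definition clique_attached :: "'a set \<Rightarrow> 'a set \<Rightarrow> bool" where
  "clique_attached X C \<longleftrightarrow> (\<forall>x\<in>C. \<forall>u\<in>X - C. E x u \<longrightarrow>
     (\<forall>y\<in>C. E y u) \<and> (\<forall>y\<in>C. \<forall>u'\<in>X - C. E y u' \<longrightarrow> u' \<noteq> u \<longrightarrow> E u u'))"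

text \<open>By maximality \<open>F\<close> is a component of the neighbourhood of \<open>d\<close>.
  If a vertex \<open>z\<close> not adjacent to \<open>d\<close> sees an edge of \<open>F\<close>,
  then \<open>F\<close> is the whole neighbourhood, and either \<open>z\<close> dominates
  \<open>d\<close> or some vertices of \<open>F\<close> missed by \<open>z\<close> form a
  clique-attached set. If there is no such \<open>z\<close>, the non-universal vertices of
  \<open>F\<close> form one.\<close>

lemma diamond_reduction:
  assumes "finite X" "\<not> diamond_free X"
  shows "(\<exists>d\<in>X. dominated X d) \<or> (\<exists>C\<subset>X. C \<noteq> {} \<and> clique_attached X C)"
proof -
  \<comment> \<open>A largest connected non-clique set \<open>F\<close> of neighbours of a vertex \<open>d\<close> is the extremal object.\<close>
  define lobe where "lobe = (\<lambda>(d, F). d \<in> X \<and> F \<subseteq> X \<and> (\<forall>x\<in>F. E d x) \<and> conn F \<and>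
      (\<exists>x\<in>F. \<exists>y\<in>F. x \<noteq> y \<and> \<not> E x y))"
  obtain x y z w where D: "{x, y, z, w} \<subseteq> X" "E x y" "E x z" "E y z" "E x w" "E y w" "z \<noteq> w" "\<not> E z w"
    using assms(2) unfolding diamond_free_def by auto
  have "conn {y, z, w}" using conn_star[of y "{y, z, w}"] D by auto
  then have "lobe (x, {y, z, w})" using D unfolding lobe_def by auto
  moreover have "\<forall>p. lobe p \<longrightarrow> (card \<circ> snd) p < Suc (card X)"
    using card_mono[OF assms(1)] unfolding lobe_def by (auto simp: less_Suc_eq_le)
  ultimately obtain p where p: "lobe p" "\<And>q. lobe q \<Longrightarrow> card (snd q) \<le> card (snd p)"
    using ex_has_greatest_nat[of lobe _ "card \<circ> snd" "Suc (card X)"] by (metis comp_apply)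
  obtain d F where dF: "p = (d, F)" by (cases p)
  have F: "d \<in> X" "F \<subseteq> X" "\<And>x. x \<in> F \<Longrightarrow> E d x" "conn F" and ncl: "\<exists>x\<in>F. \<exists>y\<in>F. x \<noteq> y \<and> \<not> E x y"
    using p(1) unfolding lobe_def dF by auto
  have max: "card F' \<le> card F" if "lobe (d', F')" for d' F'
    using p(2)[OF that] unfolding dF by simp
  have finF: "finite F" using F(2) assms(1) finite_subset by blast
  have "d \<notin> F" using F(3)[of d] by auto
  have closed: "y \<in> F" if "y \<in> X" "E d y" "x \<in> F" "E x y" for x y
  proof (rule ccontr)
    assume "y \<notin> F"
    have "lobe (d, insert y F)"
      using that F ncl conn_insert[OF F(4) that(3,4)] unfolding lobe_def by auto
    then show False using max[of d "insert y F"] \<open>y \<notin> F\<close> finF by simp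
  qed
  show ?thesis
  proof (cases "\<exists>z\<in>X. z \<noteq> d \<and> \<not> E d z \<and> (\<exists>a\<in>F. \<exists>c\<in>F. E z a \<and> E z c \<and> E a c)")
    case True
    then obtain z a c where z: "z \<in> X" "z \<noteq> d" "\<not> E d z" and ac: "a \<in> F" "c \<in> F" "E z a" "E z c" "E a c"
      by blast
    have all: "y \<in> F" if "y \<in> X" "E d y" for y
      using exit_edge[of d a c z y] z ac F(3) that closed by blast
    have "z \<notin> F" using F(3) z by blast
    \<comment> \<open>\<open>m\<close> would take over the role of \<open>d\<close>: replacing
      \<open>m\<close> in \<open>F\<close> by \<open>d\<close> and \<open>z\<close> gives a lobe at
      \<open>m\<close> with one more vertex.\<close>
    have no_univ: False if m: "m \<in> F" "m' \<in> F" "E z m" "E z m'" "E m m'" "\<And>x. x \<in> F \<Longrightarrow> x \<noteq> m \<Longrightarrow> E m x" for m m'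
    proof -
      let ?F = "insert z (insert d (F - {m}))"
      have mm: "m \<noteq> m'" using m by auto
      have "conn (insert d (F - {m}))" by (rule conn_star[of d]) (use F(3) in auto)
      then have "conn ?F" by (rule conn_insert[of _ m' z]) (use m mm commute[of z m'] in auto)
      moreover have "E m z" "E m d" using F(3)[of m] m(1,3) by (simp_all add: commute[of m z] commute[of m d])
      then have "\<forall>x\<in>?F. E m x" by (simp add: m(6))
      moreover have "\<exists>x\<in>?F. \<exists>y\<in>?F. x \<noteq> y \<and> \<not> E x y"
        by (rule bexI[of _ z], rule bexI[of _ d]) (use z(2,3) commute[of z d] in simp_all)
      moreover have "m \<in> X" "?F \<subseteq> X" using F(1,2) z(1) m(1) by auto
      ultimately have "lobe (m, ?F)" unfolding lobe_def prod.case by (intro conjI)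
      moreover have "card ?F = Suc (card F)"
        using \<open>z \<notin> F\<close> \<open>d \<notin> F\<close> z(2) finF card_Suc_Diff1[OF finF m(1)] by simp
      ultimately show False using max[of m ?F] by simp
    qed
    show ?thesis
    proof (cases "\<forall>x\<in>F. E z x")
      case True
      then have "dominated X d" unfolding dominated_def using z all by blast
      then show ?thesis using F(1) by blast
    next
      case False
      define M where "M = {x\<in>F. E z x}"
      have "M \<subseteq> F" "M \<noteq> {}" "M \<noteq> F" using False ac unfolding M_def by auto
      then obtain m0 y0 where m0: "m0 \<in> M" and y0: "y0 \<in> F - M" and "E m0 y0"
        using F(4) unfolding conn_def by blast
      \<comment> \<open>Otherwise \<open>m y b\<close> is an induced path in \<open>F\<close> and
        \<open>exit_P3\<close> makes \<open>z\<close> see \<open>y\<close>, although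
        \<open>y\<close> is outside \<open>M\<close>.\<close>
      have key: "E m b" if "m \<in> M" "y \<in> F - M" "E m y" "b \<in> F" "E y b" "b \<noteq> m" for m y b
        using exit_P3[of d m y b z] that F(3) z unfolding M_def by auto
      define N where "N = (\<lambda>y. {m\<in>M. E m y})"
      \<comment> \<open>The candidate set: the vertices of \<open>F\<close> missed by
        \<open>z\<close> with the same neighbours in \<open>M\<close> as \<open>y0\<close>. By
        \<open>key\<close> it is closed under adjacency within \<open>F - M\<close>.\<close>
      define C where "C = {y\<in>F - M. N y = N y0}"
      have "m0 \<in> N y0" using m0 \<open>E m0 y0\<close> unfolding N_def by blast
      have "y0 \<in> C" using y0 unfolding C_def by blast
      have closedC: "b \<in> C" if "y \<in> C" "b \<in> F - M" "E y b" for y b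
      proof -
        have "N y \<subseteq> N b"
          using key[of _ y b] that unfolding N_def C_def by auto
        moreover have "N b \<subseteq> N y"
          using key[of _ b y] that commute[of y b] unfolding N_def C_def by auto
        ultimately show ?thesis using that unfolding C_def by auto
      qed
      have M_nbr: "\<exists>m'\<in>M. E m m'" if "m \<in> M" for m
        using exit_edge[of d a c z m] that z ac F(3) commute unfolding M_def by (cases "m = a"; cases "m = c") auto
      \<comment> \<open>Such a \<open>w\<close> would make a vertex of \<open>M\<close> universal in
        \<open>F\<close>, against \<open>no_univ\<close>: any \<open>m\<close> in \<open>N y\<close>
        that \<open>w\<close> sees, and \<open>m0\<close> if \<open>w\<close> sees none.\<close>
      have no_exit: "\<not> E w y" if w: "w \<in> X" "w \<notin> F" "w \<noteq> d" and y: "y \<in> C" for w y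
      proof
        assume "E w y"
        have dw: "\<not> E d w" using all w by blast
        have yF: "y \<in> F" "y \<in> F - M" using y unfolding C_def by auto
        have univ: "E m x" if "m \<in> N y" "x \<in> F" "x \<noteq> m" "E m x \<or> E y x \<or> x = y" for m x
          using key[of m y x] that yF commute unfolding N_def by auto
        have non: "\<not> E w m" if m: "m \<in> N y" for m
        proof
          assume "E w m"
          have "E m x" if "x \<in> F" "x \<noteq> m" for x
            using univ[OF m that] exit_edge[of d m y w x] F(3) yF m that \<open>E w m\<close> \<open>E w y\<close> dw w(3)
            unfolding N_def M_def by blast
          then show False
            using M_nbr[of m] no_univ[of m] m unfolding N_def M_def by blast
        qed
        have twin: "E y x \<or> x = y" if "m \<in> N y" "x \<in> F" "E m x" for m x
          using exit_P3[of d y m x w] that non[OF that(1)] F(3) yF \<open>E w y\<close> dw commute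
          unfolding N_def M_def by auto
        have m0N: "m0 \<in> N y" using \<open>m0 \<in> N y0\<close> y unfolding C_def by auto
        obtain m' where m': "m' \<in> M" "E m0 m'" using M_nbr m0 by blast
        have m'N: "m' \<in> N y" using twin[OF m0N, of m'] m' yF commute unfolding N_def M_def by auto
        have "E m0 x" if "x \<in> F" "x \<noteq> m0" for x
          using univ[OF m0N that] exit_edge[of d m0 m' z x] F(3) m0 m' that z
            twin[OF m0N that(1)] twin[OF m'N that(1)] unfolding M_def by auto
        then show False
          using no_univ[of m0 m'] m0 m' unfolding M_def by blast
      qed
      have outside: "u = d \<or> u \<in> N y0" if "y \<in> C" "u \<in> X - C" "E y u" for y u
      proof (cases "u \<in> F")
        case True
        then have "u \<in> M" using closedC[of y u] that by blast
        then have "u \<in> N y" using that commute unfolding N_def by blast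
        then show ?thesis using that(1) unfolding C_def by auto
      next
        case False
        then show ?thesis using no_exit[of u y] that commute by blast
      qed
      have N_clique: "E m m'" if "m \<in> N y0" "m' \<in> N y0" "m' \<noteq> m" for m m'
        using key[of m y0 m'] that y0 commute unfolding N_def M_def by auto
      have NF: "m \<in> F" if "m \<in> N y0" for m using that unfolding N_def M_def by blast
      have N_complete: "E y m" if "m \<in> N y0" "y \<in> C" for m y
        using that commute unfolding C_def N_def by blast
      have dN: "E d m" if "m \<in> N y0" for m using F(3) NF that by blast
      have "clique_attached X C"
        unfolding clique_attached_def
      proof (intro conjI ballI impI)
        fix x u y assume u: "x \<in> C" "u \<in> X - C" "E x u" and y: "y \<in> C"
        have "E d y" using F(3) y unfolding C_def by blast
        then show "E y u"
          using outside[OF u] N_complete[of u y] y commute[of y d] by auto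
        show "E u u'" if u': "u' \<in> X - C" "E y u'" "u' \<noteq> u" for u'
          using outside[OF u] outside[OF y u'(1,2)] N_clique[of u u'] dN commute[of u d] u'(3) by auto
      qed
      moreover have "C \<subset> X" using F(1,2) \<open>d \<notin> F\<close> unfolding C_def by blast
      ultimately show ?thesis using \<open>y0 \<in> C\<close> by blast
    qed
  next
    case False
    have no_edge: "\<not> E a c" if "z \<in> X" "z \<noteq> d" "\<not> E d z" "a \<in> F" "c \<in> F" "E z a" "E z c" for z a c
      using False that by blast
    \<comment> \<open>The attaching clique will consist of \<open>d\<close> and the universal
      vertices of \<open>F\<close>.\<close>
    define U where "U = {u\<in>F. \<forall>x\<in>F. x \<noteq> u \<longrightarrow> E u x}"
    let ?C = "F - U"
    have outside: "u \<in> insert d U" if u: "y \<in> ?C" "u \<in> X - ?C" "E y u" for y u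
    proof (rule ccontr)
      assume H: "u \<notin> insert d U"
      then have "u \<notin> F" using u by blast
      then have du: "\<not> E d u" using closed u by blast
      have Uy: "E u y" using u commute by blast
      \<comment> \<open>\<open>y\<close> is not universal, so an edge leaving its closed
        neighbourhood in \<open>F\<close> yields an induced path \<open>y x b\<close>; then
        \<open>exit_P3\<close> lets \<open>u\<close> see the edge \<open>y x\<close>, which
        \<open>no_edge\<close> forbids.\<close>
      let ?A = "{x\<in>F. x = y \<or> E y x}"
      have "?A \<noteq> F" using u(1) unfolding U_def by blast
      moreover have "?A \<subseteq> F" "?A \<noteq> {}" using u(1) by blast+
      ultimately obtain x b where xb: "x \<in> ?A" "b \<in> F - ?A" "E x b"
        using F(4) unfolding conn_def by meson
      then have "E u x"
        using exit_P3[of d y x b u] F(3) u(1) Uy du by auto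
      moreover have "E y x" using xb by auto
      ultimately show False using no_edge[of u y x] Uy u(1,2) xb(1) du H by blast
    qed
    have complete: "E x u" if "u \<in> insert d U" "x \<in> F" "x \<noteq> u" for u x
      using that F(3)[of x] commute[of x u] unfolding U_def by blast
    obtain x y where "x \<in> F" "y \<in> F" "x \<noteq> y" "\<not> E x y" using ncl by blast
    then have "x \<in> ?C" unfolding U_def by auto
    then have "?C \<noteq> {}" by blast
    moreover have "?C \<subset> X" using F(1,2) \<open>d \<notin> F\<close> by blast
    moreover have "clique_attached X ?C"
      unfolding clique_attached_def
    proof (intro conjI ballI impI)
      fix x u y assume u: "x \<in> ?C" "u \<in> X - ?C" "E x u"
      show "E y u" if "y \<in> ?C"
        using outside[OF u] complete[of u y] that u(2) by blast
      show "E u u'" if "y \<in> ?C" "u' \<in> X - ?C" "E y u'" "u' \<noteq> u" for u'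
      proof -
        have "u \<in> insert d U" "u' \<in> insert d U" using outside[OF u] outside[of y u'] that by auto
        moreover have "U \<subseteq> F" unfolding U_def by blast
        ultimately show ?thesis
          using complete[of u' u] complete[of u u'] commute[of u u'] that(4) by blast
      qed
    qed
    ultimately show ?thesis by blast
  qed
qed

text \<open>Outside neighbours are adjacent to all of \<open>C\<close> and to each other. So a
  dominating vertex in \<open>C\<close> sees them too, and they never count among the non-universal
  neighbours of \<open>v\<close>.\<close>

lemma removable_extend:
  assumes "C \<subseteq> X" "v \<in> C" "removable C v"
    and "clique_attached X C"
  shows "removable X v"
proof -
  have att: "x \<in> C \<Longrightarrow> u \<in> X - C \<Longrightarrow> E x u \<Longrightarrow> y \<in> C \<Longrightarrow> E y u"
    "x \<in> C \<Longrightarrow> u \<in> X - C \<Longrightarrow> E x u \<Longrightarrow> y \<in> C \<Longrightarrow> u' \<in> X - C \<Longrightarrow> E y u' \<Longrightarrow> u' \<noteq> u \<Longrightarrow> E u u'"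
    for x u y u'
    using assms(4) unfolding clique_attached_def by blast+
  show ?thesis
  proof (cases "dominated C v")
    case True
    then obtain z where z: "z \<in> C" "z \<noteq> v" "\<not> E v z" "\<And>x. x \<in> C \<Longrightarrow> E v x \<Longrightarrow> E z x"
      unfolding dominated_def by blast
    then have "E z x" if "x \<in> X" "E v x" for x
      using that att(1)[of v x z] assms(2) by blast
    then show ?thesis using z assms(1) unfolding removable_def dominated_def by blast
  next
    case False
    have nu: "nonuniversal X v x \<longleftrightarrow> nonuniversal C v x" for x
    proof
      assume "nonuniversal X v x"
      then obtain y where xy: "x \<in> X" "E v x" "y \<in> X" "E v y" "y \<noteq> x" "\<not> E x y"
        unfolding nonuniversal_def by blast
      then have "x \<in> C" "y \<in> C"
        using att(1)[of v x y] att(1)[of v y x] att(2)[of v x v y] assms(2) commute[of x y] by blast+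
      then show "nonuniversal C v x" using xy unfolding nonuniversal_def by blast
    next
      assume "nonuniversal C v x"
      then show "nonuniversal X v x" using assms(1) unfolding nonuniversal_def by blast
    qed
    have inC: "x \<in> C" if "nonuniversal C v x" for x using that unfolding nonuniversal_def by blast
    then have "linked X v x \<longleftrightarrow> linked C v x" for x
      using assms(1) unfolding linked_def nu by blast
    moreover have "linked C v x \<Longrightarrow> x \<in> C" for x using inC unfolding linked_def by blast
    moreover have "two_clique_vertex C v" using assms(3) False unfolding removable_def by blast
    ultimately have "two_clique_vertex X v"
      using inC unfolding two_clique_vertex_def nu by meson
    then show ?thesis unfolding removable_def by blast
  qed
qed

lemma exists_removable:
  assumes "finite X" "X \<noteq> {}"
  shows "\<exists>v\<in>X. removable X v"
  using assms
proof (induction X rule: finite_psubset_induct)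
  case (psubset X)
  show ?case
  proof (cases "diamond_free X")
    case True
    show ?thesis
    proof (cases "\<exists>a b c d e f g. {a, b, c, d, e, f, g} \<subseteq> X \<and> ind_C7 E a b c d e f g")
      case C7: True
      then obtain a b c d e f g where C: "{a, b, c, d, e, f, g} \<subseteq> X" "ind_C7 E a b c d e f g"
        by (elim exE conjE) (rule that)
      have "a \<in> X" "d \<in> X" using C(1) by auto
      then show ?thesis using diamond_free_C7[OF True C] unfolding removable_def by blast
    next
      case False
      then have "\<exists>v\<in>X. two_clique_vertex X v"
        by (intro diamond_free_no_C7[OF True psubset.prems]) blast
      then show ?thesis unfolding removable_def by blast
    qed
  next
    case False
    from diamond_reduction[OF psubset.hyps(1) False] show ?thesis
    proof (elim disjE exE conjE)
      assume "\<exists>d\<in>X. dominated X d"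
      then show ?thesis unfolding removable_def by blast
    next
      fix C assume C: "C \<subset> X" "C \<noteq> {}" and att: "clique_attached X C"
      obtain v where "v \<in> C" "removable C v" using psubset.IH[OF C] by blast
      then have "removable X v"
        using removable_extend[of C X v] C att by blast
      then show ?thesis using C \<open>v \<in> C\<close> by blast
    qed
  qed
qed

end

context coloured_pckp_free
begin

section \<open>Kempe changes\<close>

definition colour_nbrs :: "'a \<Rightarrow> nat \<Rightarrow> 'a set" where
  "colour_nbrs v a = {x\<in>S. E v x \<and> \<phi> x = a}"

text \<open>The union of all Kempe components in colours \<open>a\<close>, \<open>b\<close> that
  contain a neighbour of \<open>v\<close> coloured \<open>a\<close>; all of them have to be swapped
  to free \<open>a\<close>. The two colours may coincide.\<close>

inductive reach :: "'a \<Rightarrow> nat \<Rightarrow> nat \<Rightarrow> 'a \<Rightarrow> bool" for v a b where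
  start: "x \<in> colour_nbrs v a \<Longrightarrow> reach v a b x"
| step: "reach v a b x \<Longrightarrow> y \<in> S \<Longrightarrow> E x y \<Longrightarrow> \<phi> y \<in> {a, b} \<Longrightarrow> reach v a b y"

text \<open>For \<open>a = b\<close> this only says that the colour occurs at \<open>v\<close>, so a
  colour absent from the neighbourhood is found by the same search over pairs.\<close>

definition stuck :: "'a \<Rightarrow> nat \<Rightarrow> nat \<Rightarrow> bool" where
  "stuck v a b \<longleftrightarrow> (\<exists>w \<in> colour_nbrs v b. reach v a b w)"

definition joined :: "'a \<Rightarrow> nat \<Rightarrow> nat \<Rightarrow> bool" where
  "joined v a b \<longleftrightarrow> (\<exists>x \<in> colour_nbrs v a. \<exists>y \<in> colour_nbrs v b. E x y)"

lemma joined_commute: "joined v a b \<longleftrightarrow> joined v b a"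
  unfolding joined_def using commute by blast

definition walk :: "'a \<Rightarrow> nat \<Rightarrow> nat \<Rightarrow> (nat \<Rightarrow> 'a) \<Rightarrow> nat \<Rightarrow> bool" where
  "walk v a b f n \<longleftrightarrow> f 0 \<in> colour_nbrs v a \<and>
     (\<forall>i<n. E (f i) (f (Suc i))) \<and> (\<forall>i\<le>n. f i \<in> S \<and> \<phi> (f i) \<in> {a, b})"

lemma reach_walk:
  assumes "reach v a b y"
  shows "\<exists>f n. walk v a b f n \<and> f n = y"
  using assms
proof induction
  case (start x)
  then show ?case
    by (intro exI[of _ "\<lambda>_. x"] exI[of _ 0]) (auto simp: walk_def colour_nbrs_def)
next
  case (step x y)
  then obtain f n where f: "walk v a b f n" "f n = x" by blast
  have "walk v a b (f(Suc n := y)) (Suc n)"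
    using f step.hyps unfolding walk_def by (auto simp: less_Suc_eq le_Suc_eq)
  then show ?case by (metis fun_upd_same)
qed

lemma walk_colours:
  assumes "walk v a b f n" "i \<le> n" "a \<noteq> b"
  shows "\<phi> (f i) = (if even i then a else b)"
  using assms(2)
proof (induction i)
  case 0
  then show ?case using assms unfolding walk_def colour_nbrs_def by auto
next
  case (Suc i)
  then have "\<phi> (f i) \<noteq> \<phi> (f (Suc i))"
    using proper[of "f i" "f (Suc i)"] assms(1) unfolding walk_def by auto
  then show ?case using Suc assms(1) unfolding walk_def by auto
qed

text \<open>A shortest walk between the two colour classes is induced and has no inner vertex in the
  neighbourhood of \<open>v\<close>; together with \<open>v\<close> it is an odd hole, so its length is forced to be 5.\<close>

lemma stuck_chain:
  assumes "stuck v a b" "a \<noteq> b" "\<not> joined v a b" "v \<notin> S"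
  shows "\<exists>x\<in>colour_nbrs v a. \<exists>y\<in>colour_nbrs v b. \<exists>p q r s. chain v x p q r s y"
proof -
  let ?P = "\<lambda>n. \<exists>f. walk v a b f n \<and> f n \<in> colour_nbrs v b"
  define n where "n = (LEAST n. ?P n)"
  have "\<exists>n. ?P n" using assms(1) reach_walk unfolding stuck_def by metis
  then have "?P n" unfolding n_def by (rule LeastI_ex)
  then obtain f where w: "walk v a b f n" and fn: "f n \<in> colour_nbrs v b" by blast
  have min: "n \<le> m" if "walk v a b g m" "g m \<in> colour_nbrs v b" for g m
    unfolding n_def using that by (intro Least_le) blast
  have edge: "E (f i) (f (Suc i))" if "i < n" for i using w that unfolding walk_def by blast
  have inS: "f i \<in> S" "\<phi> (f i) \<in> {a, b}" if "i \<le> n" for i using w that unfolding walk_def by blast+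
  have f0: "f 0 \<in> colour_nbrs v a" using w unfolding walk_def by blast
  have chord: "\<not> E (f i) (f j)" if ij: "Suc i < j" "j \<le> n" for i j
  proof
    assume e: "E (f i) (f j)"
    \<comment> \<open>The walk that takes the chord from \<open>f i\<close> to \<open>f j\<close>;
      it saves \<open>j - Suc i\<close> steps.\<close>
    define g where "g = (\<lambda>k. if k \<le> i then f k else f (k + (j - Suc i)))"
    define m where "m = n - (j - Suc i)"
    have "walk v a b g m"
      unfolding walk_def
    proof (intro conjI allI impI)
      show "g 0 \<in> colour_nbrs v a" using f0 unfolding g_def by simp
    next
      fix k assume "k < m"
      then show "E (g k) (g (Suc k))"
        using edge[of k] edge[of "k + (j - Suc i)"] e ij unfolding g_def m_def
        by (cases "k < i"; cases "k = i") auto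
    next
      fix k assume "k \<le> m"
      then show "g k \<in> S" "\<phi> (g k) \<in> {a, b}"
        using inS[of k] inS[of "k + (j - Suc i)"] ij unfolding g_def m_def
        by (cases "k \<le> i"; auto)+
    qed
    moreover have "g m = f n" using ij unfolding g_def m_def by auto
    ultimately show False using min[of g m] fn ij unfolding m_def by auto
  qed
  have inner: "\<not> E v (f i)" if i: "0 < i" "i < n" for i
  proof
    assume e: "E v (f i)"
    show False
    \<comment> \<open>An inner neighbour of \<open>v\<close> coloured \<open>a\<close> begins a
      shorter walk, one coloured \<open>b\<close> ends a shorter walk.\<close>
    proof (cases "\<phi> (f i) = a")
      case True
      then have "walk v a b (\<lambda>k. f (i + k)) (n - i)"
        using w e inS[of i] i unfolding walk_def colour_nbrs_def by auto
      then show False using min[of "\<lambda>k. f (i + k)" "n - i"] fn i by auto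
    next
      case False
      then have "f i \<in> colour_nbrs v b" using inS[of i] i e unfolding colour_nbrs_def by auto
      moreover have "walk v a b f i" using w i unfolding walk_def by auto
      ultimately show False using min[of f i] i by auto
    qed
  qed
  have col: "\<phi> (f i) = (if even i then a else b)" if "i \<le> n" for i
    using walk_colours[OF w that assms(2)] .
  have "odd n" using col[of n] fn assms(2) unfolding colour_nbrs_def by auto
  have ev: "E v (f 0)" "E v (f n)" using f0 fn unfolding colour_nbrs_def by auto
  have "n \<noteq> 1" using edge[of 0] f0 fn assms(3) unfolding joined_def by auto
  moreover have "n \<noteq> 3"
  proof
    assume n: "n = 3"
    have "ind_C5 E v (f 0) (f 1) (f 2) (f 3)"
      using ev edge[of 0] edge[of 1] edge[of 2] inner[of 1] inner[of 2]
        chord[of 0 2] chord[of 0 3] chord[of 1 3]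
      unfolding ind_C5_def n by (simp add: numeral_2_eq_2 numeral_3_eq_3)
    then show False using no_C5 by blast
  qed
  moreover have "n < 6"
  proof (rule ccontr)
    assume "\<not> n < 6"
    then have n: "6 \<le> n" by simp
    have "ind_P7 E (f 0) (f 1) (f 2) (f 3) (f 4) (f 5) (f 6)"
      unfolding ind_P7_def
      using n edge[of 0] edge[of 1] edge[of 2] edge[of 3] edge[of 4] edge[of 5]
      by (intro conjI chord) (simp_all add: eval_nat_numeral)
    then show False using no_P7 by blast
  qed
  ultimately have n: "n = 5" using \<open>odd n\<close> by presburger
  have "ind_C7 E v (f 0) (f 1) (f 2) (f 3) (f 4) (f 5)"
    unfolding ind_C7_def
    using n ev edge[of 0] edge[of 1] edge[of 2] edge[of 3] edge[of 4] 
    by (intro conjI chord inner) (simp_all add: eval_nat_numeral)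
  then have "chain v (f 0) (f 1) (f 2) (f 3) (f 4) (f 5)"
    using inS col n unfolding chain_def by simp
  then show ?thesis using f0 fn n by blast
qed

lemma chain_reverse:
  assumes "chain v x p q r s y"
  shows "chain v y s r q p x"
  using assms commute unfolding chain_def ind_C7_def by auto

text \<open>\<open>u\<close> misses \<open>x\<close>, \<open>q\<close>, \<open>s\<close> by colour.
  If it saw \<open>r\<close>, then \<open>r s y v u\<close> would be a \<open>C5\<close>; if it
  missed \<open>p\<close> as well, \<open>p q r s y v u\<close> would be a \<open>P7\<close>. Hence
  \<open>u\<close> sees exactly \<open>p\<close> and \<open>v\<close>, as \<open>x\<close>
  does.\<close>

lemma chain_replace:
  assumes "chain v x p q r s y" "u \<in> S" "E v u" "\<phi> u = \<phi> x" "\<not> E u y"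
  shows "chain v u p q r s y"
proof -
  have C: "ind_C7 E v x p q r s y" and S: "{x, p, q, r, s, y} \<subseteq> S"
    and col: "\<phi> p = \<phi> y" "\<phi> q = \<phi> x" "\<phi> r = \<phi> y" "\<phi> s = \<phi> x"
    using assms(1) unfolding chain_def by auto
  have non: "\<not> E u x" "\<not> E u q" "\<not> E u s"
    using proper[of u x] proper[of u q] proper[of u s] S col assms by auto
  have "ind_C7 E v u p q r s y"
    using C non assms(3,5) no_P7[of p q r s y v u] no_C5[of y s r v u] no_C5[of r s y v u]
    apply (simp (no_asm_use) only: patterns commute)
    by sat
  then show ?thesis using S col assms(2,4) unfolding chain_def by auto
qed

text \<open>Exchanging the ends one at a time makes chains for different colour pairs start at
  prescribed neighbours of \<open>v\<close>, so that they share ends as the configuration lemmas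
  demand.\<close>

lemma stuck_chains:
  assumes "stuck v a b" "a \<noteq> b" "\<not> joined v a b" "v \<notin> S" "x \<in> colour_nbrs v a" "y \<in> colour_nbrs v b"
  shows "\<exists>p q r s. chain v x p q r s y"
proof -
  obtain x0 y0 p q r s where c: "x0 \<in> colour_nbrs v a" "y0 \<in> colour_nbrs v b" "chain v x0 p q r s y0"
    using stuck_chain[OF assms(1-4)] by blast
  have non: "\<not> E x' y'" "\<not> E y' x'" if "x' \<in> colour_nbrs v a" "y' \<in> colour_nbrs v b" for x' y'
    using assms(3) that commute unfolding joined_def by blast+
  have "chain v x p q r s y0"
    using chain_replace[OF c(3), of x] assms(5) c(1,2) non[OF assms(5) c(2)]
    unfolding colour_nbrs_def by simp
  then have "chain v y0 s r q p x" by (rule chain_reverse)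
  then have "chain v y s r q p x"
    using chain_replace[of v y0 s r q p x y] assms(6) c(2) non[OF assms(5,6)]
    unfolding colour_nbrs_def by simp
  then show ?thesis using chain_reverse by blast
qed

lemma three_stuck_colours:
  assumes "v \<notin> S" "distinct [a, b, c]" "stuck v a b" "stuck v b c" "stuck v c a"
    and "colour_nbrs v a \<noteq> {}" "colour_nbrs v b \<noteq> {}" "colour_nbrs v c \<noteq> {}"
  shows "joined v a b \<or> joined v b c \<or> joined v c a"
proof (rule ccontr)
  assume "\<not> ?thesis"
  then have non: "\<not> joined v a b" "\<not> joined v b c" "\<not> joined v c a" by auto
  obtain x y z where "x \<in> colour_nbrs v a" "y \<in> colour_nbrs v b" "z \<in> colour_nbrs v c"
    using assms(6-8) by blast
  then show False
    using stuck_chains[OF assms(3) _ non(1) assms(1), of x y] stuck_chains[OF assms(4) _ non(2) assms(1), of y z]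
      stuck_chains[OF assms(5) _ non(3) assms(1), of z x] assms(2) no_three_chains by auto
qed

lemma two_stuck_colours:
  assumes "v \<notin> S" "x \<in> colour_nbrs v a" "y \<in> colour_nbrs v b" "z \<in> colour_nbrs v c"
    and "a \<noteq> b" "a \<noteq> c" "stuck v a b" "stuck v a c" "\<not> joined v a b" "\<not> joined v a c"
    and "E v x'" "E x x'" "E y z" "\<not> E x' y" "\<not> E x' z"
  shows False
proof -
  obtain p1 p2 p3 p4 where "chain v x p1 p2 p3 p4 y"
    using stuck_chains[of v a b x y] assms by blast
  moreover obtain q1 q2 q3 q4 where "chain v x q1 q2 q3 q4 z"
    using stuck_chains[of v a c x z] assms by blast
  ultimately show False using no_two_chains assms(11-) by blast
qed

text \<open>If all pairs are stuck, the nonuniversal neighbours of \<open>v\<close> carry at least two colours more than their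
  largest clique \<open>K\<close> has vertices. Two such extra colours that are not joined form, with a colour of \<open>K\<close>,
  three mutually unjoined colours; if all of them are joined, they occur on the only other nontrivial
  clique, and \<open>K\<close> has two vertices whose colours do not.\<close>

lemma some_pair_not_stuck:
  assumes "finite S" "v \<notin> S" and two: "two_clique_vertex (insert v S) v"
    and col: "\<phi> ` S \<subseteq> {1..k}"
    and clique: "\<And>K. K \<subseteq> insert v S \<Longrightarrow> (\<forall>x\<in>K. \<forall>y\<in>K. x \<noteq> y \<longrightarrow> E x y) \<Longrightarrow> card K < k"
  shows "\<exists>a\<in>{1..k}. \<exists>b\<in>{1..k}. \<not> stuck v a b"
proof (rule ccontr)
  assume "\<not> ?thesis"
  then have stuck: "stuck v a b" if "a \<in> {1..k}" "b \<in> {1..k}" for a b using that by blast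
  have nonempty: "colour_nbrs v a \<noteq> {}" if "a \<in> {1..k}" for a
    using stuck[OF that that] unfolding stuck_def by blast
  define N where "N = {x\<in>S. E v x}"
  define X where "X = {x. nonuniversal (insert v S) v x}"
  define U where "U = N - X"
  have "X \<subseteq> N" unfolding X_def N_def nonuniversal_def by auto
  have fin: "finite N" "finite X" "finite U"
    using assms(1) finite_subset[OF \<open>X \<subseteq> N\<close>] unfolding N_def U_def by auto
  have U: "E u x" if "u \<in> U" "x \<in> N" "x \<noteq> u" for u x
    using that unfolding U_def X_def N_def nonuniversal_def by blast
  have trans: "E x z" if "x \<in> X" "y \<in> X" "z \<in> X" "E x y" "E y z" "x \<noteq> z" for x y z
  proof -
    have "x \<in> insert v S" "y \<in> insert v S" "z \<in> insert v S"
      using that(1-3) unfolding X_def nonuniversal_def by blast+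
    then show ?thesis
      using two that unfolding two_clique_vertex_def X_def by blast
  qed
  have three: "x = y \<or> y = z \<or> x = z \<or> E x y \<or> E y z \<or> E x z"
    if "x \<in> X" "E x x'" "x' \<in> X" "y \<in> X" "E y y'" "y' \<in> X" "z \<in> X" "E z z'" "z' \<in> X" for x x' y y' z z'
  proof -
    have inX: "w \<in> insert v S" if "w \<in> X" for w using that unfolding X_def nonuniversal_def by blast
    have "linked (insert v S) v w" if "w \<in> X" "w' \<in> X" "E w w'" for w w'
      using that inX unfolding linked_def X_def by blast
    then have "linked (insert v S) v x" "linked (insert v S) v y" "linked (insert v S) v z"
      using that by blast+
    then show ?thesis
      using two inX[OF that(1)] inX[OF that(4)] inX[OF that(7)] unfolding two_clique_vertex_def by blast
  qed
  have same: "\<phi> x = \<phi> y \<Longrightarrow> x \<in> N \<Longrightarrow> y \<in> N \<Longrightarrow> \<not> E x y" for x y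
    using proper[of x y] unfolding N_def by auto
  have colX: "colour_nbrs v (\<phi> x) \<subseteq> X" if "x \<in> X" for x
  proof
    fix y assume "y \<in> colour_nbrs v (\<phi> x)"
    then have y: "y \<in> N" "\<phi> y = \<phi> x" unfolding colour_nbrs_def N_def by auto
    show "y \<in> X"
    proof (rule ccontr)
      assume "y \<notin> X"
      then have "E y x" using U[of y x] y that \<open>X \<subseteq> N\<close> unfolding U_def by auto
      then show False using same[of y x] y that \<open>X \<subseteq> N\<close> by auto
    qed
  qed
  have nbrX: "x \<in> colour_nbrs v (\<phi> x)" if "x \<in> X" for x
    using that \<open>X \<subseteq> N\<close> unfolding colour_nbrs_def N_def by auto
  have range: "\<phi> x \<in> {1..k}" if "x \<in> X" for x
    using that \<open>X \<subseteq> N\<close> col unfolding N_def by blast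
  have joinedE: "\<exists>x y. x \<in> X \<and> y \<in> X \<and> E x y \<and> \<phi> x = a \<and> \<phi> y = b"
    if "joined v a b" "a \<in> \<phi> ` X" "b \<in> \<phi> ` X" for a b
    using that colX unfolding joined_def colour_nbrs_def by blast
  have joinedI: "joined v (\<phi> x) (\<phi> y)" if "x \<in> X" "y \<in> X" "E x y" for x y
    using that nbrX unfolding joined_def by blast
  \<comment> \<open>\<open>K\<close>, \<open>U\<close> and \<open>v\<close> form a clique, so
    \<open>card K + card U + 1 < k\<close>, while all \<open>k\<close> colours occur on
    \<open>X\<close> and \<open>U\<close>.\<close>
  have key: "card K + 2 \<le> card (\<phi> ` X)" if K: "K \<subseteq> X" "\<And>x y. x \<in> K \<Longrightarrow> y \<in> K \<Longrightarrow> x \<noteq> y \<Longrightarrow> E x y" for K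
  proof -
    have "{1..k} \<subseteq> \<phi> ` X \<union> \<phi> ` U"
    proof
      fix a assume "a \<in> {1..k}"
      then obtain x where "x \<in> colour_nbrs v a" using nonempty by blast
      then show "a \<in> \<phi> ` X \<union> \<phi> ` U" unfolding colour_nbrs_def U_def N_def by blast
    qed
    then have "k \<le> card (\<phi> ` X \<union> \<phi> ` U)"
      using card_mono[of "\<phi> ` X \<union> \<phi> ` U" "{1..k}"] fin by simp
    also have "\<dots> \<le> card (\<phi> ` X) + card (\<phi> ` U)" by (rule card_Un_le)
    also have "card (\<phi> ` U) \<le> card U" using fin by (simp add: card_image_le)
    finally have k: "k \<le> card (\<phi> ` X) + card U" by simp
    have "K \<subseteq> N" "K \<inter> U = {}" "v \<notin> K \<union> U"
      using K(1) \<open>X \<subseteq> N\<close> assms(2) unfolding U_def N_def by auto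
    then have "card (insert v (K \<union> U)) = Suc (card K + card U)"
      using fin finite_subset[OF \<open>K \<subseteq> N\<close>] by (simp add: card_Un_disjoint)
    moreover have "card (insert v (K \<union> U)) < k"
    proof (rule clique)
      show "insert v (K \<union> U) \<subseteq> insert v S" using \<open>K \<subseteq> N\<close> unfolding U_def N_def by auto
      have vN: "E v x" "E x v" if "x \<in> N" for x using that commute unfolding N_def by auto
      have "E x y" if "x \<in> K \<union> U" "y \<in> K \<union> U" "x \<noteq> y" for x y
      proof (cases "x \<in> U \<or> y \<in> U")
        case True
        then show ?thesis
          using U[of x y] U[of y x] that \<open>K \<subseteq> N\<close> commute[of x y] unfolding U_def by blast
      next
        case False
        then show ?thesis using that K(2) by blast
      qed
      then show "\<forall>x\<in>insert v (K \<union> U). \<forall>y\<in>insert v (K \<union> U). x \<noteq> y \<longrightarrow> E x y"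
        using vN \<open>K \<subseteq> N\<close> unfolding U_def by blast
    qed
    ultimately show ?thesis using k by simp
  qed
  \<comment> \<open>The clique of \<open>X\<close> that contains \<open>x\<close>; by transitivity
    these cliques partition \<open>X\<close>. \<open>K\<close> will be a largest one, and
    \<open>R\<close> the colours of \<open>X\<close> missing on it.\<close>
  define comp where "comp = (\<lambda>x. {y\<in>X. y = x \<or> E x y})"
  have comp_clique: "E y z" if "x \<in> X" "y \<in> comp x" "z \<in> comp x" "y \<noteq> z" for x y z
    using that trans[of y x z] commute unfolding comp_def by auto
  have comp_inj: "inj_on \<phi> (comp x)" if "x \<in> X" for x
    using comp_clique[OF that] same \<open>X \<subseteq> N\<close> unfolding comp_def inj_on_def by blast
  have comp_fin: "finite (comp x)" for x using fin unfolding comp_def by simp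
  have "X \<noteq> {}" using key[of "{}"] by auto
  then obtain x1 where "x1 \<in> X" by blast
  moreover have "card (comp x) < Suc (card X)" for x
    using card_mono[OF fin(2), of "comp x"] unfolding comp_def by (auto simp: less_Suc_eq_le)
  ultimately obtain x0 where x0: "x0 \<in> X" and max: "\<And>x. x \<in> X \<Longrightarrow> card (comp x) \<le> card (comp x0)"
    using ex_has_greatest_nat[of "\<lambda>x. x \<in> X" x1 "\<lambda>x. card (comp x)" "Suc (card X)"] by blast
  define K where "K = comp x0"
  have K: "K \<subseteq> X" "x0 \<in> K" "finite K" using x0 comp_fin unfolding K_def comp_def by auto
  have Kcl: "E y z" if "y \<in> K" "z \<in> K" "y \<noteq> z" for y z
    using comp_clique[OF x0] that unfolding K_def by blast
  have Kclosed: "y \<in> K" if "x \<in> K" "y \<in> X" "E x y" for x y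
    using that x0 trans[of x0 x y] unfolding K_def comp_def by auto
  define R where "R = \<phi> ` X - \<phi> ` K"
  have cardR: "2 \<le> card R"
  proof -
    have "card (\<phi> ` X) \<le> card (R \<union> \<phi> ` K)"
      unfolding R_def using fin K(3) by (intro card_mono) auto
    also have "\<dots> \<le> card R + card (\<phi> ` K)" by (rule card_Un_le)
    finally show ?thesis using key[of K] K Kcl card_image_le[of K \<phi>] by auto
  qed
  \<comment> \<open>\<open>K\<close> is at least as large as any clique of \<open>X\<close>, so it
    has an edge if another one does. This leaves room for only one further clique with an
    edge.\<close>
  have other: "z \<in> comp x"
    if "x \<in> X - K" "x' \<in> X" "E x x'" "z \<in> X - K" "z' \<in> X" "E z z'" for x x' z z'
  proof -
    have "{x, x'} \<subseteq> comp x" "x \<noteq> x'" using that unfolding comp_def by auto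
    then have "2 \<le> card (comp x)" using card_mono[OF comp_fin, of "{x, x'}" x] by auto
    then have "2 \<le> card K" using max[of x] that unfolding K_def by auto
    then have "K \<noteq> {x0}" by auto
    then obtain y0 where "y0 \<in> K" "y0 \<noteq> x0" using K by blast
    then have "E x0 y0" "y0 \<in> X" using K Kcl by auto
    moreover have "x \<noteq> x0" "z \<noteq> x0" "\<not> E x0 x" "\<not> E x0 z"
      using that K Kclosed by blast+
    ultimately show ?thesis
      using three[of x x' z z' x0 y0] that x0 commute[of z x0] commute[of x x0] unfolding comp_def by blast
  qed
  have compI: "y \<in> comp x" if "z \<in> comp x" "x \<in> X" "y \<in> X" "E z y" for x y z
    using that trans[of x z y] unfolding comp_def by auto
  have notK: "x \<in> X - K" "y \<in> X - K"
    if "x \<in> X" "y \<in> X" "E x y" "\<phi> x \<in> R \<or> \<phi> y \<in> R" for x y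
    using that Kclosed[of x y] Kclosed[of y x] commute[of x y] unfolding R_def by blast+
  have inR: "a \<in> \<phi> ` X" if "a \<in> R" for a using that unfolding R_def by blast
  have inK: "a \<in> \<phi> ` X" if "a \<in> \<phi> ` K" for a using that K(1) by blast
  have rng: "a \<in> {1..k}" if "a \<in> \<phi> ` X" for a using that range by blast
  show False
  proof (cases "\<exists>a\<in>R. \<exists>b\<in>R. a \<noteq> b \<and> \<not> joined v a b")
    case True
    then obtain a b where ab: "a \<in> R" "b \<in> R" "a \<noteq> b" "\<not> joined v a b" by blast
    have "\<exists>c\<in>\<phi> ` K. \<not> joined v c a \<and> \<not> joined v c b"
    proof (rule ccontr)
      assume "\<not> ?thesis"
      then have J: "joined v c a \<or> joined v c b" if "c \<in> \<phi> ` K" for c using that by blast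
      \<comment> \<open>Every colour of \<open>K\<close> is joined to \<open>a\<close> or
        \<open>b\<close>, and such an edge lies outside \<open>K\<close>, hence in the single other
        nontrivial clique. That clique then carries all colours of \<open>K\<close> and also
        \<open>a\<close>, so it is larger than \<open>K\<close>.\<close>
      have no: "\<not> joined v (\<phi> x0) a"
        if ab: "a \<in> R" "b \<in> R" "a \<noteq> b" "\<not> joined v a b" "\<not> joined v b a"
          and J: "\<And>c. c \<in> \<phi> ` K \<Longrightarrow> joined v c a \<or> joined v c b" for a b
      proof
        assume "joined v (\<phi> x0) a"
        then obtain x x' where x: "x \<in> X" "x' \<in> X" "E x x'" "\<phi> x = \<phi> x0" "\<phi> x' = a"
          using joinedE[of "\<phi> x0" a] inR[OF ab(1)] x0 by blast
        have xK: "x \<in> X - K" "x' \<in> X - K" using notK[OF x(1-3)] x(5) ab(1) by auto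
        have "c \<in> \<phi> ` comp x" if c: "c \<in> \<phi> ` K" for c
        proof -
          obtain z z' where z: "z \<in> X" "z' \<in> X" "E z z'" "\<phi> z = c" "\<phi> z' = a \<or> \<phi> z' = b"
            using J[OF c] joinedE[of c a] joinedE[of c b] inR ab(1,2) inK[OF c] by blast
          have "z \<in> X - K" using notK[OF z(1-3)] z(5) ab(1,2) by auto
          then have "z \<in> comp x" using other[of x x' z z'] xK x z by blast
          then show ?thesis using z(4) by blast
        qed
        then have "insert a (\<phi> ` K) \<subseteq> \<phi> ` comp x"
          using x unfolding comp_def by blast
        then have "card (insert a (\<phi> ` K)) \<le> card (\<phi> ` comp x)"
          using comp_fin by (intro card_mono) auto
        moreover have "card (\<phi> ` comp x) = card (comp x)" "card (\<phi> ` K) = card K"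
          using comp_inj x(1) x0 card_image unfolding K_def by blast+
        moreover have "a \<notin> \<phi> ` K" using ab(1) unfolding R_def by blast
        ultimately show False using max[OF x(1)] K(3) unfolding K_def by simp
      qed
      have "\<not> joined v b a" using ab(4) joined_commute by blast
      then show False
        using no[of a b] no[of b a] J[of "\<phi> x0"] ab J K(2) by blast
    qed
    then obtain c where c: "c \<in> \<phi> ` K" "\<not> joined v c a" "\<not> joined v c b" by blast
    have "distinct [a, b, c]" using ab c unfolding R_def by auto
    moreover have "a \<in> {1..k}" "b \<in> {1..k}" "c \<in> {1..k}"
      using rng[OF inR[OF ab(1)]] rng[OF inR[OF ab(2)]] rng[OF inK[OF c(1)]] by auto
    ultimately show False
      using three_stuck_colours[OF assms(2), of a b c] stuck nonempty ab c joined_commute by blast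
  next
    case False
    then have J: "joined v a b" if "a \<in> R" "b \<in> R" "a \<noteq> b" for a b using that by blast
    obtain a b where ab: "a \<in> R" "b \<in> R" "a \<noteq> b"
      using cardR by (metis card_le_Suc0_iff_eq card.infinite not_less_eq_eq numeral_2_eq_2 zero_le)
    obtain x y where xy: "x \<in> X" "y \<in> X" "E x y" "\<phi> x = a" "\<phi> y = b"
      using joinedE[OF J[OF ab]] inR ab by blast
    have xyK: "x \<in> X - K" "y \<in> X - K" using notK[OF xy(1-3)] xy ab by auto
    have Rsub: "R \<subseteq> \<phi> ` comp x"
    proof
      fix c assume c: "c \<in> R"
      obtain d where d: "d \<in> R" "c \<noteq> d" using ab by metis
      obtain z w where z: "z \<in> X" "w \<in> X" "E z w" "\<phi> z = c" "\<phi> w = d"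
        using joinedE[OF J[OF c d]] inR c d by blast
      have "z \<in> X - K" using notK[OF z(1-3)] z c by auto
      then have "z \<in> comp x" using other[of x y z w] xyK xy z by blast
      then show "c \<in> \<phi> ` comp x" using z by blast
    qed
    define P where "P = {p\<in>K. \<phi> p \<notin> \<phi> ` comp x}"
    \<comment> \<open>\<open>comp x\<close> is no larger than \<open>K\<close> and carries the
      disjoint colour sets of \<open>K - P\<close> and \<open>R\<close>, the latter of size at least
      2.\<close>
    have "2 \<le> card P"
    proof -
      have "card (\<phi> ` (K - P) \<union> R) \<le> card (\<phi> ` comp x)"
        using comp_fin Rsub unfolding P_def by (intro card_mono) auto
      moreover have "card (\<phi> ` (K - P) \<union> R) = card (\<phi> ` (K - P)) + card R"
        using K(3) fin unfolding R_def by (intro card_Un_disjoint) auto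
      moreover have "card (\<phi> ` (K - P)) = card (K - P)"
        using comp_inj[OF x0] unfolding K_def by (intro card_image) (rule inj_on_diff)
      moreover have "card (\<phi> ` comp x) \<le> card K"
        using card_image_le[OF comp_fin, of \<phi> x] max[OF xy(1)] unfolding K_def by simp
      moreover have "card (K - P) = card K - card P" "card P \<le> card K"
        using K(3) unfolding P_def by (auto intro!: card_Diff_subset card_mono)
      ultimately show ?thesis using cardR by linarith
    qed
    then obtain p p' where p: "p \<in> P" "p' \<in> P" "p \<noteq> p'"
      by (metis card_le_Suc0_iff_eq card.infinite not_less_eq_eq numeral_2_eq_2 zero_le)
    have pK: "p \<in> K" "p' \<in> K" "\<phi> p \<notin> \<phi> ` comp x" using p unfolding P_def by auto
    have non: "\<not> joined v (\<phi> p) c" if c: "c \<in> R" for c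
    proof
      assume "joined v (\<phi> p) c"
      then obtain z z' where z: "z \<in> X" "z' \<in> X" "E z z'" "\<phi> z = \<phi> p" "\<phi> z' = c"
        using joinedE[of "\<phi> p" c] inR[OF c] pK(1) K(1) by blast
      have "z \<in> X - K" using notK[OF z(1-3)] z(5) c by auto
      then have "z \<in> comp x" using other[of x y z z'] xyK xy z by blast
      then show False using z(4) pK(3) by (metis image_eqI)
    qed
    \<comment> \<open>The colour of \<open>p\<close> is linked by chains to both ends of the edge
      \<open>x y\<close>, and \<open>p'\<close> serves as the common neighbour of \<open>v\<close>
      and \<open>p\<close> that misses this edge.\<close>
    have "\<phi> p \<noteq> a" "\<phi> p \<noteq> b" using ab pK unfolding R_def by blast+
    moreover have "\<not> E p' x" "\<not> E p' y" using xyK Kclosed[OF pK(2)] by blast+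
    moreover have "E v p'" using pK K(1) \<open>X \<subseteq> N\<close> unfolding N_def by blast
    moreover have "E p p'" using Kcl pK p by blast
    moreover have "stuck v (\<phi> p) a" "stuck v (\<phi> p) b"
      using stuck[OF rng rng, OF inK inR, of "\<phi> p"] ab pK(1) by simp_all
    moreover have "x \<in> colour_nbrs v a" "y \<in> colour_nbrs v b" "p \<in> colour_nbrs v (\<phi> p)"
      using nbrX[of x] nbrX[of y] nbrX[of p] xy pK(1) K(1) by auto
    ultimately show False
      using two_stuck_colours[OF assms(2), of p "\<phi> p" x a y b p'] xy(3) non ab(1,2) by simp
  qed
qed

section \<open>Correctness of a Kempe change\<close>

lemma reachD:
  assumes "reach v a b x"
  shows "x \<in> S" "\<phi> x \<in> {a, b}"
  using assms by (induction) (auto simp: colour_nbrs_def)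

text \<open>Reached vertices carry \<open>a\<close> or \<open>b\<close>, so subtraction from
  \<open>a + b\<close> exchanges the two colours.\<close>

definition kempe :: "'a \<Rightarrow> nat \<Rightarrow> nat \<Rightarrow> 'a \<Rightarrow> nat" where
  "kempe v a b x = (if x = v then a else if reach v a b x then a + b - \<phi> x else \<phi> x)"

text \<open>The reached set is closed under both colours, which settles edges inside
  \<open>S\<close>. No neighbour of \<open>v\<close> ends with colour \<open>a\<close>: an unreached
  one never had it, and a reached one does not have colour \<open>b\<close>, the pair not being
  stuck.\<close>

lemma kempe_proper:
  assumes "v \<notin> S" "\<not> stuck v a b" "x \<in> insert v S" "y \<in> insert v S" "E x y"
  shows "kempe v a b x \<noteq> kempe v a b y"
proof -
  have at_v: "kempe v a b y \<noteq> a" if "y \<in> S" "E v y" for y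
  proof
    assume H: "kempe v a b y = a"
    have "y \<noteq> v" using that(1) assms(1) by blast
    show False
    proof (cases "reach v a b y")
      case True
      then have "\<phi> y \<noteq> b"
        using assms(2) that unfolding stuck_def colour_nbrs_def by blast
      then show False using reachD[OF True] H True \<open>y \<noteq> v\<close> unfolding kempe_def by auto
    next
      case False
      then have "\<phi> y \<noteq> a"
        using start[of y v a b] that unfolding colour_nbrs_def by blast
      then show False using H False \<open>y \<noteq> v\<close> unfolding kempe_def by auto
    qed
  qed
  have in_S: "kempe v a b x \<noteq> kempe v a b y" if "x \<in> S" "y \<in> S" "E x y" "reach v a b x" for x y
  proof (cases "reach v a b y")
    case True
    then show ?thesis
      using reachD(2)[OF True] reachD(2)[OF that(4)] proper[OF that(1-3)] that assms(1)
      unfolding kempe_def by auto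
  next
    case False
    then have "\<phi> y \<notin> {a, b}" using step[OF that(4,2,3)] by blast
    then show ?thesis
      using reachD(2)[OF that(4)] False that assms(1) unfolding kempe_def by auto
  qed
  have v: "kempe v a b v = a" unfolding kempe_def by simp
  consider "x = v" | "y = v" "x \<noteq> v" | "x \<in> S" "y \<in> S" using assms(3,4) by blast
  then show ?thesis
  proof cases
    case 1
    moreover have "y \<noteq> v" using 1 assms(5) by auto
    ultimately show ?thesis using at_v[of y] assms(4,5) v by auto
  next
    case 2
    then show ?thesis using at_v[of x] assms(3,5) commute[of x y] v by auto
  next
    case 3
    then show ?thesis
      using in_S[of x y] in_S[of y x] proper[OF 3 assms(5)] assms(1,5) commute[of x y]
      unfolding kempe_def by (cases "reach v a b x"; cases "reach v a b y") auto
  qed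
qed

lemma kempe_range:
  assumes "\<phi> ` S \<subseteq> {1..k}" "a \<in> {1..k}" "b \<in> {1..k}"
  shows "kempe v a b ` insert v S \<subseteq> {1..k}"
proof -
  have "kempe v a b x \<in> {1..k}" if "x \<in> insert v S" for x
  proof (cases "x \<noteq> v \<and> reach v a b x")
    case True
    then have "kempe v a b x \<in> {a, b}" using reachD(2)[of v a b x] unfolding kempe_def by auto
    then show ?thesis using assms by auto
  next
    case False
    then show ?thesis using assms that unfolding kempe_def by auto
  qed
  then show ?thesis by blast
qed

lemma removable_not_stuck:
  assumes "finite S" "v \<notin> S" "removable (insert v S) v" "\<phi> ` S \<subseteq> {1..k}"
    and "\<And>K. K \<subseteq> insert v S \<Longrightarrow> (\<forall>x\<in>K. \<forall>y\<in>K. x \<noteq> y \<longrightarrow> E x y) \<Longrightarrow> card K < k"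
  shows "\<exists>a\<in>{1..k}. \<exists>b\<in>{1..k}. \<not> stuck v a b"
proof (cases "dominated (insert v S) v")
  case True
  then obtain z where z: "z \<in> S" "\<And>x. x \<in> S \<Longrightarrow> E v x \<Longrightarrow> E z x"
    unfolding dominated_def by blast
  then have "colour_nbrs v (\<phi> z) = {}"
    using proper[OF z(1)] unfolding colour_nbrs_def by fastforce
  \<comment> \<open>The degenerate pair \<open>a = b\<close>: the colour of the dominating vertex is
    free at \<open>v\<close>.\<close>
  then have "\<not> stuck v (\<phi> z) (\<phi> z)" unfolding stuck_def by blast
  then show ?thesis using z(1) assms(4) by blast
next
  case False
  then show ?thesis
    using some_pair_not_stuck[OF assms(1,2) _ assms(4,5)] assms(3) unfolding removable_def by blast
qed

end

text \<open>The existence argument over an arbitrary vertex type; the program treats only graphs on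
  an initial segment of the naturals.\<close>

lemma (in pckp_free) colourable:
  assumes "finite S" "\<And>K. K \<subseteq> S \<Longrightarrow> (\<forall>x\<in>K. \<forall>y\<in>K. x \<noteq> y \<longrightarrow> E x y) \<Longrightarrow> card K < k"
  shows "\<exists>\<phi>. \<phi> ` S \<subseteq> {1..k} \<and> (\<forall>x\<in>S. \<forall>y\<in>S. E x y \<longrightarrow> \<phi> x \<noteq> \<phi> y)"
  using assms
proof (induction S rule: finite_psubset_induct)
  case (psubset S)
  show ?case
  proof (cases "S = {}")
    case False
    then obtain v where v: "v \<in> S" "removable S v" using exists_removable psubset.hyps by blast
    let ?T = "S - {v}"
    have S: "insert v ?T = S" using v by blast
    obtain \<phi> where \<phi>: "\<phi> ` ?T \<subseteq> {1..k}" "\<forall>x\<in>?T. \<forall>y\<in>?T. E x y \<longrightarrow> \<phi> x \<noteq> \<phi> y"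
    proof -
      have "?T \<subset> S" using v by blast
      moreover have "card K < k" if "K \<subseteq> ?T" "\<forall>x\<in>K. \<forall>y\<in>K. x \<noteq> y \<longrightarrow> E x y" for K
        by (rule psubset.prems) (use that in auto)
      ultimately show thesis using psubset.IH[of ?T] that by blast
    qed
    interpret coloured_pckp_free E ?T \<phi> by unfold_locales (use \<phi>(2) in blast)
    obtain a b where ab: "a \<in> {1..k}" "b \<in> {1..k}" "\<not> stuck v a b"
      using removable_not_stuck[of v k, unfolded S] psubset.prems psubset.hyps v(2) \<phi>(1) by auto
    have "kempe v a b ` S \<subseteq> {1..k}" using kempe_range[OF \<phi>(1) ab(1,2), of v] unfolding S .
    moreover have "\<forall>x\<in>S. \<forall>y\<in>S. E x y \<longrightarrow> kempe v a b x \<noteq> kempe v a b y"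
      using kempe_proper[of v a b] ab(3) unfolding S by blast
    ultimately show ?thesis by blast
  qed auto
qed

lemma simple_graphD:
  assumes "simple_graph G" "adjacent G u v"
  shows "u \<in> verts G" "v \<in> verts G" "u \<noteq> v"
proof -
  obtain x y where "{u, v} = {x, y}" "x \<in> verts G" "y \<in> verts G" "x \<noteq> y"
    using assms unfolding simple_graph_def by blast
  then show "u \<in> verts G" "v \<in> verts G" "u \<noteq> v" by (auto simp: doubleton_eq_iff)
qed

section \<open>From graphs to adjacency relations\<close>

text \<open>Positions in \<open>xs\<close> are the vertices of \<open>H\<close>, so the inverse of
  indexing is the isomorphism. Adjacency is asked for \<open>i < j\<close> only, as edges are
  unordered and both graphs are loopless.\<close>

lemma free_of_pattern:
  assumes G: "simple_graph G" and free: "free_of G \<H>" "H \<in> \<H>" "verts H = {..<length xs}"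
    and dist: "distinct xs" and verts: "set xs \<subseteq> verts G"
    and H: "\<And>i. \<not> adjacent H i i"
    and adj: "\<forall>j<length xs. \<forall>i<j. adjacent G (xs ! i) (xs ! j) \<longleftrightarrow> adjacent H i j"
  shows False
proof -
  let ?f = "the_inv_into {..<length xs} ((!) xs)"
  have b: "bij_betw ((!) xs) {..<length xs} (set xs)"
    using dist by (rule bij_betw_nth) auto
  then have inj: "inj_on ((!) xs) {..<length xs}" by (rule bij_betw_imp_inj_on)
  have "graph_iso (induced_subgraph G (set xs)) H"
    unfolding graph_iso_def
  proof (intro exI conjI ballI)
    show "bij_betw ?f (verts (induced_subgraph G (set xs))) (verts H)"
      using bij_betw_the_inv_into[OF b] free(3) by (simp add: induced_subgraph_def)
    fix u v
    assume "u \<in> verts (induced_subgraph G (set xs))" "v \<in> verts (induced_subgraph G (set xs))"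
    then obtain i j where ij: "i < length xs" "u = xs ! i" "j < length xs" "v = xs ! j"
      by (auto simp: induced_subgraph_def in_set_conv_nth)
    have "adjacent G u v \<longleftrightarrow> adjacent H i j"
    proof (cases i j rule: linorder_cases)
      case less
      then show ?thesis using adj ij by blast
    next
      case equal
      then show ?thesis using H[of j] simple_graphD(3)[OF G, of v v] ij by auto
    next
      case greater
      then have "adjacent G v u \<longleftrightarrow> adjacent H j i" using adj ij by blast
      then show ?thesis by (simp only: insert_commute)
    qed
    moreover have "?f u = i" "?f v = j" using ij the_inv_into_f_f[OF inj] by auto
    ultimately show "adjacent (induced_subgraph G (set xs)) u v \<longleftrightarrow> adjacent H (?f u) (?f v)"
      using ij by (simp add: induced_subgraph_def)
  qed
  then show False using free(1,2) verts unfolding free_of_def by blast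
qed

text \<open>An image of a list of indices can be enumerated by the simplifier once \<open>n\<close>
  is a numeral.\<close>

lemma path_graph_edges:
  "edges (path_graph n) = (\<lambda>i. {i, i + 1}) ` set [0..<n - 1]"
  unfolding path_graph_def by auto

lemma path_graph_4_edges: "edges (path_graph 4) = {{0, 1}, {1, 2}, {2, 3}}"
  and path_graph_7_edges:
    "edges (path_graph 7) = {{0, 1}, {1, 2}, {2, 3}, {3, 4}, {4, 5}, {5, 6}}"
  unfolding path_graph_edges by (simp add: upt_rec, simp add: numeral_eq_Suc)+

lemma cycle_graph_edges:
  "edges (cycle_graph n) = (\<lambda>i. {i, (i + 1) mod n}) ` set [0..<n]"
  unfolding cycle_graph_def by auto

lemma cycle_graph_4_edges: "edges (cycle_graph 4) = {{0, 1}, {1, 2}, {2, 3}, {3, 0}}"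
  and cycle_graph_5_edges: "edges (cycle_graph 5) = {{0, 1}, {1, 2}, {2, 3}, {3, 4}, {4, 0}}"
  unfolding cycle_graph_edges by (simp add: upt_rec, simp add: numeral_eq_Suc)+

lemma pckp_free_adjacent:
  assumes G: "simple_graph G" and free: "free_of G {path_graph 7, cycle_graph 5, kite, paraglider}"
  shows "pckp_free (adjacent G)"
proof
  let ?E = "adjacent G"
  fix a b c d e f g x y
  show comm: "?E x y \<longleftrightarrow> ?E y x" for x y by (simp add: insert_commute)
  show irr: "\<not> ?E x x" for x using simple_graphD(3)[OF G, of x x] by blast
  note D = simple_graphD(1,2)[OF G]
  show "\<not> ind_P7 ?E a b c d e f g"
  proof
    assume P: "ind_P7 ?E a b c d e f g"
    have ed: "edges (path_graph 7) = {{0, 1}, {1, 2}, {2, 3}, {3, 4}, {4, 5}, {5, 6}}"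
      by (rule path_graph_7_edges)
    show False
    proof (rule free_of_pattern[OF G free, of "(path_graph 7)" "[a, b, c, d, e, f, g]"])
      show "distinct [a, b, c, d, e, f, g]" using P comm irr unfolding ind_P7_def by auto
      show "set [a, b, c, d, e, f, g] \<subseteq> verts G" using P D unfolding ind_P7_def by auto
      show "verts (path_graph 7) = {..<length [a, b, c, d, e, f, g]}" by (auto simp: path_graph_def)
      show "\<not> adjacent (path_graph 7) i i" for i unfolding ed by auto
      show "\<forall>j<length [a, b, c, d, e, f, g]. \<forall>i<j.
          adjacent G ([a, b, c, d, e, f, g] ! i) ([a, b, c, d, e, f, g] ! j) \<longleftrightarrow> adjacent (path_graph 7) i j"
        unfolding ed using P unfolding ind_P7_def
        by (simp add: All_less_Suc numeral_eq_Suc doubleton_eq_iff)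
    qed simp
  qed
  show "\<not> ind_C5 ?E a b c d e"
  proof
    assume P: "ind_C5 ?E a b c d e"
    have ed: "edges (cycle_graph 5) = {{0, 1}, {1, 2}, {2, 3}, {3, 4}, {4, 0}}"
      by (rule cycle_graph_5_edges)
    show False
    proof (rule free_of_pattern[OF G free, of "(cycle_graph 5)" "[a, b, c, d, e]"])
      show "distinct [a, b, c, d, e]" using P comm irr unfolding ind_C5_def by auto
      show "set [a, b, c, d, e] \<subseteq> verts G" using P D unfolding ind_C5_def by auto
      show "verts (cycle_graph 5) = {..<length [a, b, c, d, e]}" by (auto simp: cycle_graph_def)
      show "\<not> adjacent (cycle_graph 5) i i" for i unfolding ed by auto
      show "\<forall>j<length [a, b, c, d, e]. \<forall>i<j.
          adjacent G ([a, b, c, d, e] ! i) ([a, b, c, d, e] ! j) \<longleftrightarrow> adjacent (cycle_graph 5) i j"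
        unfolding ed using P unfolding ind_C5_def
        by (simp add: All_less_Suc numeral_eq_Suc doubleton_eq_iff)
    qed simp
  qed
  show "\<not> ind_kite ?E a b c d x"
  proof
    assume P: "ind_kite ?E a b c d x"
    have ed: "edges kite = {{4, 0}, {4, 1}, {4, 2}, {0, 1}, {1, 2}, {2, 3}}"
      unfolding kite_def add_vertex_def graph.sel path_graph_4_edges
        setcompr_eq_image Collect_mem_eq by simp
    show False
    proof (rule free_of_pattern[OF G free, of "kite" "[a, b, c, d, x]"])
      show "distinct [a, b, c, d, x]" using P comm irr unfolding ind_kite_def by auto
      show "set [a, b, c, d, x] \<subseteq> verts G" using P D unfolding ind_kite_def by auto
      show "verts kite = {..<length [a, b, c, d, x]}" by (auto simp: kite_def add_vertex_def path_graph_def)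
      show "\<not> adjacent kite i i" for i unfolding ed by auto
      show "\<forall>j<length [a, b, c, d, x]. \<forall>i<j.
          adjacent G ([a, b, c, d, x] ! i) ([a, b, c, d, x] ! j) \<longleftrightarrow> adjacent kite i j"
        unfolding ed using P unfolding ind_kite_def
        by (simp add: All_less_Suc numeral_eq_Suc doubleton_eq_iff)
    qed simp
  qed
  show "\<not> ind_paraglider ?E a b c d x"
  proof
    assume P: "ind_paraglider ?E a b c d x"
    have ed: "edges paraglider = {{4, 0}, {4, 1}, {4, 2}, {0, 1}, {1, 2}, {2, 3}, {3, 0}}"
      unfolding paraglider_def add_vertex_def graph.sel cycle_graph_4_edges
        setcompr_eq_image Collect_mem_eq by simp
    show False
    proof (rule free_of_pattern[OF G free, of "paraglider" "[a, b, c, d, x]"])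
      show "distinct [a, b, c, d, x]" using P comm irr unfolding ind_paraglider_def by auto
      show "set [a, b, c, d, x] \<subseteq> verts G" using P D unfolding ind_paraglider_def by auto
      show "verts paraglider = {..<length [a, b, c, d, x]}" by (auto simp: paraglider_def add_vertex_def cycle_graph_def)
      show "\<not> adjacent paraglider i i" for i unfolding ed by auto
      show "\<forall>j<length [a, b, c, d, x]. \<forall>i<j.
          adjacent G ([a, b, c, d, x] ! i) ([a, b, c, d, x] ! j) \<longleftrightarrow> adjacent paraglider i j"
        unfolding ed using P unfolding ind_paraglider_def
        by (simp add: All_less_Suc numeral_eq_Suc doubleton_eq_iff)
    qed simp
  qed
qed

lemma card_clique_le_clique_number:
  assumes "simple_graph G" "clique G K"
  shows "card K \<le> clique_number G"
proof -
  have "finite {K. clique G K}"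
    by (rule finite_subset[of _ "Pow (verts G)"]) (use assms in \<open>auto simp: clique_def simple_graph_def\<close>)
  then show ?thesis unfolding clique_number_def using assms(2) by (intro Max_ge) auto
qed

lemma card_less_clique_number:
  assumes "simple_graph G" "K \<subseteq> verts G" "\<forall>x\<in>K. \<forall>y\<in>K. x \<noteq> y \<longrightarrow> adjacent G x y"
  shows "card K < clique_number G + 1"
  using card_clique_le_clique_number[OF assms(1), of K] assms(2,3) unfolding clique_def by simp

lemma chromatic_number_bound:
  assumes "simple_graph G" "free_of G {path_graph 7, cycle_graph 5, kite, paraglider}"
  shows "chromatic_number G \<le> clique_number G + 1"
proof -
  interpret pckp_free "adjacent G" using pckp_free_adjacent[OF assms] .
  have "\<exists>\<phi>. \<phi> ` verts G \<subseteq> {1..clique_number G + 1} \<and>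
      (\<forall>x\<in>verts G. \<forall>y\<in>verts G. adjacent G x y \<longrightarrow> \<phi> x \<noteq> \<phi> y)"
  proof (rule colourable)
    show "finite (verts G)" using assms(1) unfolding simple_graph_def by blast
    show "card K < clique_number G + 1"
      if "K \<subseteq> verts G" "\<forall>x\<in>K. \<forall>y\<in>K. x \<noteq> y \<longrightarrow> adjacent G x y" for K
      using card_less_clique_number[OF assms(1)] that .
  qed
  then obtain \<phi> where "coloring G (clique_number G + 1) \<phi>"
    unfolding coloring_def image_subset_iff by blast
  then show ?thesis unfolding chromatic_number_def by (intro Least_le) blast
qed

section \<open>Programs with bounded loops and quantified tests\<close>

datatype fm = Lt aexp aexp | Neg fm | Conj fm fm | Ex fm

definition var :: "nat \<Rightarrow> aexp" where
  "var d = Cell ''q'' (Const d) (Const 0)"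

text \<open>A formula is evaluated at quantifier depth \<open>d\<close>: the variables bound so far are the cells
  \<open>0, \<dots>, d - 1\<close> of the array \<open>q\<close>.\<close>

fun holds :: "fm \<Rightarrow> nat \<Rightarrow> state \<Rightarrow> bool" where
  "holds (Lt a b) d s \<longleftrightarrow> aval a s < aval b s"
| "holds (Neg f) d s \<longleftrightarrow> \<not> holds f d s"
| "holds (Conj f g) d s \<longleftrightarrow> holds f d s \<and> holds g d s"
| "holds (Ex f) d s \<longleftrightarrow> (\<exists>j < s ''n'' 0 0. holds f (d + 1) (store s ''q'' d 0 j))"

text \<open>\<open>test f d\<close> leaves the truth value of \<open>f\<close> in cell \<open>d\<close> of the array \<open>r\<close>.\<close>

fun test :: "fm \<Rightarrow> nat \<Rightarrow> com" where
  "test (Lt a b) d = Cond (Less a b)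
     (Assign ''r'' (Const d) (Const 0) (Const 1)) (Assign ''r'' (Const d) (Const 0) (Const 0))"
| "test (Neg f) d = Seq (test f d)
     (Assign ''r'' (Const d) (Const 0) (Minus (Const 1) (Cell ''r'' (Const d) (Const 0))))"
| "test (Conj f g) d = Seq (test f d)
     (Cond (Less (Const 0) (Cell ''r'' (Const d) (Const 0))) (test g d) Skip)"
| "test (Ex f) d = Seq (Assign ''r'' (Const d) (Const 0) (Const 0))
     (Seq (Assign ''q'' (Const d) (Const 0) (Const 0))
       (While (Less (var d) (Cell ''n'' (Const 0) (Const 0)))
         (Seq (test f (d + 1))
           (Seq (Cond (Less (Const 0) (Cell ''r'' (Const (d + 1)) (Const 0)))
                  (Assign ''r'' (Const d) (Const 0) (Const 1)) Skip)
             (Assign ''q'' (Const d) (Const 0) (Plus (var d) (Const 1)))))))"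

text \<open>Expressions may not read the results in \<open>r\<close>, and of \<open>q\<close> only
  variables bound at smaller depth. So the scratch cells left dirty by earlier tests cannot
  influence a value.\<close>

fun wf_aexp :: "nat \<Rightarrow> aexp \<Rightarrow> bool" where
  "wf_aexp d (Const k) \<longleftrightarrow> True"
| "wf_aexp d (Cell x a b) \<longleftrightarrow> x \<noteq> ''r'' \<and> (x = ''q'' \<longrightarrow> (\<exists>e<d. a = Const e) \<and> b = Const 0) \<and> wf_aexp d a \<and> wf_aexp d b"
| "wf_aexp d (Plus a b) \<longleftrightarrow> wf_aexp d a \<and> wf_aexp d b"
| "wf_aexp d (Minus a b) \<longleftrightarrow> wf_aexp d a \<and> wf_aexp d b"

fun wf_fm :: "nat \<Rightarrow> fm \<Rightarrow> bool" where
  "wf_fm d (Lt a b) \<longleftrightarrow> wf_aexp d a \<and> wf_aexp d b"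
| "wf_fm d (Neg f) \<longleftrightarrow> wf_fm d f"
| "wf_fm d (Conj f g) \<longleftrightarrow> wf_fm d f \<and> wf_fm d g"
| "wf_fm d (Ex f) \<longleftrightarrow> wf_fm (d + 1) f"

definition agree :: "nat \<Rightarrow> state \<Rightarrow> state \<Rightarrow> bool" where
  "agree d s s' \<longleftrightarrow>
     (\<forall>x. x \<noteq> ''r'' \<and> x \<noteq> ''q'' \<longrightarrow> s x = s' x) \<and> (\<forall>i<d. s ''q'' i 0 = s' ''q'' i 0)"

text \<open>In the case of \<open>Ex\<close>, 3 counts the two initial assignments and the last
  failing loop test; 4 counts, per round, the loop test, at most 2 steps for the conditional, and
  the increment. The loop has no early exit.\<close>

fun test_cost :: "fm \<Rightarrow> nat poly" where
  "test_cost (Lt a b) = [:2:]"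
| "test_cost (Neg f) = test_cost f + [:1:]"
| "test_cost (Conj f g) = test_cost f + test_cost g + [:2:]"
| "test_cost (Ex f) = [:3:] + [:0, 1:] * (test_cost f + [:4:])"

lemma agree_refl [simp]: "agree d s s"
  unfolding agree_def by simp

lemma agree_trans: "agree d s s' \<Longrightarrow> agree d s' s'' \<Longrightarrow> agree d s s''"
  unfolding agree_def by simp

lemma agree_mono: "agree e s s' \<Longrightarrow> d \<le> e \<Longrightarrow> agree d s s'"
  unfolding agree_def by simp

lemma agree_n: "agree d s s' \<Longrightarrow> s ''n'' i j = s' ''n'' i j"
  unfolding agree_def by simp

lemma agree_store_r: "agree d (store s ''r'' i j k) s"
  unfolding agree_def store_def by simp

lemma agree_store_q: "d \<le> i \<Longrightarrow> agree d (store s ''q'' i j k) s"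
  unfolding agree_def store_def by simp

lemma agree_store: "agree d s s' \<Longrightarrow> agree d (store s x i j k) (store s' x i j k)"
  unfolding agree_def store_def by auto

lemma agree_store_q_Suc:
  "agree d s s' \<Longrightarrow> agree (Suc d) (store s ''q'' d 0 k) (store s' ''q'' d 0 k)"
  unfolding agree_def store_def by (simp add: less_Suc_eq)

lemma agree_store_q_self: "agree d s s' \<Longrightarrow> agree (Suc d) s (store s' ''q'' d 0 (s ''q'' d 0))"
  unfolding agree_def store_def by (simp add: less_Suc_eq)

lemma aval_agree:
  assumes "wf_aexp d a" "agree d s s'"
  shows "aval a s = aval a s'"
  using assms(1)
proof (induction a)
  case (Cell x a b)
  show ?case
  proof (cases "x = ''q''")
    case True
    then obtain e where "e < d" "a = Const e" "b = Const 0" using Cell.prems by auto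
    then show ?thesis using assms(2) True unfolding agree_def by simp
  next
    case False
    then have "s x = s' x" using Cell.prems assms(2) unfolding agree_def by simp
    then show ?thesis using Cell by simp
  qed
qed simp_all

lemma holds_agree: "wf_fm d f \<Longrightarrow> agree d s s' \<Longrightarrow> holds f d s \<longleftrightarrow> holds f d s'"
proof (induction f arbitrary: d s s')
  case (Lt a b)
  then have "aval a s = aval a s'" "aval b s = aval b s'" by (auto intro: aval_agree)
  then show ?case by simp
next
  case (Ex f)
  have "holds f (Suc d) (store s ''q'' d 0 j) \<longleftrightarrow> holds f (Suc d) (store s' ''q'' d 0 j)" for j
    using Ex agree_store_q_Suc by simp
  then show ?case using agree_n[OF Ex.prems(2)] by simp
next
  case (Neg f)
  then show ?case by simp
next
  case (Conj f g)
  then have "holds f d s \<longleftrightarrow> holds f d s'" "holds g d s \<longleftrightarrow> holds g d s'" by simp_all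
  then show ?case by simp
qed

lemma exec_test:
  assumes "wf_fm d f"
  shows "\<exists>t s'. exec (test f d) s t s' \<and> t \<le> poly (test_cost f) (s ''n'' 0 0) \<and>
     agree d s' s \<and> (\<forall>e<d. s' ''r'' e = s ''r'' e) \<and> s' ''r'' d 0 = of_bool (holds f d s)"
  using assms
proof (induction f arbitrary: d s)
  case (Lt a b)
  have r: "agree d (store s ''r'' d 0 k) s" "\<forall>e<d. store s ''r'' d 0 k ''r'' e = s ''r'' e"
      "store s ''r'' d 0 k ''r'' d 0 = k" for k
    using agree_store_r by (simp_all add: store_def)
  show ?case
  proof (cases "aval a s < aval b s")
    case True
    then have "exec (test (Lt a b) d) s (1 + 1) (store s ''r'' d 0 1)"
      using CondTrue[of "Less a b" s] exec.Assign[of "''r''" "Const d" "Const 0" "Const 1" s] by simp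
    then show ?thesis using r[of 1] True by (intro exI[of _ "1 + 1"] exI[of _ "store s ''r'' d 0 1"]) simp
  next
    case False
    then have "exec (test (Lt a b) d) s (1 + 1) (store s ''r'' d 0 0)"
      using CondFalse[of "Less a b" s] exec.Assign[of "''r''" "Const d" "Const 0" "Const 0" s] by simp
    then show ?thesis using r[of 0] False by (intro exI[of _ "1 + 1"] exI[of _ "store s ''r'' d 0 0"]) simp
  qed
next
  case (Neg f)
  have "wf_fm d f" using Neg.prems by simp
  from Neg.IH[OF this, of s] obtain t s' where s': "exec (test f d) s t s'" "t \<le> poly (test_cost f) (s ''n'' 0 0)"
     "agree d s' s" "\<forall>e<d. s' ''r'' e = s ''r'' e" "s' ''r'' d 0 = of_bool (holds f d s)" by blast
  define s2 where "s2 = store s' ''r'' d 0 (1 - s' ''r'' d 0)"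
  have "exec (test (Neg f) d) s (t + 1) s2"
    using exec.Seq[OF s'(1) exec.Assign[of "''r''" "Const d" "Const 0"
      "Minus (Const 1) (Cell ''r'' (Const d) (Const 0))" s']] unfolding s2_def by simp
  moreover have "agree d s2 s"
    unfolding s2_def using agree_trans[OF agree_store_r s'(3)] .
  moreover have "\<forall>e<d. s2 ''r'' e = s ''r'' e" "s2 ''r'' d 0 = of_bool (holds (Neg f) d s)"
    using s'(4,5) unfolding s2_def store_def by simp_all
  ultimately show ?case using s'(2)
    by (intro exI[of _ "t + 1"] exI[of _ s2]) simp
next
  case (Conj f g)
  have wf: "wf_fm d f" "wf_fm d g" using Conj.prems by simp_all
  from Conj.IH(1)[OF wf(1), of s] obtain t s' where s': "exec (test f d) s t s'" "t \<le> poly (test_cost f) (s ''n'' 0 0)"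
     "agree d s' s" "\<forall>e<d. s' ''r'' e = s ''r'' e" "s' ''r'' d 0 = of_bool (holds f d s)" by blast
  show ?case
  proof (cases "holds f d s")
    case True
    from Conj.IH(2)[OF wf(2), of s'] obtain t' s'' where s'': "exec (test g d) s' t' s''" "t' \<le> poly (test_cost g) (s' ''n'' 0 0)"
     "agree d s'' s'" "\<forall>e<d. s'' ''r'' e = s' ''r'' e" "s'' ''r'' d 0 = of_bool (holds g d s')" by blast
    have "exec (test (Conj f g) d) s (t + (t' + 1)) s''"
      using exec.Seq[OF s'(1) CondTrue[OF _ s''(1)]] s'(5) True by simp
    moreover have "holds g d s' \<longleftrightarrow> holds g d s" using holds_agree[OF wf(2) s'(3)] .
    moreover have "t + (t' + 1) \<le> poly (test_cost (Conj f g)) (s ''n'' 0 0)"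
      using s'(2) s''(2) agree_n[OF s'(3)] by simp
    ultimately show ?thesis using agree_trans[OF s''(3) s'(3)] s''(4,5) s'(4) True
      by (intro exI[of _ "t + (t' + 1)"] exI[of _ s'']) simp
  next
    case False
    have "exec (test (Conj f g) d) s (t + (1 + 1)) s'"
      using exec.Seq[OF s'(1) CondFalse[OF _ exec.Skip]] s'(5) False by simp
    then show ?thesis using s'(2-5) False by (intro exI[of _ "t + (1 + 1)"] exI[of _ s']) simp
  qed
next
  case (Ex f)
  let ?n = "s ''n'' 0 0" and ?c = "poly (test_cost f) (s ''n'' 0 0) + 4"
  let ?b = "Less (var d) (Cell ''n'' (Const 0) (Const 0))"
  let ?c1 = "Cond (Less (Const 0) (Cell ''r'' (Const (d + 1)) (Const 0)))
                  (Assign ''r'' (Const d) (Const 0) (Const 1)) Skip"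
  let ?c2 = "Assign ''q'' (Const d) (Const 0) (Plus (var d) (Const 1))"
  let ?body = "Seq (test f (d + 1)) (Seq ?c1 ?c2)"
  let ?H = "\<lambda>j. holds f (Suc d) (store s ''q'' d 0 j)"
  let ?inv = "\<lambda>s1 j. agree d s1 s \<and> (\<forall>e<d. s1 ''r'' e = s ''r'' e) \<and>
      s1 ''q'' d 0 = j \<and> s1 ''r'' d 0 = of_bool (\<exists>i<j. ?H i)"
  have wf: "wf_fm (Suc d) f" using Ex.prems by simp
  have body: "\<exists>t s2. exec ?body s1 t s2 \<and> t + 1 \<le> ?c \<and> ?inv s2 (Suc j)" if s1: "?inv s1 j" for s1 j
  proof -
    from Ex.IH[OF wf, of s1] obtain t s' where s': "exec (test f (Suc d)) s1 t s'"
      "t \<le> poly (test_cost f) (s1 ''n'' 0 0)" "agree (Suc d) s' s1"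
      "\<forall>e<Suc d. s' ''r'' e = s1 ''r'' e" "s' ''r'' (Suc d) 0 = of_bool (holds f (Suc d) s1)" by blast
    have n: "s1 ''n'' 0 0 = ?n" using s1 agree_n by blast
    \<comment> \<open>The loop counter in cell \<open>d\<close> of \<open>q\<close> is itself the
      bound variable, so up to scratch cells \<open>s1\<close> is \<open>s\<close> with that
      variable set to \<open>j\<close>.\<close>
    have H: "holds f (Suc d) s1 \<longleftrightarrow> ?H j"
      using holds_agree[OF wf agree_store_q_self[of d s1 s]] s1 by blast
    define s3 where "s3 = (if ?H j then store s' ''r'' d 0 1 else s')"
    have c1: "\<exists>t\<le>2. exec ?c1 s' t s3"
    proof (cases "?H j")
      case True
      then have "exec ?c1 s' (1 + 1) s3"
        using CondTrue[of "Less (Const 0) (Cell ''r'' (Const (d + 1)) (Const 0))" s']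
          exec.Assign[of "''r''" "Const d" "Const 0" "Const 1" s'] s'(5) H
        unfolding s3_def by simp
      then show ?thesis by (intro exI[of _ "1 + 1"]) simp
    next
      case False
      then have "exec ?c1 s' (1 + 1) s3"
        using CondFalse[of "Less (Const 0) (Cell ''r'' (Const (d + 1)) (Const 0))" s']
          exec.Skip[of s'] s'(5) H
        unfolding s3_def by simp
      then show ?thesis by (intro exI[of _ "1 + 1"]) simp
    qed
    then obtain t1 where t1: "t1 \<le> 2" "exec ?c1 s' t1 s3" by blast
    define s4 where "s4 = store s3 ''q'' d 0 (s3 ''q'' d 0 + 1)"
    have c2: "exec ?c2 s3 1 s4"
      using exec.Assign[of "''q''" "Const d" "Const 0" "Plus (var d) (Const 1)" s3]
      unfolding s4_def var_def by simp
    have "exec ?body s1 (t + (t1 + 1)) s4"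
      using exec.Seq[OF s'(1) exec.Seq[OF t1(2) c2]] by simp
    moreover have "t + (t1 + 1) + 1 \<le> ?c" using s'(2) t1(1) n by simp
    moreover have "?inv s4 (Suc j)"
    proof (intro conjI allI impI)
      have "agree d s3 s1"
        using agree_mono[OF s'(3), of d] agree_trans[OF agree_store_r] unfolding s3_def by simp
      then show "agree d s4 s"
        using agree_trans[OF agree_store_q[of d d]] agree_trans[of d s3 s1 s] s1 unfolding s4_def by blast
      have q: "s3 ''q'' d 0 = j"
        using s'(3) s1 unfolding s3_def agree_def store_def by simp
      then show "s4 ''q'' d 0 = Suc j" unfolding s4_def store_def by simp
      show "s4 ''r'' e = s ''r'' e" if "e < d" for e
        using that s'(4) s1 unfolding s4_def s3_def store_def by simp
      have "s' ''r'' d 0 = of_bool (\<exists>i<j. ?H i)" using s'(4) s1 by simp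
      then show "s4 ''r'' d 0 = of_bool (\<exists>i<Suc j. ?H i)"
        unfolding s4_def s3_def store_def by (auto simp: less_Suc_eq)
    qed
    ultimately show ?thesis by blast
  qed
  have loop: "\<exists>t s2. exec (While ?b ?body) s1 t s2 \<and> t \<le> k * ?c + 1 \<and> ?inv s2 ?n"
    if "?inv s1 j" "j + k = ?n" for s1 j k
    using that
  proof (induction k arbitrary: s1 j)
    case 0
    have "aval (var d) s1 = ?n" using 0 unfolding var_def by simp
    moreover have "s1 ''n'' 0 0 = ?n" using 0(1) agree_n by blast
    ultimately have "exec (While ?b ?body) s1 1 s1" by (intro WhileFalse) simp
    then show ?case using 0 by (intro exI[of _ 1] exI[of _ s1]) simp
  next
    case (Suc k)
    obtain t s2 where s2: "exec ?body s1 t s2" "t + 1 \<le> ?c" "?inv s2 (Suc j)" using body[OF Suc.prems(1)] by blast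
    have "Suc j + k = ?n" using Suc.prems(2) by simp
    from Suc.IH[OF s2(3) this] obtain t' s3 where
      s3: "exec (While ?b ?body) s2 t' s3" "t' \<le> k * ?c + 1" "?inv s3 ?n" by blast
    have "aval (var d) s1 = j" using Suc.prems(1) unfolding var_def by simp
    moreover have "s1 ''n'' 0 0 = ?n" using Suc.prems(1) agree_n by blast
    ultimately have "bval ?b s1" using Suc.prems(2) by simp
    then have "exec (While ?b ?body) s1 (t + t' + 1) s3" using WhileTrue[OF _ s2(1) s3(1)] by blast
    moreover have "t + t' + 1 \<le> Suc k * ?c + 1" using s2(2) s3(2) by simp
    ultimately show ?case using s3(3) by blast
  qed
  let ?s1 = "store (store s ''r'' d 0 0) ''q'' d 0 0"
  have "?inv ?s1 0"
    using agree_trans[OF agree_store_q[of d d] agree_store_r] by (simp add: store_def)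
  then obtain t s2 where s2: "exec (While ?b ?body) ?s1 t s2" "t \<le> ?n * ?c + 1" "?inv s2 ?n"
    using loop[of ?s1 0 ?n] by auto
  have 1: "exec (Assign ''r'' (Const d) (Const 0) (Const 0)) s 1 (store s ''r'' d 0 0)"
    using exec.Assign[of "''r''" "Const d" "Const 0" "Const 0" s] by simp
  have 2: "exec (Assign ''q'' (Const d) (Const 0) (Const 0)) (store s ''r'' d 0 0) 1 ?s1"
    using exec.Assign[of "''q''" "Const d" "Const 0" "Const 0" "store s ''r'' d 0 0"] by simp
  have "exec (test (Ex f) d) s (1 + (1 + t)) s2"
    using exec.Seq[OF 1 exec.Seq[OF 2 s2(1)]] by simp
  moreover have "1 + (1 + t) \<le> poly (test_cost (Ex f)) ?n" using s2(2) by (simp add: algebra_simps)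
  ultimately show ?case using s2(3) by (intro exI[of _ "1 + (1 + t)"] exI[of _ s2]) simp
qed

section \<open>Structured programs, their semantics and compilation\<close>

datatype prog = Do name aexp aexp aexp | Then prog prog | When fm prog | For name prog

text \<open>Formulas are evaluated without touching scratch memory. The final store in the
  \<open>For\<close> case mirrors the compiled loop, which leaves its counter at
  \<open>n\<close>.\<close>

fun sem :: "prog \<Rightarrow> state \<Rightarrow> state" where
  "sem (Do x a b e) s = store s x (aval a s) (aval b s) (aval e s)"
| "sem (Then p1 p2) s = sem p2 (sem p1 s)"
| "sem (When f p) s = (if holds f 0 s then sem p s else s)"
| "sem (For x p) s = store (fold (\<lambda>j s. sem p (store s x 0 0 j)) [0..<s ''n'' 0 0] s) x 0 0 (s ''n'' 0 0)"

fun compile :: "prog \<Rightarrow> com" where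
  "compile (Do x a b e) = Assign x a b e"
| "compile (Then p1 p2) = Seq (compile p1) (compile p2)"
| "compile (When f p) = Seq (test f 0)
     (Cond (Less (Const 0) (Cell ''r'' (Const 0) (Const 0))) (compile p) Skip)"
| "compile (For x p) = Seq (Assign x (Const 0) (Const 0) (Const 0))
     (While (Less (Cell x (Const 0) (Const 0)) (Cell ''n'' (Const 0) (Const 0)))
       (Seq (compile p) (Assign x (Const 0) (Const 0) (Plus (Cell x (Const 0) (Const 0)) (Const 1)))))"

fun writes :: "prog \<Rightarrow> name set" where
  "writes (Do x a b e) = {x}"
| "writes (Then p1 p2) = writes p1 \<union> writes p2"
| "writes (When f p) = writes p"
| "writes (For x p) = insert x (writes p)"

fun wf_prog :: "prog \<Rightarrow> bool" where
  "wf_prog (Do x a b e) \<longleftrightarrow> x \<notin> {''r'', ''q'', ''n''} \<and> wf_aexp 0 a \<and> wf_aexp 0 b \<and> wf_aexp 0 e"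
| "wf_prog (Then p1 p2) \<longleftrightarrow> wf_prog p1 \<and> wf_prog p2"
| "wf_prog (When f p) \<longleftrightarrow> wf_fm 0 f \<and> wf_prog p"
| "wf_prog (For x p) \<longleftrightarrow> x \<notin> {''r'', ''q'', ''n''} \<and> x \<notin> writes p \<and> wf_prog p"

fun cost :: "prog \<Rightarrow> nat poly" where
  "cost (Do x a b e) = [:1:]"
| "cost (Then p1 p2) = cost p1 + cost p2"
| "cost (When f p) = test_cost f + cost p + [:2:]"
| "cost (For x p) = [:2:] + [:0, 1:] * (cost p + [:2:])"

lemma store_apply: "store s x i j k y i' j' = (if y = x \<and> i' = i \<and> j' = j then k else s y i' j')"
  unfolding store_def by simp

lemma store_other [simp]: "y \<noteq> x \<Longrightarrow> store s x i j k y = s y"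
  unfolding store_def by simp

lemma sem_frame: "y \<notin> writes p \<Longrightarrow> sem p s y = s y"
proof (induction p arbitrary: s)
  case (For x p)
  have "fold (\<lambda>j s. sem p (store s x 0 0 j)) js s y = s y" for js s
    using For by (induction js arbitrary: s) (simp_all add: store_def)
  then show ?case using For.prems by (simp add: store_def)
qed (simp_all add: store_def)

lemma wf_prog_writes: "wf_prog p \<Longrightarrow> ''n'' \<notin> writes p"
  by (induction p) auto

text \<open>The last premise makes the invariant insensitive to the loop variable, which is
  overwritten at the start of every round and once more at the end.\<close>

lemma For_rule:
  assumes "I 0 s0"
    and "\<And>j s. j < s0 ''n'' 0 0 \<Longrightarrow> (\<And>y. y \<notin> insert x (writes p) \<Longrightarrow> s y = s0 y) \<Longrightarrow>
      s x 0 0 = j \<Longrightarrow> I j s \<Longrightarrow> I (Suc j) (sem p s)"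
    and "\<And>j s k. I j s \<Longrightarrow> I j (store s x 0 0 k)"
  shows "I (s0 ''n'' 0 0) (sem (For x p) s0)"
proof -
  let ?F = "\<lambda>j. fold (\<lambda>j s. sem p (store s x 0 0 j)) [0..<j] s0"
  have "(\<forall>y. y \<notin> insert x (writes p) \<longrightarrow> ?F j y = s0 y) \<and> I j (?F j)" if "j \<le> s0 ''n'' 0 0" for j
    using that
  proof (induction j)
    case (Suc j)
    let ?s = "store (?F j) x 0 0 j"
    have IH: "\<And>y. y \<notin> insert x (writes p) \<Longrightarrow> ?F j y = s0 y" "I j (?F j)" using Suc by auto
    have *: "\<And>y. y \<notin> insert x (writes p) \<Longrightarrow> ?s y = s0 y" "I j ?s" "?s x 0 0 = j"
      using IH(1) assms(3)[OF IH(2)] by (simp_all add: store_apply)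
    then have "I (Suc j) (sem p ?s)" using assms(2)[of j ?s] Suc.prems by simp
    moreover have "sem p ?s y = s0 y" if "y \<notin> insert x (writes p)" for y
      using sem_frame[of y p ?s] *(1) that by simp
    ultimately show ?case by simp
  qed (use assms(1) in simp)
  then show ?thesis using assms(3)[of "s0 ''n'' 0 0"] by simp
qed

text \<open>Execution follows \<open>sem\<close> up to the arrays \<open>r\<close> and
  \<open>q\<close>. Well-formed programs never write \<open>n\<close>, so one value bounds every
  loop and the costs compose as polynomials.\<close>

lemma exec_compile:
  assumes "wf_prog p" "agree 0 s s0"
  shows "\<exists>t s'. exec (compile p) s t s' \<and> t \<le> poly (cost p) (s0 ''n'' 0 0) \<and> agree 0 s' (sem p s0)"
  using assms
proof (induction p arbitrary: s s0)
  case (Do x a b e)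
  then have "aval a s = aval a s0" "aval b s = aval b s0" "aval e s = aval e s0"
    by (auto intro: aval_agree)
  then have "agree 0 (store s x (aval a s) (aval b s) (aval e s)) (sem (Do x a b e) s0)"
    using agree_store[OF Do.prems(2)] by simp
  then show ?case using exec.Assign[of x a b e s]
    by (intro exI[of _ 1] exI[of _ "store s x (aval a s) (aval b s) (aval e s)"]) simp
next
  case (Then p1 p2)
  have wf: "wf_prog p1" "wf_prog p2" using Then.prems by simp_all
  obtain t1 s1 where s1: "exec (compile p1) s t1 s1" "t1 \<le> poly (cost p1) (s0 ''n'' 0 0)"
    "agree 0 s1 (sem p1 s0)" using Then.IH(1)[OF wf(1) Then.prems(2)] by blast
  obtain t2 s2 where s2: "exec (compile p2) s1 t2 s2" "t2 \<le> poly (cost p2) (sem p1 s0 ''n'' 0 0)"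
    "agree 0 s2 (sem p2 (sem p1 s0))" using Then.IH(2)[OF wf(2) s1(3)] by blast
  have "sem p1 s0 ''n'' = s0 ''n''" using sem_frame[OF wf_prog_writes[OF wf(1)]] .
  then show ?case using exec.Seq[OF s1(1) s2(1)] s1(2) s2(2,3)
    by (intro exI[of _ "t1 + t2"] exI[of _ s2]) simp
next
  case (When f p)
  have wf: "wf_fm 0 f" "wf_prog p" using When.prems by simp_all
  obtain t1 s1 where s1: "exec (test f 0) s t1 s1" "t1 \<le> poly (test_cost f) (s ''n'' 0 0)"
    "agree 0 s1 s" "s1 ''r'' 0 0 = of_bool (holds f 0 s)" using exec_test[OF wf(1), of s] by blast
  have a: "agree 0 s1 s0" using agree_trans[OF s1(3) When.prems(2)] .
  have n: "s ''n'' 0 0 = s0 ''n'' 0 0" using agree_n[OF When.prems(2)] .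
  have h: "holds f 0 s \<longleftrightarrow> holds f 0 s0" using holds_agree[OF wf(1) When.prems(2)] .
  show ?case
  proof (cases "holds f 0 s0")
    case True
    obtain t2 s2 where s2: "exec (compile p) s1 t2 s2" "t2 \<le> poly (cost p) (s0 ''n'' 0 0)"
      "agree 0 s2 (sem p s0)" using When.IH[OF wf(2) a] by blast
    have "exec (compile (When f p)) s (t1 + (t2 + 1)) s2"
      using exec.Seq[OF s1(1) CondTrue[OF _ s2(1)]] s1(4) h True by simp
    then show ?thesis using s1(2) s2(2,3) n True
      by (intro exI[of _ "t1 + (t2 + 1)"] exI[of _ s2]) simp
  next
    case False
    have "exec (compile (When f p)) s (t1 + (1 + 1)) s1"
      using exec.Seq[OF s1(1) CondFalse[OF _ exec.Skip]] s1(4) h False by simp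
    then show ?thesis using s1(2) a n False
      by (intro exI[of _ "t1 + (1 + 1)"] exI[of _ s1]) simp
  qed
next
  case (For x p)
  let ?n = "s0 ''n'' 0 0" and ?c = "poly (cost p) (s0 ''n'' 0 0) + 2"
  let ?F = "\<lambda>j. fold (\<lambda>j s. sem p (store s x 0 0 j)) [0..<j] s0"
  let ?b = "Less (Cell x (Const 0) (Const 0)) (Cell ''n'' (Const 0) (Const 0))"
  let ?inc = "Assign x (Const 0) (Const 0) (Plus (Cell x (Const 0) (Const 0)) (Const 1))"
  let ?body = "Seq (compile p) ?inc"
  have wf: "wf_prog p" "x \<notin> writes p" "x \<notin> {''r'', ''q'', ''n''}" using For.prems by simp_all
  have Fn: "?F j ''n'' = s0 ''n''" for j
    by (induction j) (use sem_frame[OF wf_prog_writes[OF wf(1)]] wf(3) in auto)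
  have loop: "\<exists>t s2. exec (While ?b ?body) s1 t s2 \<and> t \<le> k * ?c + 1 \<and> agree 0 s2 (store (?F ?n) x 0 0 ?n)"
    if "agree 0 s1 (store (?F j) x 0 0 j)" "j + k = ?n" for s1 j k
    using that
  proof (induction k arbitrary: s1 j)
    case 0
    have "s1 x 0 0 = j" "s1 ''n'' 0 0 = ?n"
      using 0(1) wf(3) Fn[of j] unfolding agree_def by (auto simp: store_apply)
    then have "exec (While ?b ?body) s1 1 s1" using 0 by (intro WhileFalse) simp
    then show ?case using 0 by (intro exI[of _ 1] exI[of _ s1]) simp
  next
    case (Suc k)
    let ?s = "store (?F j) x 0 0 j"
    have *: "s1 x 0 0 = j" "s1 ''n'' 0 0 = ?n" "?s ''n'' 0 0 = ?n"
      using Suc.prems(1) wf(3) Fn[of j] unfolding agree_def by (auto simp: store_apply)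
    obtain t s2 where s2: "exec (compile p) s1 t s2" "t \<le> poly (cost p) ?n" "agree 0 s2 (sem p ?s)"
      using For.IH[OF wf(1) Suc.prems(1)] unfolding *(3) by blast
    have "sem p ?s x = ?s x" using sem_frame[OF wf(2)] .
    then have "s2 x 0 0 = j" using s2(3) wf(3) unfolding agree_def by (simp add: store_apply)
    then have inc: "exec ?inc s2 1 (store s2 x 0 0 (Suc j))"
      using exec.Assign[of x "Const 0" "Const 0" "Plus (Cell x (Const 0) (Const 0)) (Const 1)" s2] by simp
    have "agree 0 (store s2 x 0 0 (Suc j)) (store (?F (Suc j)) x 0 0 (Suc j))"
      using agree_store[OF s2(3)] by simp
    moreover have "Suc j + k = ?n" using Suc.prems(2) by simp
    ultimately obtain t' s3 where s3: "exec (While ?b ?body) (store s2 x 0 0 (Suc j)) t' s3"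
      "t' \<le> k * ?c + 1" "agree 0 s3 (store (?F ?n) x 0 0 ?n)" using Suc.IH by blast
    have "bval ?b s1" using * Suc.prems(2) by simp
    then have "exec (While ?b ?body) s1 ((t + 1) + t' + 1) s3"
      using WhileTrue[OF _ exec.Seq[OF s2(1) inc] s3(1)] by blast
    moreover have "(t + 1) + t' + 1 \<le> Suc k * ?c + 1" using s2(2) s3(2) by simp
    ultimately show ?case using s3(3) by blast
  qed
  have init: "exec (Assign x (Const 0) (Const 0) (Const 0)) s 1 (store s x 0 0 0)"
    using exec.Assign[of x "Const 0" "Const 0" "Const 0" s] by simp
  have "agree 0 (store s x 0 0 0) (store (?F 0) x 0 0 0)" using agree_store[OF For.prems(2)] by simp
  then obtain t s2 where s2: "exec (While ?b ?body) (store s x 0 0 0) t s2" "t \<le> ?n * ?c + 1"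
    "agree 0 s2 (store (?F ?n) x 0 0 ?n)" using loop[of "store s x 0 0 0" 0 ?n] by auto
  have "exec (compile (For x p)) s (1 + t) s2" using exec.Seq[OF init s2(1)] by simp
  moreover have "1 + t \<le> poly (cost (For x p)) ?n" using s2(2) by (simp add: algebra_simps)
  ultimately show ?case using s2(3) by (intro exI[of _ "1 + t"] exI[of _ s2]) simp
qed

lemma poly_nat_mono: "m \<le> n \<Longrightarrow> poly p m \<le> poly p n" for p :: "nat poly"
  by (induction p) (auto intro: mult_le_mono add_le_mono)

section \<open>The colouring program\<close>

text \<open>Arrays: \<open>a\<close> flags the eliminated vertices, \<open>o\<close> is the elimination order, \<open>m\<close> marks the Kempe
  component, \<open>k\<close> is the number of colours in use and \<open>d\<close> tells whether the current vertex \<open>c\<close> is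
  coloured. Colours start at 1, and \<open>out\<close> is 0 at uncoloured vertices; the loop variables \<open>x\<close> and \<open>y\<close>
  stand for the colours \<open>x + 1\<close> and \<open>y + 1\<close>.\<close>

abbreviation scalar :: "name \<Rightarrow> aexp" where
  "scalar x \<equiv> Cell x (Const 0) (Const 0)"

abbreviation entry :: "name \<Rightarrow> aexp \<Rightarrow> aexp" where
  "entry x a \<equiv> Cell x a (Const 0)"

definition Eq :: "aexp \<Rightarrow> aexp \<Rightarrow> fm" where
  "Eq a b = Conj (Neg (Lt a b)) (Neg (Lt b a))"

definition Disj :: "fm \<Rightarrow> fm \<Rightarrow> fm" where
  "Disj f g = Neg (Conj (Neg f) (Neg g))"

definition Imp :: "fm \<Rightarrow> fm \<Rightarrow> fm" where
  "Imp f g = Neg (Conj f (Neg g))"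

definition All :: "fm \<Rightarrow> fm" where
  "All f = Neg (Ex (Neg f))"

lemma holds_Eq [simp]: "holds (Eq a b) d s \<longleftrightarrow> aval a s = aval b s"
  unfolding Eq_def by auto

lemma holds_Disj [simp]: "holds (Disj f g) d s \<longleftrightarrow> holds f d s \<or> holds g d s"
  unfolding Disj_def by simp

lemma holds_Imp [simp]: "holds (Imp f g) d s \<longleftrightarrow> (holds f d s \<longrightarrow> holds g d s)"
  unfolding Imp_def by simp

lemma holds_All [simp]:
  "holds (All f) d s \<longleftrightarrow> (\<forall>j < s ''n'' 0 0. holds f (d + 1) (store s ''q'' d 0 j))"
  unfolding All_def by simp

definition Adj :: "aexp \<Rightarrow> aexp \<Rightarrow> fm" where
  "Adj a b = Lt (Const 0) (Cell ''adj'' a b)"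

definition Alive :: "aexp \<Rightarrow> fm" where
  "Alive a = Lt (entry ''a'' a) (Const 1)"

definition nonuniversal_fm :: "nat \<Rightarrow> aexp \<Rightarrow> fm" where
  "nonuniversal_fm d a = Conj (Alive a) (Conj (Adj (scalar ''v'') a)
     (Ex (Conj (Alive (var d)) (Conj (Adj (scalar ''v'') (var d))
       (Conj (Neg (Eq (var d) a)) (Neg (Adj a (var d))))))))"

definition linked_fm :: "nat \<Rightarrow> aexp \<Rightarrow> fm" where
  "linked_fm d a = Conj (nonuniversal_fm d a)
     (Ex (Conj (nonuniversal_fm (d + 1) (var d)) (Adj a (var d))))"

definition dominated_fm :: fm where
  "dominated_fm = Ex (Conj (Alive (var 0)) (Conj (Neg (Eq (var 0) (scalar ''v'')))
     (Conj (Neg (Adj (scalar ''v'') (var 0)))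
       (All (Imp (Conj (Alive (var 1)) (Adj (scalar ''v'') (var 1))) (Adj (var 0) (var 1)))))))"

definition transitive_fm :: fm where
  "transitive_fm = All (All (All (Imp
     (Conj (nonuniversal_fm 3 (var 0)) (Conj (nonuniversal_fm 3 (var 1)) (Conj (nonuniversal_fm 3 (var 2))
       (Conj (Adj (var 0) (var 1)) (Conj (Adj (var 1) (var 2)) (Neg (Eq (var 0) (var 2))))))))
     (Adj (var 0) (var 2)))))"

definition three_cliques_fm :: fm where
  "three_cliques_fm = Ex (Ex (Ex
     (Conj (linked_fm 3 (var 0)) (Conj (linked_fm 3 (var 1)) (Conj (linked_fm 3 (var 2))
       (Conj (Neg (Eq (var 0) (var 1))) (Conj (Neg (Eq (var 1) (var 2))) (Conj (Neg (Eq (var 0) (var 2)))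
         (Conj (Neg (Adj (var 0) (var 1))) (Conj (Neg (Adj (var 1) (var 2))) (Neg (Adj (var 0) (var 2)))))))))))))"

definition removable_fm :: fm where
  "removable_fm = Disj dominated_fm (Conj transitive_fm (Neg three_cliques_fm))"

lemmas fm_defs = Eq_def Disj_def Imp_def All_def Adj_def Alive_def nonuniversal_fm_def linked_fm_def
  dominated_fm_def transitive_fm_def three_cliques_fm_def removable_fm_def var_def

text \<open>The search keeps the last removable vertex it meets. A stale \<open>w\<close> cannot be
  used, because a removable vertex exists as long as some vertex is left.\<close>

definition select :: prog where
  "select = For ''i'' (Then
     (For ''v'' (When (Conj (Alive (scalar ''v'')) removable_fm)
       (Do ''w'' (Const 0) (Const 0) (scalar ''v''))))
     (Then (Do ''o'' (scalar ''i'') (Const 0) (scalar ''w''))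
       (Do ''a'' (scalar ''w'') (Const 0) (Const 1))))"

text \<open>\<open>kmax\<close> stands for \<open>\<omega> + 1\<close>. It belongs to the analysis;
  the program does not read it.\<close>

locale program_input = pckp_free E for E :: "nat \<Rightarrow> nat \<Rightarrow> bool" +
  fixes n kmax :: nat
  assumes less: "E x y \<Longrightarrow> x < n"
    and clique_bound: "K \<subseteq> {..<n} \<Longrightarrow> (\<forall>x\<in>K. \<forall>y\<in>K. x \<noteq> y \<longrightarrow> E x y) \<Longrightarrow> card K < kmax"
begin

definition input :: "state \<Rightarrow> bool" where
  "input s \<longleftrightarrow> s ''n'' 0 0 = n \<and> (\<forall>i j. 0 < s ''adj'' i j \<longleftrightarrow> E i j)"

definition alive :: "state \<Rightarrow> nat set" where
  "alive s = {u. u < n \<and> s ''a'' u 0 = 0}"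

lemma input_store [simp]: "x \<noteq> ''n'' \<Longrightarrow> x \<noteq> ''adj'' \<Longrightarrow> input (store s x i j k) \<longleftrightarrow> input s"
  unfolding input_def by simp

lemma alive_store [simp]: "x \<noteq> ''a'' \<Longrightarrow> alive (store s x i j k) = alive s"
  unfolding alive_def by simp

lemma aval_store_q: "wf_aexp d a \<Longrightarrow> aval a (store s ''q'' d 0 j) = aval a s"
  by (erule aval_agree) (simp add: agree_store_q)

lemma aval_var [simp]: "aval (var d) s = s ''q'' d 0"
  unfolding var_def by simp

lemma holds_Adj [simp]: "input s \<Longrightarrow> holds (Adj a b) d s \<longleftrightarrow> E (aval a s) (aval b s)"
  unfolding Adj_def input_def by simp

lemma holds_Alive: "holds (Alive a) d s \<longleftrightarrow> s ''a'' (aval a s) 0 = 0"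
  unfolding Alive_def by auto

lemma input_n: "input s \<Longrightarrow> s ''n'' 0 0 = n"
  unfolding input_def by simp

lemma holds_nonuniversal:
  assumes "input s" "wf_aexp d a" "aval a s < n"
  shows "holds (nonuniversal_fm d a) d s \<longleftrightarrow> nonuniversal (alive s) (s ''v'' 0 0) (aval a s)"
  using assms input_n[OF assms(1)]
  unfolding nonuniversal_fm_def nonuniversal_def alive_def
  by (auto simp: holds_Alive aval_store_q store_apply)

lemma holds_linked:
  assumes "input s" "wf_aexp d a" "aval a s < n"
  shows "holds (linked_fm d a) d s \<longleftrightarrow> linked (alive s) (s ''v'' 0 0) (aval a s)"
proof -
  let ?v = "s ''v'' 0 0"
  have wf: "wf_aexp (d + 1) (var d)" unfolding var_def by simp
  have nu: "holds (nonuniversal_fm (d + 1) (var d)) (d + 1) (store s ''q'' d 0 j) \<longleftrightarrow>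
      nonuniversal (alive s) ?v j" if "j < n" for j
  proof -
    have "aval (var d) (store s ''q'' d 0 j) = j" by (simp add: store_apply)
    then show ?thesis
      using holds_nonuniversal[of "store s ''q'' d 0 j", OF _ wf] assms(1) that by simp
  qed
  have inX: "j < n \<and> j \<in> alive s" if "nonuniversal (alive s) ?v j" for j
    using that unfolding nonuniversal_def alive_def by blast
  have "holds (linked_fm d a) d s \<longleftrightarrow> nonuniversal (alive s) ?v (aval a s) \<and>
      (\<exists>j<n. nonuniversal (alive s) ?v j \<and> E (aval a s) j)"
    using assms nu holds_nonuniversal[OF assms] input_n[OF assms(1)]
    unfolding linked_fm_def by (simp add: aval_store_q store_apply cong: conj_cong)
  then show ?thesis using inX unfolding linked_def by blast
qed

lemma holds_removable:
  assumes "input s" "s ''v'' 0 0 < n"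
  shows "holds removable_fm 0 s \<longleftrightarrow> removable (alive s) (s ''v'' 0 0)"
proof -
  let ?v = "s ''v'' 0 0" and ?s = "\<lambda>x y z. store (store (store s ''q'' 0 0 x) ''q'' (Suc 0) 0 y) ''q'' 2 0 z"
  have n: "s ''n'' 0 0 = n" using input_n[OF assms(1)] .
  have "holds dominated_fm 0 s \<longleftrightarrow> dominated (alive s) ?v"
    using assms n unfolding dominated_fm_def dominated_def alive_def
    by (auto simp: holds_Alive store_apply less commute)
  moreover
  have wf: "wf_aexp 3 (var 0)" "wf_aexp 3 (var (Suc 0))" "wf_aexp 3 (var 2)"
    unfolding var_def by auto
  have nu: "holds (nonuniversal_fm 3 (var 0)) 3 (?s x y z) \<longleftrightarrow> nonuniversal (alive s) ?v x"
    "holds (nonuniversal_fm 3 (var (Suc 0))) 3 (?s x y z) \<longleftrightarrow> nonuniversal (alive s) ?v y"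
    "holds (nonuniversal_fm 3 (var 2)) 3 (?s x y z) \<longleftrightarrow> nonuniversal (alive s) ?v z"
    if "x < n" "y < n" "z < n" for x y z
    using that assms(1) holds_nonuniversal[OF _ wf(1), of "?s x y z"]
      holds_nonuniversal[OF _ wf(2), of "?s x y z"] holds_nonuniversal[OF _ wf(3), of "?s x y z"]
    by (simp_all add: store_apply)
  have li: "holds (linked_fm 3 (var 0)) 3 (?s x y z) \<longleftrightarrow> linked (alive s) ?v x"
    "holds (linked_fm 3 (var (Suc 0))) 3 (?s x y z) \<longleftrightarrow> linked (alive s) ?v y"
    "holds (linked_fm 3 (var 2)) 3 (?s x y z) \<longleftrightarrow> linked (alive s) ?v z"
    if "x < n" "y < n" "z < n" for x y z
    using that assms(1) holds_linked[OF _ wf(1), of "?s x y z"]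
      holds_linked[OF _ wf(2), of "?s x y z"] holds_linked[OF _ wf(3), of "?s x y z"]
    by (simp_all add: store_apply)
  have inX: "x < n" "x \<in> alive s" if "nonuniversal (alive s) ?v x" for x
    using that unfolding nonuniversal_def alive_def by auto
  have inX': "x < n" "x \<in> alive s" if "linked (alive s) ?v x" for x
    using that inX unfolding linked_def by blast+
  have "holds transitive_fm 0 s \<longleftrightarrow> (\<forall>x<n. \<forall>y<n. \<forall>z<n. nonuniversal (alive s) ?v x \<and>
      nonuniversal (alive s) ?v y \<and> nonuniversal (alive s) ?v z \<and> E x y \<and> E y z \<and> x \<noteq> z \<longrightarrow> E x z)"
    using assms(1) n nu unfolding transitive_fm_def
    by (simp add: store_apply numeral_2_eq_2 numeral_3_eq_3)
  moreover have "holds three_cliques_fm 0 s \<longleftrightarrow> (\<exists>x<n. \<exists>y<n. \<exists>z<n. linked (alive s) ?v x \<and>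
      linked (alive s) ?v y \<and> linked (alive s) ?v z \<and>
        x \<noteq> y \<and> y \<noteq> z \<and> x \<noteq> z \<and> \<not> E x y \<and> \<not> E y z \<and> \<not> E x z)"
    using assms(1) n li unfolding three_cliques_fm_def
    by (simp add: store_apply numeral_2_eq_2 numeral_3_eq_3 cong: conj_cong)
  moreover have "two_clique_vertex (alive s) ?v \<longleftrightarrow> (\<forall>x<n. \<forall>y<n. \<forall>z<n. nonuniversal (alive s) ?v x \<and>
      nonuniversal (alive s) ?v y \<and> nonuniversal (alive s) ?v z \<and> E x y \<and> E y z \<and> x \<noteq> z \<longrightarrow> E x z) \<and>
      \<not> (\<exists>x<n. \<exists>y<n. \<exists>z<n. linked (alive s) ?v x \<and> linked (alive s) ?v y \<and> linked (alive s) ?v z \<and>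
        x \<noteq> y \<and> y \<noteq> z \<and> x \<noteq> z \<and> \<not> E x y \<and> \<not> E y z \<and> \<not> E x z)"
    \<comment> \<open>Tests quantify over all indices below \<open>n\<close>, the definition over
      remaining vertices; \<open>nonuniversal\<close> and \<open>linked\<close> already imply
      membership, so both agree.\<close>
    unfolding two_clique_vertex_def by (rule arg_cong2[where f = "(\<and>)"]) (use inX inX' in meson)+
  ultimately show ?thesis unfolding removable_fm_def removable_def by simp
qed

definition rest :: "(nat \<Rightarrow> nat) \<Rightarrow> nat \<Rightarrow> nat set" where
  "rest f i = {..<n} - f ` {..<i}"

definition elimination :: "(nat \<Rightarrow> nat) \<Rightarrow> nat \<Rightarrow> bool" where
  "elimination f i \<longleftrightarrow> (\<forall>j<i. f j \<in> rest f j \<and> removable (rest f j) (f j))"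

definition order :: "state \<Rightarrow> nat \<Rightarrow> nat" where
  "order s j = s ''o'' j 0"

lemma rest_Suc: "rest f (Suc i) = rest f i - {f i}"
  unfolding rest_def by (auto simp: less_Suc_eq)

lemma rest_cong: "(\<And>j. j < i \<Longrightarrow> f j = g j) \<Longrightarrow> rest f i = rest g i"
  unfolding rest_def by auto

lemma rest_nonempty: "i < n \<Longrightarrow> rest f i \<noteq> {}"
proof
  assume "i < n" "rest f i = {}"
  then have "card {..<n} \<le> card (f ` {..<i})"
    unfolding rest_def by (intro card_mono) auto
  then show False using card_image_le[of "{..<i}" f] \<open>i < n\<close> by simp
qed

lemma elimination_inj: "elimination f i \<Longrightarrow> inj_on f {..<i}"
  unfolding elimination_def rest_def inj_on_def
  by (metis (no_types, lifting) DiffD2 image_eqI lessThan_iff linorder_neqE_nat)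

lemma elimination_rest_n: "elimination f n \<Longrightarrow> rest f n = {}"
proof -
  assume f: "elimination f n"
  then have "f ` {..<n} \<subseteq> {..<n}" unfolding elimination_def rest_def by auto
  then have "f ` {..<n} = {..<n}" using elimination_inj[OF f] by (simp add: endo_inj_surj)
  then show ?thesis unfolding rest_def by simp
qed

lemma elimination_Suc:
  assumes "elimination f i" "w \<in> rest f i" "removable (rest f i) w" "\<And>j. j < i \<Longrightarrow> g j = f j" "g i = w"
  shows "elimination g (Suc i)"
proof -
  have r: "rest g j = rest f j" if "j \<le> i" for j using rest_cong[of j g f] assms(4) that by simp
  show ?thesis
    unfolding elimination_def
  proof (intro allI impI)
    fix j assume "j < Suc i"
    then consider "j < i" | "j = i" by linarith
    then show "g j \<in> rest g j \<and> removable (rest g j) (g j)"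
    proof cases
      case 1
      then have "f j \<in> rest f j \<and> removable (rest f j) (f j)"
        using assms(1) unfolding elimination_def by blast
      then show ?thesis using 1 assms(4)[of j] r[of j] by simp
    next
      case 2
      then have "g j = w" "rest g j = rest f i" using assms(5) r by simp_all
      then show ?thesis using assms(2,3) by simp
    qed
  qed
qed

lemma sem_select:
  assumes "input s" "alive s = {..<n}"
  shows "elimination (order (sem select s)) n"
proof -
  let ?search = "For ''v'' (When (Conj (Alive (scalar ''v'')) removable_fm)
       (Do ''w'' (Const 0) (Const 0) (scalar ''v'')))"
  let ?I = "\<lambda>i s. elimination (order s) i \<and> alive s = rest (order s) i"
  have "?I (s ''n'' 0 0) (sem select s)"
    unfolding select_def
  proof (rule For_rule[where I = ?I])
    show "?I 0 s" using assms(2) unfolding elimination_def rest_def by simp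
  next
    fix j s' k
    assume "?I j s'"
    then show "?I j (store s' ''i'' 0 0 k)" by (simp add: order_def[abs_def])
  next
    fix i s1
    assume i: "i < s ''n'' 0 0" "s1 ''i'' 0 0 = i" and I: "?I i s1"
      and frame: "\<And>y. y \<notin> insert ''i'' (writes (Then ?search
        (Then (Do ''o'' (scalar ''i'') (Const 0) (scalar ''w''))
          (Do ''a'' (scalar ''w'') (Const 0) (Const 1))))) \<Longrightarrow> s1 y = s y"
    let ?X = "alive s1"
    have s1: "input s1" using assms(1) frame[of "''n''"] frame[of "''adj''"] unfolding input_def by simp
    define s2 where "s2 = sem ?search s1"
    have s2: "s2 y = s1 y" if "y \<noteq> ''v''" "y \<noteq> ''w''" for y
      unfolding s2_def by (rule sem_frame) (use that in simp)
    \<comment> \<open>Once a removable vertex has appeared among the first \<open>j\<close>, the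
      cell \<open>w\<close> holds a valid choice; before that it may hold anything.\<close>
    let ?J = "\<lambda>j (s' :: state). (\<exists>u<j. u \<in> ?X \<and> removable ?X u) \<longrightarrow> s' ''w'' 0 0 \<in> ?X \<and> removable ?X (s' ''w'' 0 0)"
    have "?J (s1 ''n'' 0 0) s2"
      unfolding s2_def
    proof (rule For_rule[where I = ?J])
      show "?J 0 s1" by simp
    next
      fix j s' k
      assume "?J j s'"
      then show "?J j (store s' ''v'' 0 0 k)" by simp
    next
      fix j s'
      assume j: "j < s1 ''n'' 0 0" "s' ''v'' 0 0 = j" and J: "?J j s'"
        and frame: "\<And>y. y \<notin> insert ''v'' (writes (When (Conj (Alive (scalar ''v'')) removable_fm)
          (Do ''w'' (Const 0) (Const 0) (scalar ''v'')))) \<Longrightarrow> s' y = s1 y"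
      have s': "input s'" "alive s' = ?X"
        using s1 frame[of "''n''"] frame[of "''adj''"] frame[of "''a''"]
        unfolding input_def alive_def by simp_all
      have "j < n" using j(1) input_n[OF s1] by simp
      then have h: "holds (Conj (Alive (scalar ''v'')) removable_fm) 0 s' \<longleftrightarrow> j \<in> ?X \<and> removable ?X j"
        using holds_removable[OF s'(1)] s'(2) j(2) frame[of "''a''"]
        by (simp add: holds_Alive alive_def)
      show "?J (Suc j) (sem (When (Conj (Alive (scalar ''v'')) removable_fm)
          (Do ''w'' (Const 0) (Const 0) (scalar ''v''))) s')"
      proof (cases "j \<in> ?X \<and> removable ?X j")
        case True
        then have "sem (When (Conj (Alive (scalar ''v'')) removable_fm)
          (Do ''w'' (Const 0) (Const 0) (scalar ''v''))) s' = store s' ''w'' 0 0 j"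
          using h j(2) by simp
        then show ?thesis using True by (simp add: store_apply)
      next
        case False
        then show ?thesis using h J by (auto simp: less_Suc_eq)
      qed
    qed
    moreover have "\<exists>u<n. u \<in> ?X \<and> removable ?X u"
    proof -
      have "?X \<noteq> {}" using I rest_nonempty i(1) input_n[OF assms(1)] by simp
      moreover have "finite ?X" unfolding alive_def by simp
      ultimately obtain u where "u \<in> ?X" "removable ?X u" using exists_removable by blast
      then show ?thesis unfolding alive_def by blast
    qed
    ultimately have w: "s2 ''w'' 0 0 \<in> ?X" "removable ?X (s2 ''w'' 0 0)"
      using input_n[OF s1] by auto
    define w where "w = s2 ''w'' 0 0"
    define s3 where "s3 = store (store s2 ''o'' i 0 w) ''a'' w 0 1"
    have sem: "sem (Then ?search (Then (Do ''o'' (scalar ''i'') (Const 0) (scalar ''w''))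
          (Do ''a'' (scalar ''w'') (Const 0) (Const 1)))) s1 = s3"
      using s2[of "''i''"] i(2) unfolding s3_def w_def s2_def[symmetric] sem.simps(2)
      by (simp add: store_apply)
    have o: "order s3 j = order s1 j" if "j < i" for j
      using that s2[of "''o''"] unfolding s3_def order_def by (simp add: store_apply)
    have oi: "order s3 i = w" unfolding s3_def order_def by (simp add: store_apply)
    have "elimination (order s3) (Suc i)"
      by (rule elimination_Suc[of "order s1" i w]) (use I w o oi in \<open>simp_all add: w_def\<close>)
    moreover have "alive s3 = alive s1 - {w}"
      using s2[of "''a''"] unfolding s3_def alive_def by (auto simp: store_apply)
    moreover have "rest (order s3) i = rest (order s1) i" by (rule rest_cong) (rule o)
    ultimately show "?I (Suc i) (sem (Then ?search (Then (Do ''o'' (scalar ''i'') (Const 0) (scalar ''w''))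
          (Do ''a'' (scalar ''w'') (Const 0) (Const 1)))) s1)"
      unfolding sem using I oi by (simp add: rest_Suc)
  qed
  then show ?thesis using input_n[OF assms(1)] by simp
qed

end

section \<open>One Kempe change as a program\<close>

definition colour_a :: aexp where
  "colour_a = Plus (scalar ''x'') (Const 1)"

definition colour_b :: aexp where
  "colour_b = Plus (scalar ''y'') (Const 1)"

definition mark_init :: prog where
  "mark_init = For ''u'' (Then (Do ''m'' (scalar ''u'') (Const 0) (Const 0))
     (When (Conj (Adj (scalar ''c'') (scalar ''u'')) (Eq (entry ''out'' (scalar ''u'')) colour_a))
       (Do ''m'' (scalar ''u'') (Const 0) (Const 1))))"

definition mark_fm :: fm where
  "mark_fm =
     Conj (Disj (Eq (entry ''out'' (scalar ''u'')) colour_a) (Eq (entry ''out'' (scalar ''u'')) colour_b))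
       (Ex (Conj (Lt (Const 0) (entry ''m'' (var 0))) (Adj (var 0) (scalar ''u''))))"

definition mark_round :: prog where
  "mark_round = For ''u'' (When mark_fm (Do ''m'' (scalar ''u'') (Const 0) (Const 1)))"

definition swap :: prog where
  "swap = For ''u'' (When (Lt (Const 0) (entry ''m'' (scalar ''u'')))
     (Do ''out'' (scalar ''u'') (Const 0)
       (Minus (Plus colour_a colour_b) (entry ''out'' (scalar ''u'')))))"

definition stuck_fm :: fm where
  "stuck_fm = Ex (Conj (Lt (Const 0) (entry ''m'' (var 0)))
     (Conj (Adj (scalar ''c'') (var 0)) (Eq (entry ''out'' (var 0)) colour_b)))"

definition attempt :: prog where
  "attempt = Then mark_init (Then (For ''e'' mark_round)
     (When (Neg stuck_fm) (Then swap (Then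
       (Do ''out'' (scalar ''c'') (Const 0) colour_a)
       (Do ''d'' (Const 0) (Const 0) (Const 1))))))"

lemma For_rule_n:
  assumes "s0 ''n'' 0 0 = n" "I 0 s0"
    and "\<And>j s. j < n \<Longrightarrow> (\<And>y. y \<notin> insert x (writes p) \<Longrightarrow> s y = s0 y) \<Longrightarrow>
      s x 0 0 = j \<Longrightarrow> I j s \<Longrightarrow> I (Suc j) (sem p s)"
    and "\<And>j s k. I j s \<Longrightarrow> I j (store s x 0 0 k)"
  shows "I n (sem (For x p) s0)"
  using For_rule[of I s0 x p] assms by simp

text \<open>Colour 0 encodes an uncoloured vertex. As \<open>a\<close> and \<open>b\<close> are
  positive, comparing colours already confines the marking to \<open>S\<close>.\<close>

locale program_colouring = program_input E n kmax + coloured_pckp_free E S \<phi>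
  for E :: "nat \<Rightarrow> nat \<Rightarrow> bool" and n kmax S \<phi> +
  fixes v a b :: nat
  assumes S: "S \<subseteq> {..<n}" "v \<notin> S" and \<phi>: "u \<notin> S \<Longrightarrow> \<phi> u = 0" "u \<in> S \<Longrightarrow> 0 < \<phi> u"
    and ab: "0 < a" "0 < b"
begin

definition ready :: "state \<Rightarrow> bool" where
  "ready s \<longleftrightarrow> input s \<and> (\<forall>u. s ''out'' u 0 = \<phi> u) \<and> s ''c'' 0 0 = v \<and>
     Suc (s ''x'' 0 0) = a \<and> Suc (s ''y'' 0 0) = b"

definition marks :: "state \<Rightarrow> nat set" where
  "marks s = {u. u < n \<and> 0 < s ''m'' u 0}"

abbreviation R :: "nat set" where
  "R \<equiv> {u. reach v a b u}"

text \<open>One closure step; \<open>R\<close> is the least set containing the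
  \<open>a\<close>-coloured neighbours of \<open>v\<close> that is closed under it.\<close>

definition next_marks :: "nat set \<Rightarrow> nat set" where
  "next_marks M = {u\<in>S. \<phi> u \<in> {a, b} \<and> (\<exists>z\<in>M. E z u)}"

lemma ready_input: "ready s \<Longrightarrow> input s"
  unfolding ready_def by simp

lemma ready_n: "ready s \<Longrightarrow> s ''n'' 0 0 = n"
  unfolding ready_def input_def by simp

lemma ready_aval:
  assumes "ready s"
  shows "aval colour_a s = a" "aval colour_b s = b"
  using assms unfolding ready_def colour_a_def colour_b_def by simp_all

lemma ready_frame:
  assumes "ready s" "\<And>y. y \<in> {''n'', ''adj'', ''out'', ''c'', ''x'', ''y''} \<Longrightarrow> s' y = s y"
  shows "ready s'"
  using assms(1) assms(2)[of "''n''"] assms(2)[of "''adj''"] assms(2)[of "''out''"] assms(2)[of "''c''"]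
    assms(2)[of "''x''"] assms(2)[of "''y''"]
  unfolding ready_def input_def by simp

lemma ready_sem:
  assumes "ready s" "writes p \<inter> {''n'', ''adj'', ''out'', ''c'', ''x'', ''y''} = {}"
  shows "ready (sem p s)"
  using assms(1) by (rule ready_frame) (rule sem_frame, use assms(2) in blast)

lemma in_S: "\<phi> u = c \<Longrightarrow> 0 < c \<Longrightarrow> u \<in> S"
  using \<phi>(1)[of u] by (cases "u \<in> S") auto

lemma colour_nbrs_eq: "colour_nbrs v a = {u. E v u \<and> \<phi> u = a}"
  using in_S ab unfolding colour_nbrs_def by auto

lemma marks_store_other [simp]: "x \<noteq> ''m'' \<Longrightarrow> marks (store s x i j k) = marks s"
  unfolding marks_def by simp

lemma marks_store_m:
  "u < n \<Longrightarrow> marks (store s ''m'' u 0 k) = (if k = 0 then marks s - {u} else insert u (marks s))"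
  unfolding marks_def by (auto simp: store_apply)

lemma sem_mark_init:
  assumes "ready s"
  shows "marks (sem mark_init s) = colour_nbrs v a"
proof -
  let ?I = "\<lambda>j (s :: state). marks s \<inter> {..<j} = colour_nbrs v a \<inter> {..<j}"
  have "?I n (sem mark_init s)"
    unfolding mark_init_def
  proof (rule For_rule_n[where I = ?I])
    show "s ''n'' 0 0 = n" using ready_n[OF assms] .
    show "?I 0 s" by simp
    show "?I j (store s ''u'' 0 0 k)" if "?I j s" for j s k using that by simp
  next
    fix j s1
    let ?p = "Then (Do ''m'' (scalar ''u'') (Const 0) (Const 0))
     (When (Conj (Adj (scalar ''c'') (scalar ''u'')) (Eq (entry ''out'' (scalar ''u'')) colour_a))
       (Do ''m'' (scalar ''u'') (Const 0) (Const 1)))"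
    assume j: "j < n" "s1 ''u'' 0 0 = j" and I: "?I j s1"
      and frame: "\<And>y. y \<notin> insert ''u'' (writes ?p) \<Longrightarrow> s1 y = s y"
    have "ready s1" by (rule ready_frame[OF assms]) (rule frame, auto)
    define s2 where "s2 = store s1 ''m'' j 0 0"
    have s2: "ready s2" unfolding s2_def by (rule ready_frame[OF \<open>ready s1\<close>]) auto
    have u2: "s2 ''u'' 0 0 = j" using j unfolding s2_def by simp
    have "holds (Conj (Adj (scalar ''c'') (scalar ''u'')) (Eq (entry ''out'' (scalar ''u'')) colour_a)) 0 s2
        \<longleftrightarrow> j \<in> colour_nbrs v a"
      using u2 ready_aval[OF s2] ready_input[OF s2] s2 unfolding colour_nbrs_eq
      by (simp add: ready_def)
    then have "sem ?p s1 = (if j \<in> colour_nbrs v a then store s2 ''m'' j 0 1 else s2)"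
      using j(2) u2 unfolding s2_def by simp
    moreover have "marks s2 = marks s1 - {j}" using j unfolding s2_def by (simp add: marks_store_m)
    ultimately have "marks (sem ?p s1) = (if j \<in> colour_nbrs v a then insert j (marks s1) else marks s1 - {j})"
      using j by (auto simp: marks_store_m)
    then show "?I (Suc j) (sem ?p s1)" using I by (auto simp: lessThan_Suc)
  qed
  moreover have "marks s \<subseteq> {..<n}" for s unfolding marks_def by auto
  moreover have "colour_nbrs v a \<subseteq> {..<n}" using S unfolding colour_nbrs_def by auto
  ultimately show ?thesis by blast
qed

lemma next_marks_R: "M \<subseteq> R \<Longrightarrow> next_marks M \<subseteq> R"
  using step unfolding next_marks_def by blast

lemma R_least:
  assumes "colour_nbrs v a \<subseteq> M" "next_marks M \<subseteq> M"
  shows "R \<subseteq> M"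
proof
  fix u assume "u \<in> R"
  then have "reach v a b u" by simp
  then show "u \<in> M"
  proof induction
    case (start x)
    then show ?case using assms(1) by blast
  next
    case (step x y)
    then show ?case using assms(2) unfolding next_marks_def by blast
  qed
qed

text \<open>Marks are set in place, so a round can reach further than one closure step. Hence the
  result is only enclosed between \<open>next_marks\<close> and \<open>R\<close>.\<close>

lemma sem_mark_round:
  assumes "ready s"
    and "marks s \<subseteq> R"
  shows "marks s \<subseteq> marks (sem mark_round s)" "next_marks (marks s) \<subseteq> marks (sem mark_round s)"
    "marks (sem mark_round s) \<subseteq> R"
proof -
  let ?I = "\<lambda>j (s' :: state). marks s \<subseteq> marks s' \<and> next_marks (marks s) \<inter> {..<j} \<subseteq> marks s' \<and> marks s' \<subseteq> R"
  have "?I n (sem mark_round s)"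
    unfolding mark_round_def
  proof (rule For_rule_n[where I = ?I])
    show "s ''n'' 0 0 = n" using ready_n[OF assms(1)] .
    show "?I 0 s" using assms(2) by simp
    show "?I j (store s' ''u'' 0 0 k)" if "?I j s'" for j s' k using that by simp
  next
    fix j s1
    let ?p = "When mark_fm (Do ''m'' (scalar ''u'') (Const 0) (Const 1))"
    assume j: "j < n" "s1 ''u'' 0 0 = j" and I: "?I j s1"
      and frame: "\<And>y. y \<notin> insert ''u'' (writes ?p) \<Longrightarrow> s1 y = s y"
    have s1: "ready s1" by (rule ready_frame[OF assms(1)]) (rule frame, auto)
    have ra: "aval colour_a s1 = a" "aval colour_b s1 = b" using ready_aval[OF s1] .
    have out: "s1 ''out'' j 0 = \<phi> j" using s1 unfolding ready_def by simp
    have h: "holds mark_fm 0 s1 \<longleftrightarrow> j \<in> next_marks (marks s1)"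
      using j ra out in_S[of j] ab less ready_input[OF s1] ready_n[OF s1]
      unfolding next_marks_def marks_def mark_fm_def by (auto simp: store_apply)
    have mono: "next_marks (marks s) \<subseteq> next_marks (marks s1)"
      using I unfolding next_marks_def by blast
    have R: "next_marks (marks s1) \<subseteq> R" using next_marks_R I by blast
    show "?I (Suc j) (sem ?p s1)"
    proof (cases "j \<in> next_marks (marks s1)")
      case True
      then have "sem ?p s1 = store s1 ''m'' j 0 1" using h j(2) by simp
      then have "marks (sem ?p s1) = insert j (marks s1)" using j(1) by (simp add: marks_store_m)
      then show ?thesis using I True R by (auto simp: lessThan_Suc)
    next
      case False
      then have "sem ?p s1 = s1" using h by simp
      then show ?thesis using I False mono by (auto simp: lessThan_Suc)
    qed
  qed
  moreover have "next_marks (marks s) \<subseteq> {..<n}" using S unfolding next_marks_def by auto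
  ultimately show "marks s \<subseteq> marks (sem mark_round s)" "next_marks (marks s) \<subseteq> marks (sem mark_round s)"
    "marks (sem mark_round s) \<subseteq> R" by blast+
qed

text \<open>A round that adds no mark has reached the closure, so \<open>n\<close> rounds suffice.\<close>

lemma sem_mark:
  assumes "ready s" "marks s = colour_nbrs v a"
  shows "marks (sem (For ''e'' mark_round) s) = R"
proof -
  let ?I = "\<lambda>j (s :: state). colour_nbrs v a \<subseteq> marks s \<and> marks s \<subseteq> R \<and> (R \<subseteq> marks s \<or> j \<le> card (marks s))"
  have fin: "finite (marks s)" "marks s \<subseteq> {..<n}" for s unfolding marks_def by auto
  have "?I n (sem (For ''e'' mark_round) s)"
  proof (rule For_rule_n[where I = ?I])
    show "s ''n'' 0 0 = n" using ready_n[OF assms(1)] .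
    show "?I 0 s" using assms(2) start by auto
    show "?I j (store s ''e'' 0 0 k)" if "?I j s" for j s k using that by simp
  next
    fix j s1
    assume I: "?I j s1"
      and frame: "\<And>y. y \<notin> insert ''e'' (writes mark_round) \<Longrightarrow> s1 y = s y"
    have s1: "ready s1"
      by (rule ready_frame[OF assms(1)]) (rule frame, auto simp: mark_round_def)
    let ?s2 = "sem mark_round s1"
    have R: "marks s1 \<subseteq> marks ?s2" "next_marks (marks s1) \<subseteq> marks ?s2" "marks ?s2 \<subseteq> R"
      using sem_mark_round[OF s1] I by blast+
    have "R \<subseteq> marks ?s2 \<or> Suc j \<le> card (marks ?s2)"
    proof (cases "marks ?s2 = marks s1")
      case True
      then show ?thesis using R_least[of "marks s1"] I R(2) by simp
    next
      case False
      then have "card (marks s1) < card (marks ?s2)" using R(1) fin by (intro psubset_card_mono) auto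
      then show ?thesis using I R(1) by auto
    qed
    then show "?I (Suc j) ?s2" using I R by blast
  qed
  moreover have "marks s' = {..<n}" if "n \<le> card (marks s')" for s'
    using card_subset_eq[OF _ fin(2)[of s']] that card_mono[OF _ fin(2)[of s']] by simp
  moreover have "R \<subseteq> {..<n}" using reachD(1) S by blast
  ultimately show ?thesis by blast
qed

lemma sem_swap:
  assumes "ready s" "marks s = R"
  shows "sem swap s ''out'' u 0 = (if u \<in> R then a + b - \<phi> u else \<phi> u)"
proof -
  \<comment> \<open>Each vertex is visited exactly once, so no swap is undone; vertices from
    \<open>j\<close> on still have their old colour.\<close>
  let ?I = "\<lambda>j (s :: state). \<forall>u. s ''out'' u 0 = (if u \<in> R \<and> u < j then a + b - \<phi> u else \<phi> u)"
  have "?I n (sem swap s)"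
    unfolding swap_def
  proof (rule For_rule_n[where I = ?I])
    show "s ''n'' 0 0 = n" using ready_n[OF assms(1)] .
    show "?I 0 s" using assms(1) unfolding ready_def by simp
    show "?I j (store s ''u'' 0 0 k)" if "?I j s" for j s k using that by simp
  next
    fix j s1
    let ?p = "When (Lt (Const 0) (entry ''m'' (scalar ''u'')))
     (Do ''out'' (scalar ''u'') (Const 0)
       (Minus (Plus colour_a colour_b) (entry ''out'' (scalar ''u''))))"
    assume j: "j < n" "s1 ''u'' 0 0 = j" and I: "?I j s1"
      and frame: "\<And>y. y \<notin> insert ''u'' (writes ?p) \<Longrightarrow> s1 y = s y"
    have "s1 ''m'' = s ''m''" "s1 ''x'' = s ''x''" "s1 ''y'' = s ''y''"
      using frame[of "''m''"] frame[of "''x''"] frame[of "''y''"] by simp_all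
    then have "aval colour_a s1 = a" "aval colour_b s1 = b" "0 < s1 ''m'' j 0 \<longleftrightarrow> j \<in> R"
      using ready_aval[OF assms(1)] assms(2) j(1) unfolding colour_a_def colour_b_def marks_def by auto
    then have "sem ?p s1 = (if j \<in> R then store s1 ''out'' j 0 (a + b - \<phi> j) else s1)"
      using j I by simp
    then show "?I (Suc j) (sem ?p s1)" using I by (auto simp: store_apply less_Suc_eq)
  qed
  moreover have "R \<subseteq> {..<n}" using reachD(1) S by blast
  ultimately show ?thesis by auto
qed

lemma sem_attempt:
  assumes "ready s" "s ''d'' 0 0 = 0"
  shows "stuck v a b \<Longrightarrow> sem attempt s ''d'' 0 0 = 0 \<and> (\<forall>u. sem attempt s ''out'' u 0 = \<phi> u)"
    and "\<not> stuck v a b \<Longrightarrow> sem attempt s ''d'' 0 0 = 1 \<and> (\<forall>u. sem attempt s ''out'' u 0 = kempe v a b u)"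
proof -
  let ?s1 = "sem mark_init s"
  define s2 where "s2 = sem (For ''e'' mark_round) ?s1"
  have r1: "ready ?s1" by (rule ready_sem[OF assms(1)]) (simp add: mark_init_def)
  have r2: "ready s2" unfolding s2_def by (rule ready_sem[OF r1]) (simp add: mark_round_def)
  have m2: "marks s2 = R" unfolding s2_def by (rule sem_mark[OF r1 sem_mark_init[OF assms(1)]])
  have d2: "s2 ''d'' 0 0 = 0"
    using assms(2) sem_frame[of "''d''" "For ''e'' mark_round" ?s1] sem_frame[of "''d''" mark_init s]
    unfolding s2_def mark_init_def mark_round_def by simp
  have h: "holds stuck_fm 0 s2 \<longleftrightarrow> stuck v a b"
  proof -
    have "holds stuck_fm 0 s2 \<longleftrightarrow> (\<exists>u<n. 0 < s2 ''m'' u 0 \<and> E v u \<and> \<phi> u = b)"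
      using r2 ready_aval[OF r2] unfolding stuck_fm_def ready_def
      by (simp add: input_n store_apply colour_b_def)
    also have "\<dots> \<longleftrightarrow> (\<exists>u\<in>marks s2. E v u \<and> \<phi> u = b)" unfolding marks_def by blast
    also have "\<dots> \<longleftrightarrow> stuck v a b"
      unfolding m2 stuck_def colour_nbrs_def using reachD(1) by blast
    finally show ?thesis .
  qed
  have sem: "sem attempt s = (if stuck v a b then s2
      else store (store (sem swap s2) ''out'' v 0 a) ''d'' 0 0 1)"
  proof -
    have "sem swap s2 ''c'' = s2 ''c''" "sem swap s2 ''x'' = s2 ''x''"
      using sem_frame[of "''c''" swap s2] sem_frame[of "''x''" swap s2] unfolding swap_def by simp_all
    then have "sem swap s2 ''c'' 0 0 = v" "aval colour_a (sem swap s2) = a"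
      using r2 unfolding ready_def colour_a_def by simp_all
    then show ?thesis using h unfolding attempt_def by (simp add: s2_def[symmetric] del: sem.simps(4))
  qed
  show "sem attempt s ''d'' 0 0 = 0 \<and> (\<forall>u. sem attempt s ''out'' u 0 = \<phi> u)" if "stuck v a b"
    using sem that d2 r2 unfolding ready_def by simp
  show "sem attempt s ''d'' 0 0 = 1 \<and> (\<forall>u. sem attempt s ''out'' u 0 = kempe v a b u)" if "\<not> stuck v a b"
    using sem that sem_swap[OF r2 m2] unfolding kempe_def by (simp add: store_apply)
qed

end

section \<open>The search over colour pairs and the whole algorithm\<close>

definition open_fm :: fm where
  "open_fm = Conj (Lt (scalar ''d'') (Const 1))
     (Conj (Lt (scalar ''x'') (scalar ''k'')) (Lt (scalar ''y'') (scalar ''k'')))"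

definition try_pairs :: prog where
  "try_pairs = For ''x'' (For ''y'' (When open_fm attempt))"

text \<open>Position \<open>n - (j + 1)\<close> of \<open>o\<close>: vertices are coloured in
  reverse elimination order, so each is removable in the subgraph coloured together with it.\<close>

definition insert_vertex :: prog where
  "insert_vertex = Then
     (Do ''c'' (Const 0) (Const 0) (entry ''o'' (Minus (scalar ''n'') (Plus (scalar ''j'') (Const 1)))))
     (Then (Do ''d'' (Const 0) (Const 0) (Const 0))
     (Then try_pairs
       (When (Lt (scalar ''d'') (Const 1)) (Then
         (Do ''k'' (Const 0) (Const 0) (Plus (scalar ''k'') (Const 1)))
         (Do ''out'' (scalar ''c'') (Const 0) (scalar ''k''))))))"

definition colour_program :: prog where
  "colour_program = Then select (For ''j'' insert_vertex)"

lemmas prog_defs = colour_program_def insert_vertex_def try_pairs_def open_fm_def select_def attempt_def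
  mark_init_def mark_fm_def mark_round_def swap_def stuck_fm_def colour_a_def colour_b_def

lemma writes_attempt: "writes attempt = {''u'', ''m'', ''e'', ''out'', ''d''}"
  unfolding prog_defs by auto

lemma wf_colour_program: "wf_prog colour_program"
  unfolding prog_defs fm_defs by simp

context program_input
begin

text \<open>The loops run over \<open>n\<close> indices, and \<open>k \<le> n\<close> guarantees
  that they meet every pair of used colours, equal ones included. After a success \<open>d\<close>
  is 1 and all later rounds are idle.\<close>

lemma sem_try_pairs:
  assumes "coloured_pckp_free E S \<phi>" "S \<subseteq> {..<n}" "v \<notin> S" "\<And>u. u \<notin> S \<Longrightarrow> \<phi> u = 0" "\<phi> ` S \<subseteq> {1..k}"
    and s: "input s" "\<And>u. s ''out'' u 0 = \<phi> u" "s ''c'' 0 0 = v" "s ''d'' 0 0 = 0" "s ''k'' 0 0 = k"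
    and "k \<le> n"
  defines "s' \<equiv> sem try_pairs s"
  shows "(s' ''d'' 0 0 = 0 \<and> (\<forall>u. s' ''out'' u 0 = \<phi> u) \<and>
      (\<forall>a\<in>{1..k}. \<forall>b\<in>{1..k}. coloured_pckp_free.stuck E S \<phi> v a b)) \<or>
    (s' ''d'' 0 0 = 1 \<and> (\<exists>a\<in>{1..k}. \<exists>b\<in>{1..k}. \<not> coloured_pckp_free.stuck E S \<phi> v a b \<and>
      (\<forall>u. s' ''out'' u 0 = coloured_pckp_free.kempe E S \<phi> v a b u)))"
proof -
  interpret coloured_pckp_free E S \<phi> by (rule assms(1))
  define finished where "finished = (\<lambda>(s :: state). s ''d'' 0 0 = 1 \<and>
    (\<exists>a\<in>{1..k}. \<exists>b\<in>{1..k}. \<not> stuck v a b \<and> (\<forall>u. s ''out'' u 0 = kempe v a b u)))"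
  define pending where "pending = (\<lambda>P (s :: state). s ''d'' 0 0 = 0 \<and> (\<forall>u. s ''out'' u 0 = \<phi> u) \<and>
    (\<forall>(x, y)\<in>P. x < k \<longrightarrow> y < k \<longrightarrow> stuck v (Suc x) (Suc y)))"
  have store: "finished (store s x 0 0 j) = finished s" "pending P (store s x 0 0 j) = pending P s"
    if "x \<in> {''x'', ''y''}" for s P x j
  proof -
    have "x \<noteq> ''d''" "x \<noteq> ''out''" using that by auto
    then show "finished (store s x 0 0 j) = finished s" "pending P (store s x 0 0 j) = pending P s"
      unfolding finished_def pending_def by simp_all
  qed
  let ?P = "\<lambda>i. {..<i} \<times> {..<n}"
  let ?I = "\<lambda>i s. pending (?P i) s \<or> finished s"
  have "?I n s'"
    unfolding s'_def try_pairs_def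
  proof (rule For_rule_n[where I = ?I])
    show "s ''n'' 0 0 = n" using input_n[OF s(1)] .
    show "?I 0 s" using s unfolding pending_def by simp
    show "?I i (store s1 ''x'' 0 0 j)" if "?I i s1" for i s1 j using that store by simp
  next
    fix i s1
    assume i: "i < n" "s1 ''x'' 0 0 = i" and I: "?I i s1"
      and frame: "\<And>y. y \<notin> insert ''x'' (writes (For ''y'' (When open_fm attempt))) \<Longrightarrow> s1 y = s y"
    let ?Q = "\<lambda>j. ?P i \<union> {i} \<times> {..<j}"
    let ?J = "\<lambda>j s. pending (?Q j) s \<or> finished s"
    have s1: "s1 y = s y" if "y \<in> {''n'', ''adj'', ''c'', ''k''}" for y
      by (rule frame) (use that in \<open>auto simp: writes_attempt\<close>)
    have "?J n (sem (For ''y'' (When open_fm attempt)) s1)"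
    proof (rule For_rule_n[where I = ?J])
      show "s1 ''n'' 0 0 = n" using s1[of "''n''"] input_n[OF s(1)] by simp
      show "?J 0 s1" using I by simp
      show "?J j (store s2 ''y'' 0 0 l)" if "?J j s2" for j s2 l using that store by simp
    next
      fix j s2
      assume j: "j < n" "s2 ''y'' 0 0 = j" and J: "?J j s2"
        and frame: "\<And>y. y \<notin> insert ''y'' (writes (When open_fm attempt)) \<Longrightarrow> s2 y = s1 y"
      have s2: "s2 y = s y" if "y \<in> {''n'', ''adj'', ''c'', ''k''}" for y
        using s1[OF that] frame[of y] that by (auto simp: writes_attempt)
      have inp: "input s2" using s(1) s2[of "''n''"] s2[of "''adj''"] unfolding input_def by simp
      have x: "s2 ''x'' 0 0 = i" using frame[of "''x''"] i(2) by (simp add: writes_attempt)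
      have op: "holds open_fm 0 s2 \<longleftrightarrow> s2 ''d'' 0 0 = 0 \<and> i < k \<and> j < k"
        using x j(2) s2[of "''k''"] s(5) unfolding open_fm_def by simp
      show "?J (Suc j) (sem (When open_fm attempt) s2)"
      proof (cases "pending (?Q j) s2")
        case pend: True
        show ?thesis
        proof (cases "i < k \<and> j < k")
          case True
          interpret program_colouring E n kmax S \<phi> v "Suc i" "Suc j"
            by unfold_locales (use assms(2-5) in \<open>auto simp: image_subset_iff Suc_le_eq\<close>)
          have r: "ready s2"
            using inp pend s2[of "''c''"] s(3) x j(2) unfolding ready_def pending_def by simp
          have d: "s2 ''d'' 0 0 = 0" using pend unfolding pending_def by simp
          have sem: "sem (When open_fm attempt) s2 = sem attempt s2" using op True d by simp
          show ?thesis
          proof (cases "stuck v (Suc i) (Suc j)")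
            case True
            then have "pending (?Q (Suc j)) (sem attempt s2)"
              using sem_attempt(1)[OF r d True] pend unfolding pending_def by (auto simp: less_Suc_eq)
            then show ?thesis unfolding sem by simp
          next
            case False
            then have "finished (sem attempt s2)"
              using sem_attempt(2)[OF r d False] \<open>i < k \<and> j < k\<close> unfolding finished_def
              by (intro conjI bexI[of _ "Suc i"] bexI[of _ "Suc j"]) auto
            then show ?thesis unfolding sem by simp
          qed
        next
          case False
          then have "sem (When open_fm attempt) s2 = s2" using op by auto
          moreover have "pending (?Q (Suc j)) s2"
            using pend False unfolding pending_def by (auto simp: less_Suc_eq)
          ultimately show ?thesis by simp
        qed
      next
        case False
        then have fin: "finished s2" using J by blast
        then have "sem (When open_fm attempt) s2 = s2" using op unfolding finished_def by simp
        then show ?thesis using fin by simp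
      qed
    qed
    moreover have "?Q n = ?P (Suc i)" by (auto simp: less_Suc_eq)
    ultimately show "?I (Suc i) (sem (For ''y'' (When open_fm attempt)) s1)" by simp
  qed
  moreover have "stuck v a b" if "pending (?P n) s'" "a \<in> {1..k}" "b \<in> {1..k}" for a b
  proof -
    have "(a - 1, b - 1) \<in> ?P n" using that \<open>k \<le> n\<close> by auto
    then have "a - 1 < k \<longrightarrow> b - 1 < k \<longrightarrow> stuck v (Suc (a - 1)) (Suc (b - 1))"
      using that(1) unfolding pending_def by blast
    moreover have "a - 1 < k" "b - 1 < k" "Suc (a - 1) = a" "Suc (b - 1) = b" using that(2,3) by auto
    ultimately show ?thesis by simp
  qed
  ultimately show ?thesis unfolding finished_def pending_def by blast
qed

definition partial_colouring :: "(nat \<Rightarrow> nat) \<Rightarrow> nat set \<Rightarrow> nat \<Rightarrow> bool" where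
  "partial_colouring \<phi> S k \<longleftrightarrow> \<phi> ` S \<subseteq> {1..k} \<and> (\<forall>u. u \<notin> S \<longrightarrow> \<phi> u = 0) \<and>
     (\<forall>x\<in>S. \<forall>y\<in>S. E x y \<longrightarrow> \<phi> x \<noteq> \<phi> y)"

text \<open>The bound by \<open>card S\<close> keeps the colours within reach of the loops; the
  bound by \<open>kmax\<close> is the goal of the whole construction.\<close>

lemma sem_insert_vertex:
  assumes "input s" "S \<subseteq> {..<n}" "v \<notin> S" "v < n" "removable (insert v S) v"
    and "partial_colouring (labelling_output s) S (s ''k'' 0 0)" "s ''k'' 0 0 \<le> card S" "s ''k'' 0 0 \<le> kmax"
    and "s ''o'' (n - Suc (s ''j'' 0 0)) 0 = v"
  defines "s' \<equiv> sem insert_vertex s"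
  shows "partial_colouring (labelling_output s') (insert v S) (s' ''k'' 0 0)"
    and "s' ''k'' 0 0 \<le> card (insert v S)" "s' ''k'' 0 0 \<le> kmax"
proof -
  let ?k = "s ''k'' 0 0" and ?\<phi> = "labelling_output s"
  interpret coloured_pckp_free E S ?\<phi>
    by unfold_locales (use assms(6) in \<open>simp add: partial_colouring_def\<close>)
  have finS: "finite S" using assms(2) finite_subset by blast
  have "card S \<le> n" using card_mono[OF _ assms(2)] by simp
  then have kn: "?k \<le> n" using assms(7) by simp
  have zero: "?\<phi> u = 0" if "u \<notin> S" for u using assms(6) that unfolding partial_colouring_def by blast
  have range: "?\<phi> ` S \<subseteq> {1..?k}" using assms(6) unfolding partial_colouring_def by blast
  define s1 where "s1 = store (store s ''c'' 0 0 v) ''d'' 0 0 0"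
  define s2 where "s2 = sem try_pairs s1"
  have s1: "input s1" "s1 ''out'' = s ''out''" "s1 ''c'' 0 0 = v" "s1 ''d'' 0 0 = 0" "s1 ''k'' 0 0 = ?k"
    using assms(1) unfolding s1_def by (simp_all add: store_apply)
  have out1: "s1 ''out'' u 0 = ?\<phi> u" for u by (simp add: s1(2) labelling_output_def)
  have s2: "s2 ''c'' = s1 ''c''" "s2 ''k'' = s1 ''k''"
    unfolding s2_def by (rule sem_frame, simp add: try_pairs_def writes_attempt)+
  have s': "s' = (if s2 ''d'' 0 0 = 0 then store (store s2 ''k'' 0 0 (Suc ?k)) ''out'' v 0 (Suc ?k) else s2)"
    using assms(9) input_n[OF assms(1)] s1 s2 unfolding s'_def insert_vertex_def
    by (simp add: s1_def[symmetric] s2_def[symmetric] store_apply)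
  have tried: "(s2 ''d'' 0 0 = 0 \<and> (\<forall>u. s2 ''out'' u 0 = ?\<phi> u) \<and> (\<forall>a\<in>{1..?k}. \<forall>b\<in>{1..?k}. stuck v a b)) \<or>
    (s2 ''d'' 0 0 = 1 \<and> (\<exists>a\<in>{1..?k}. \<exists>b\<in>{1..?k}. \<not> stuck v a b \<and> (\<forall>u. s2 ''out'' u 0 = kempe v a b u)))"
    unfolding s2_def
    by (rule sem_try_pairs[OF coloured_pckp_free_axioms assms(2,3) zero range s1(1) out1 s1(3-5) kn])
  have "partial_colouring (labelling_output s') (insert v S) (s' ''k'' 0 0) \<and>
    s' ''k'' 0 0 \<le> card (insert v S) \<and> s' ''k'' 0 0 \<le> kmax"
  proof (cases "s2 ''d'' 0 0 = 0")
    case True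
    then have out: "\<And>u. s2 ''out'' u 0 = ?\<phi> u" and stuck: "\<And>a b. a \<in> {1..?k} \<Longrightarrow> b \<in> {1..?k} \<Longrightarrow> stuck v a b"
      using tried by auto
    \<comment> \<open>With \<open>kmax\<close> colours in use every clique has fewer than
      \<open>?k\<close> vertices, and \<open>removable_not_stuck\<close> would have provided a
      successful pair.\<close>
    have "?k < kmax"
    proof (rule ccontr)
      assume "\<not> ?k < kmax"
      then have "card K < ?k" if "K \<subseteq> insert v S" "\<forall>x\<in>K. \<forall>y\<in>K. x \<noteq> y \<longrightarrow> E x y" for K
        using clique_bound[of K] that assms(2,4) by fastforce
      then show False using removable_not_stuck[OF finS assms(3,5) range] stuck by blast
    qed
    moreover have o: "labelling_output s' = ?\<phi>(v := Suc ?k)" and k: "s' ''k'' 0 0 = Suc ?k"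
      using True out unfolding s' by (auto simp: labelling_output_def store_apply)
    have le: "?\<phi> u \<in> {1..?k}" if "u \<in> S" for u using range that by blast
    have "partial_colouring (labelling_output s') (insert v S) (s' ''k'' 0 0)"
      unfolding partial_colouring_def o k
    proof (intro conjI ballI impI allI)
      show "(?\<phi>(v := Suc ?k)) ` insert v S \<subseteq> {1..Suc ?k}" using le assms(3) by fastforce
      show "(?\<phi>(v := Suc ?k)) u = 0" if "u \<notin> insert v S" for u using that zero by simp
      fix x y assume "x \<in> insert v S" "y \<in> insert v S" "E x y"
      then show "(?\<phi>(v := Suc ?k)) x \<noteq> (?\<phi>(v := Suc ?k)) y"
        using le[of x] le[of y] proper[of x y] by (cases "x = v"; cases "y = v") auto
    qed
    ultimately show ?thesis using k assms(3,7) finS by simp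
  next
    case False
    then obtain a b where ab: "a \<in> {1..?k}" "b \<in> {1..?k}" "\<not> stuck v a b" "\<And>u. s2 ''out'' u 0 = kempe v a b u"
      using tried by auto
    have o: "labelling_output s' = kempe v a b" and k: "s' ''k'' 0 0 = ?k"
      using False ab(4) s2 s1 unfolding s' by (auto simp: labelling_output_def)
    have "partial_colouring (labelling_output s') (insert v S) (s' ''k'' 0 0)"
      unfolding partial_colouring_def o k
    proof (intro conjI ballI impI allI)
      show "kempe v a b ` insert v S \<subseteq> {1..?k}" using kempe_range[OF range ab(1,2)] .
      show "kempe v a b u = 0" if "u \<notin> insert v S" for u
        using that zero reachD(1)[of v a b u] unfolding kempe_def by auto
      show "kempe v a b x \<noteq> kempe v a b y" if "x \<in> insert v S" "y \<in> insert v S" "E x y" for x y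
        using kempe_proper[OF assms(3) ab(3) that] .
    qed
    then show ?thesis using k assms(3,7,8) finS by simp
  qed
  then show "partial_colouring (labelling_output s') (insert v S) (s' ''k'' 0 0)"
    "s' ''k'' 0 0 \<le> card (insert v S)" "s' ''k'' 0 0 \<le> kmax" by blast+
qed

lemma sem_colour_program:
  assumes "input s" "\<And>y i j. y \<in> {''a'', ''out'', ''k''} \<Longrightarrow> s y i j = 0"
  shows "\<exists>k\<le>kmax. partial_colouring (labelling_output (sem colour_program s)) {..<n} k"
proof -
  define s0 where "s0 = sem select s"
  let ?f = "order s0"
  have "alive s = {..<n}" using assms(2) unfolding alive_def by auto
  then have elim: "elimination ?f n" unfolding s0_def by (rule sem_select[OF assms(1)])
  have frame0: "s0 y = s y" if "y \<in> {''n'', ''adj'', ''out'', ''k''}" for y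
    unfolding s0_def by (rule sem_frame) (use that in \<open>auto simp: select_def\<close>)
  \<comment> \<open>After \<open>j\<close> insertions the coloured vertices are the last
    \<open>j\<close> of the elimination order.\<close>
  let ?S = "\<lambda>j. rest ?f (n - j)"
  let ?I = "\<lambda>j s. partial_colouring (labelling_output s) (?S j) (s ''k'' 0 0) \<and>
    s ''k'' 0 0 \<le> card (?S j) \<and> s ''k'' 0 0 \<le> kmax"
  have "?I n (sem (For ''j'' insert_vertex) s0)"
  proof (rule For_rule_n[where I = ?I])
    show "s0 ''n'' 0 0 = n" using frame0[of "''n''"] input_n[OF assms(1)] by simp
    show "?I 0 s0"
      using elimination_rest_n[OF elim] frame0[of "''out''"] frame0[of "''k''"] assms(2)
      by (simp add: partial_colouring_def labelling_output_def)
    show "?I j (store s1 ''j'' 0 0 k)" if "?I j s1" for j s1 k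
    proof -
      have "labelling_output (store s1 ''j'' 0 0 k) = labelling_output s1" by (rule ext) (simp add: labelling_output_def)
      then show ?thesis using that by simp
    qed
  next
    fix j s1
    assume j: "j < n" "s1 ''j'' 0 0 = j" and I: "?I j s1"
      and frame: "\<And>y. y \<notin> insert ''j'' (writes insert_vertex) \<Longrightarrow> s1 y = s0 y"
    have fr: "s1 y = s0 y" if "y \<in> {''n'', ''adj'', ''o''}" for y
      by (rule frame) (use that in \<open>auto simp: insert_vertex_def try_pairs_def writes_attempt\<close>)
    define i where "i = n - Suc j"
    have i: "n - j = Suc i" "n - Suc j = i" "i < n" using j(1) unfolding i_def by auto
    have v: "?f i \<in> rest ?f i" "removable (rest ?f i) (?f i)"
      using elim i(3) unfolding elimination_def by auto
    have ins: "insert (?f i) (rest ?f (Suc i)) = rest ?f i" using v(1) by (auto simp: rest_Suc)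
    have inp: "input s1"
      using assms(1) fr[of "''n''"] fr[of "''adj''"] frame0[of "''n''"] frame0[of "''adj''"]
      unfolding input_def by simp
    have sub: "rest ?f l \<subseteq> {..<n}" for l unfolding rest_def by auto
    have "?f i < n" using v(1) sub by blast
    moreover have "?f i \<notin> rest ?f (Suc i)" by (simp add: rest_Suc)
    moreover have "s1 ''o'' (n - Suc (s1 ''j'' 0 0)) 0 = ?f i"
      using fr[of "''o''"] j(2) i(2) unfolding order_def by simp
    ultimately show "?I (Suc j) (sem insert_vertex s1)"
      using sem_insert_vertex[OF inp sub, of "?f i" "Suc i"] v(2) I i(1,2) unfolding ins by simp
  qed
  moreover have "?S n = {..<n}" unfolding rest_def by simp
  ultimately show ?thesis unfolding colour_program_def sem.simps(2) s0_def by auto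
qed

end

theorem corollary1p1:
  shows "(\<exists>c. poly_time_labelling c
            (\<lambda>G. free_of G {path_graph 7, cycle_graph 5, kite, paraglider})
            (\<lambda>G \<phi>. coloring G (clique_number G + 1) \<phi>))
       \<and> (\<forall>G :: 'a graph. simple_graph G \<and>
            free_of G {path_graph 7, cycle_graph 5, kite, paraglider} \<longrightarrow>
            chromatic_number G \<le> clique_number G + 1)"
proof (rule conjI)
  show "\<forall>G :: 'a graph. simple_graph G \<and> free_of G {path_graph 7, cycle_graph 5, kite, paraglider} \<longrightarrow>
      chromatic_number G \<le> clique_number G + 1"
    using chromatic_number_bound by blast
  show "\<exists>c. poly_time_labelling c
            (\<lambda>G. free_of G {path_graph 7, cycle_graph 5, kite, paraglider})
            (\<lambda>G \<phi>. coloring G (clique_number G + 1) \<phi>)"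
    unfolding poly_time_labelling_def
  proof (intro exI[of _ "compile colour_program"] exI[of _ "cost colour_program"] allI impI, elim conjE exE)
    fix G :: "nat graph" and n
    assume G: "simple_graph G" "verts G = {..<n}"
      and free: "free_of G {path_graph 7, cycle_graph 5, kite, paraglider}"
    let ?s = "graph_input G"
    interpret pckp_free "adjacent G" using pckp_free_adjacent[OF G(1) free] .
    interpret program_input "adjacent G" n "clique_number G + 1"
      by unfold_locales (use simple_graphD(1)[OF G(1)] card_less_clique_number[OF G(1)] G(2) in auto)
    have inp: "input ?s" using G(2) unfolding input_def graph_input_def by simp
    have zero: "?s y i j = 0" if "y \<in> {''a'', ''out'', ''k''}" for y i j
      using that unfolding graph_input_def by auto
    obtain k where k: "k \<le> clique_number G + 1" "partial_colouring (labelling_output (sem colour_program ?s)) {..<n} k"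
      using sem_colour_program[OF inp zero] by blast
    obtain t s' where s': "exec (compile colour_program) ?s t s'" "t \<le> poly (cost colour_program) (?s ''n'' 0 0)"
      "agree 0 s' (sem colour_program ?s)"
      using exec_compile[OF wf_colour_program agree_refl] by blast
    \<comment> \<open>The cost is a polynomial in the number of vertices; its natural coefficients
      make it monotone, so the larger graph size may replace that number.\<close>
    have "?s ''n'' 0 0 \<le> graph_size G" unfolding graph_input_def graph_size_def by simp
    then have "t \<le> poly (cost colour_program) (graph_size G)" using s'(2) poly_nat_mono le_trans by blast
    moreover have "labelling_output s' = labelling_output (sem colour_program ?s)"
      using s'(3) unfolding labelling_output_def agree_def by auto
    then have "coloring G (clique_number G + 1) (labelling_output s')"
      using k G(2) unfolding coloring_def partial_colouring_def by fastforce
    ultimately show "\<exists>t s. exec (compile colour_program) ?s t s \<and> t \<le> poly (cost colour_program) (graph_size G) \<and>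
        coloring G (clique_number G + 1) (labelling_output s)"
      using s'(1) by blast
  qed
qed

end
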